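(* Let $B$ be a unital commutative semiprime complex Banach algebra, and let $T$ be a bounded unital endomorphism of $B$. Then $T$ is quasicompact if and only if there is a natural number $n \geq 1$ such that the operators $(T^{kn})_{k=1}^\infty$ converge in operator norm to a finite-rank unital endomorphism of $B$.
   Context: All algebras are complex. A complex algebra $B$ is semiprime if $J=\{0\}$ is the only ideal of $B$ such that the product of every pair of elements of $J$ is $0$; a commutative complex algebra is semiprime if and only if it has no non-zero nilpotent elements. An endomorphism of a commutative Banach algebra $A$ is a linear map $A\to A$ preserving multiplication; if $A$ is unital, an endomorphism is unital if it maps the identity to itself. A bounded linear operator $T$ on an infinite-dimensional Banach space $E$ is quasicompact if its essential spectral radius $\rho_e(T)$, i.e. the spectral radius of $T+\mathcal{K}(E)$ in the Calkin algebra $\mathcal{L}(E)/\mathcal{K}(E)$, satisfies $\rho_e(T)<1$. Here $\mathcal{L}(E)$ is the algebra of bounded linear operators on $E$ and $\mathcal{K}(E)$ is the ideal of compact operators. Equivalently, there is a natural number $n\ge 1$ such that the operator-norm distance from $T^n$ to $\mathcal{K}(E)$ is strictly less than $1$. If $E$ is finite-dimensional, every operator on $E$ is regarded as quasicompact (the distance condition holds trivially). *)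

theory Defs
  imports "HOL-Analysis.Analysis" "HOL-Algebra.QuotRing"
begin

class complex_vector = real_vector +
  fixes scaleC :: "complex \<Rightarrow> 'a \<Rightarrow> 'a"  (infixr \<open>*\<^sub>C\<close> 75)
  assumes scaleC_add_right: "a *\<^sub>C (x + y) = a *\<^sub>C x + a *\<^sub>C y"
    and scaleC_add_left: "(a + b) *\<^sub>C x = a *\<^sub>C x + b *\<^sub>C x"
    and scaleC_scaleC: "a *\<^sub>C b *\<^sub>C x = (a * b) *\<^sub>C x"
    and scaleC_one: "1 *\<^sub>C x = x"
    and scaleC_of_real: "complex_of_real r *\<^sub>C x = r *\<^sub>R x"

class complex_algebra = complex_vector + real_algebra +
  assumes mult_scaleC_left: "(a *\<^sub>C x) * y = a *\<^sub>C (x * y)"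
    and mult_scaleC_right: "x * (a *\<^sub>C y) = a *\<^sub>C (x * y)"

class complex_normed_vector = complex_vector + real_normed_vector +
  assumes norm_scaleC: "norm (a *\<^sub>C x) = cmod a * norm x"

class complex_banach_algebra =
  complex_algebra + complex_normed_vector + real_normed_algebra + banach

(* The algebra may be zero, and the identity need not have norm 1. *)
class unital_comm_complex_banach_algebra = complex_banach_algebra + comm_monoid_mult

definition algebra_ideal :: "'a::complex_algebra set \<Rightarrow> bool" where
  "algebra_ideal J \<longleftrightarrow>
     module.subspace scaleC J \<and> (\<forall>a. \<forall>x\<in>J. a * x \<in> J \<and> x * a \<in> J)"

definition semiprime :: "'a::complex_algebra itself \<Rightarrow> bool" where
  "semiprime _ \<longleftrightarrow>
     (\<forall>J :: 'a set. algebra_ideal J \<and> (\<forall>x\<in>J. \<forall>y\<in>J. x * y = 0) \<longrightarrow> J = {0})"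

definition endomorphism :: "('a::complex_algebra \<Rightarrow> 'a) \<Rightarrow> bool" where
  "endomorphism T \<longleftrightarrow>
     Vector_Spaces.linear scaleC scaleC T \<and> (\<forall>x y. T (x * y) = T x * T y)"

definition unital_endomorphism ::
    "('a::unital_comm_complex_banach_algebra \<Rightarrow> 'a) \<Rightarrow> bool" where
  "unital_endomorphism T \<longleftrightarrow> endomorphism T \<and> T 1 = 1"

definition finite_dimensional :: "'a::complex_vector set \<Rightarrow> bool" where
  "finite_dimensional V \<longleftrightarrow> (\<exists>S. finite S \<and> V = module.span scaleC S)"

definition finite_rank :: "('a::complex_vector \<Rightarrow> 'a) \<Rightarrow> bool" where
  "finite_rank T \<longleftrightarrow> finite_dimensional (range T)"

definition bounded_operator :: "('a::complex_normed_vector \<Rightarrow> 'a) \<Rightarrow> bool" where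
  "bounded_operator T \<longleftrightarrow>
     Vector_Spaces.linear scaleC scaleC T \<and> (\<exists>C. \<forall>x. norm (T x) \<le> C * norm x)"

definition compact_operator :: "('a::complex_normed_vector \<Rightarrow> 'a) \<Rightarrow> bool" where
  "compact_operator T \<longleftrightarrow> bounded_operator T \<and> compact (closure (T ` cball 0 1))"

definition operator_ring :: "('a::complex_normed_vector \<Rightarrow> 'a) ring" where
  "operator_ring =
     \<lparr>carrier = Collect bounded_operator, mult = (\<circ>), one = id,
      zero = (\<lambda>x. 0), add = (\<lambda>S T x. S x + T x)\<rparr>"

definition calkin_ring :: "('a::complex_normed_vector \<Rightarrow> 'a) set ring" where
  "calkin_ring = operator_ring Quot (Collect compact_operator)"

definition calkin_class ::
    "('a::complex_normed_vector \<Rightarrow> 'a) \<Rightarrow> ('a \<Rightarrow> 'a) set" where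
  "calkin_class T = Collect compact_operator +>\<^bsub>operator_ring\<^esub> T"

(* The spectrum of the class of T in the Calkin algebra; the class of z I - T is
   z times the identity of the Calkin algebra minus the class of T. *)
definition essential_spectrum :: "('a::complex_normed_vector \<Rightarrow> 'a) \<Rightarrow> complex set" where
  "essential_spectrum T = {z. calkin_class (\<lambda>x. z *\<^sub>C x - T x) \<notin> Units calkin_ring}"

(* Only meaningful on an infinite-dimensional Banach space, where the essential spectrum of
   a bounded operator is non-empty and bounded; in finite dimension the Calkin algebra is
   zero, the essential spectrum is empty and Sup is unspecified. *)
definition essential_spectral_radius :: "('a::complex_normed_vector \<Rightarrow> 'a) \<Rightarrow> real" where
  "essential_spectral_radius T = Sup (cmod ` essential_spectrum T)"

definition quasicompact :: "('a::complex_normed_vector \<Rightarrow> 'a) \<Rightarrow> bool" where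
  "quasicompact T \<longleftrightarrow> bounded_operator T \<and>
     (finite_dimensional (UNIV :: 'a set) \<or> essential_spectral_radius T < 1)"

(* onorm is the operator norm only on bounded operators, hence the first two conjuncts. *)
definition converges_in_operator_norm ::
    "(nat \<Rightarrow> 'a::complex_normed_vector \<Rightarrow> 'a) \<Rightarrow> ('a \<Rightarrow> 'a) \<Rightarrow> bool" where
  "converges_in_operator_norm U S \<longleftrightarrow>
     (\<forall>k. bounded_operator (U k)) \<and> bounded_operator S \<and>
     (\<lambda>k. onorm (\<lambda>x. U k x - S x)) \<longlonglongrightarrow> 0"

end

theory Submission
  imports Defs
begin

text \<open>
  Everything rests on one consequence of quasicompactness: some power of \<open>T\<close> maps the unit ball
  into finitely many balls of a radius \<open>c < 1\<close> (\<open>quasi_precompact\<close>), so that high powers map it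
  into finitely many arbitrarily small balls.

  This gives two kinds of finiteness. By Riesz's lemma, the length of a flag of subspaces on
  which \<open>T\<close> is triangular with diagonal entries of modulus at least \<open>1\<close> is bounded
  (\<open>triangular_chain_length_bounded\<close>). And a bounded sequence \<open>x\<^sub>i\<close> for which \<open>z x\<^sub>i - T x\<^sub>i\<close>
  converges, with \<open>\<bar>z\<bar> \<ge> 1\<close>, has a convergent subsequence (\<open>quasi_precompact_subsequence\<close>); hence
  \<open>z - T\<close> is bounded below or \<open>z\<close> is an eigenvalue.

  Multiplicativity turns the first kind of finiteness into information about eigenvalues. If \<open>x\<close>
  is an eigenvector for \<open>z\<close> with \<open>\<bar>z\<bar> \<ge> 1\<close>, then every \<open>x\<^sup>k\<close> is one for \<open>z\<^sup>k\<close>, and it is nonzero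
  because a semiprime commutative algebra has no nilpotents; so \<open>z\<close> is a root of unity of bounded
  order. A power \<open>V\<close> of \<open>T\<close> therefore has no eigenvalue of modulus at least \<open>1\<close> except possibly \<open>1\<close>.
  If \<open>V x = x + y\<close> with \<open>V y = y \<noteq> 0\<close>, the monomials \<open>x\<^sup>k y\<^sup>N\<^sup>-\<^sup>k\<close> span a flag that is too long, so
  \<open>V\<close> has no Jordan block at \<open>1\<close> (\<open>fixed_space_semisimple\<close>).

  Then the Abel means \<open>\<epsilon> (1 + \<epsilon> - V)\<^sup>-\<^sup>1\<close> converge in norm, as \<open>\<epsilon>\<close> decreases to \<open>0\<close>, to a projection \<open>P\<close>
  onto the finite-dimensional fixed space of \<open>V\<close> (\<open>fixed_space_projection\<close>). The operator \<open>V - P\<close>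
  has no eigenvalue of modulus at least \<open>1\<close> left, so one of its powers is a contraction, and
  \<open>V\<^sup>k\<^sup>n - P = (V - P)\<^sup>k\<^sup>n\<close> tends to \<open>0\<close> for a suitable \<open>n\<close>. A limit of unital endomorphisms is one.

  The link between spectra and norms of powers is
  \<open>power_small_if_resolvent_everywhere\<close>: if \<open>z - t\<close> is invertible for all \<open>\<bar>z\<bar> \<ge> \<rho>\<close>, then \<open>t\<^sup>n\<close> has
  norm less than \<open>\<rho>\<^sup>n\<close> for some \<open>n\<close>. It is proved for a seminorm, by averaging the resolvent over roots of
  unity, without function theory and without forming a quotient algebra. For the operator norm it
  gives the contraction above; for the distance to the compact operators it translates the
  essential spectral radius, and it also shows that the essential spectrum is nonempty in
  infinite dimension.

  For the converse, \<open>T\<^sup>m = S + D\<close> with \<open>S\<close> of finite rank and \<open>\<parallel>D\<parallel> < 1\<close>, and the Neumann series of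
  \<open>z\<^sup>m - D\<close> inverts \<open>z - T\<close> modulo compact operators whenever \<open>\<bar>z\<bar>\<^sup>m > \<parallel>D\<parallel>\<close>.
\<close>

section \<open>Resolvents and powers under a seminorm\<close>

interpretation cvs: vector_space "scaleC :: complex \<Rightarrow> 'a \<Rightarrow> 'a::complex_vector"
  by unfold_locales (simp_all add: scaleC_add_right scaleC_add_left scaleC_scaleC scaleC_one)

lemma scaleC_minus_one: "(- 1) *\<^sub>C (x::'a::complex_vector) = - x"
  by (metis cvs.scale_minus_left scaleC_one)

lemma root_of_unity_power:
  assumes "0 < n"
  shows "cis (2 * pi * real j / real n) ^ n = 1"
  unfolding Complex.DeMoivre using assms
  by (simp add: cis_multiple_2pi)

lemma sum_roots_of_unity_power:
  assumes "0 < k" "k < n"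
  shows "(\<Sum>j<n. cis (2 * pi * real j / real n) ^ k) = 0"
proof -
  define w where "w = cis (2 * pi * real k / real n)"
  have eq: "cis (2 * pi * real j / real n) ^ k = w ^ j" for j
    unfolding w_def Complex.DeMoivre by (simp add: mult_ac)
  have "w \<noteq> 1"
  proof
    assume "w = 1"
    then have "cos (2 * pi * real k / real n) = 1" by (simp add: w_def complex_eq_iff)
    then obtain m :: int where m: "2 * pi * real k / real n = of_int m * 2 * pi"
      using cos_one_2pi_int by blast
    then have "real k = of_int m * real n" using assms by (simp add: field_simps)
    then have "int k = m * int n"
      by (metis of_int_eq_iff of_int_mult of_int_of_nat_eq)
    then have "n dvd k"
      by (metis dvd_triv_right int_dvd_int_iff)
    then show False using assms nat_dvd_not_less by blast
  qed
  moreover have "w ^ n = 1"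
    unfolding w_def using assms by (intro root_of_unity_power) auto
  ultimately show ?thesis by (simp add: eq geometric_sum)
qed

text \<open>
  The seminorm may have a kernel: with the distance to the compact operators as \<open>p\<close>, computing
  up to elements of seminorm zero is computing in the Calkin algebra.
\<close>

locale unital_seminorm =
  fixes p :: "'r::{complex_algebra, monoid_mult} \<Rightarrow> real"
  assumes triangle: "p (x + y) \<le> p x + p y"
    and scaleC: "p (z *\<^sub>C x) = cmod z * p x"
    and submult: "p (x * y) \<le> p x * p y"
    and one_le: "p 1 \<le> 1"
begin

lemma zero: "p 0 = 0"
  using scaleC[of 0 0] by simp

lemma minus: "p (- x) = p x"
  using scaleC[of "-1" x] by (simp add: scaleC_minus_one)

lemma nonneg: "0 \<le> p x"
  using triangle[of x "- x"] by (simp add: zero minus)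

lemma diff: "p (x - y) \<le> p x + p y"
  using triangle[of x "- y"] by (simp add: minus)

lemma sum_le: "p (sum f A) \<le> (\<Sum>i\<in>A. p (f i))"
proof (induction A rule: infinite_finite_induct)
  case (insert a A)
  then show ?case using triangle[of "f a" "sum f A"] by simp
qed (auto simp: zero)

lemma power_le: "p (x ^ n) \<le> p x ^ n"
proof (induction n)
  case (Suc n)
  have "p (x ^ Suc n) \<le> p x * p (x ^ n)" using submult by simp
  also have "\<dots> \<le> p x * p x ^ n" using Suc nonneg by (intro mult_left_mono)
  finally show ?case by simp
qed (use one_le in simp)

definition sim :: "'r \<Rightarrow> 'r \<Rightarrow> bool" where "sim x y \<longleftrightarrow> p (x - y) = 0"

lemma sim_refl [simp]: "sim x x" by (simp add: sim_def zero)

lemma sim_sym: "sim x y \<Longrightarrow> sim y x"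
  using minus[of "x - y"] by (simp add: sim_def)

lemma sim_trans [trans]: "sim x y \<Longrightarrow> sim y z \<Longrightarrow> sim x z"
  using triangle[of "x - y" "y - z"] nonneg[of "x - z"] by (simp add: sim_def)

lemma sim_add: "sim x y \<Longrightarrow> sim x' y' \<Longrightarrow> sim (x + x') (y + y')"
  using triangle[of "x - y" "x' - y'"] nonneg[of "x + x' - (y + y')"]
  by (simp add: sim_def algebra_simps)

lemma sim_diff: "sim x y \<Longrightarrow> sim x' y' \<Longrightarrow> sim (x - x') (y - y')"
  using diff[of "x - y" "x' - y'"] nonneg[of "x - x' - (y - y')"]
  by (simp add: sim_def algebra_simps)

lemma sim_scaleC: "sim x y \<Longrightarrow> sim (z *\<^sub>C x) (z *\<^sub>C y)"
  using scaleC[of z "x - y"] by (simp add: sim_def cvs.scale_right_diff_distrib)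

lemma sim_mult: "sim x y \<Longrightarrow> sim x' y' \<Longrightarrow> sim (x * x') (y * y')"
proof -
  assume "sim x y" "sim x' y'"
  have "p (x * x' - y * x') \<le> p (x - y) * p x'"
    using submult[of "x - y" x'] by (simp add: algebra_simps)
  then have "sim (x * x') (y * x')"
    using \<open>sim x y\<close> nonneg[of "x * x' - y * x'"] by (simp add: sim_def)
  moreover have "p (y * x' - y * y') \<le> p y * p (x' - y')"
    using submult[of y "x' - y'"] by (simp add: algebra_simps)
  then have "sim (y * x') (y * y')"
    using \<open>sim x' y'\<close> nonneg[of "y * x' - y * y'"] by (simp add: sim_def)
  ultimately show ?thesis by (rule sim_trans)
qed

lemma sim_sum: "(\<And>i. i \<in> A \<Longrightarrow> sim (f i) (g i)) \<Longrightarrow> sim (sum f A) (sum g A)"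
  by (induction A rule: infinite_finite_induct) (auto intro: sim_add)

lemma sim_eq: "sim x y \<Longrightarrow> p x = p y"
  using triangle[of "x - y" y] triangle[of "y - x" x] minus[of "x - y"]
  by (simp add: sim_def)

end

text \<open>
  The polynomial quotient \<open>(z\<^sup>n - t\<^sup>n) / (z - t)\<close>.
\<close>

definition geometric_quotient :: "complex \<Rightarrow> 'r::{complex_algebra, monoid_mult} \<Rightarrow> nat \<Rightarrow> 'r" where
  "geometric_quotient z t n = (\<Sum>i<n. z ^ (n - 1 - i) *\<^sub>C t ^ i)"

lemma scaleC_geometric_quotient:
  "z *\<^sub>C geometric_quotient z t n = (\<Sum>i<n. z ^ (n - i) *\<^sub>C t ^ i)"
  unfolding geometric_quotient_def cvs.scale_sum_right
  by (intro sum.cong refl) (auto simp: scaleC_scaleC Suc_diff_Suc simp flip: power_Suc)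

lemma geometric_quotient_0: "geometric_quotient z t 0 = 0"
  by (simp add: geometric_quotient_def)

lemma geometric_quotient_Suc:
  "geometric_quotient z t (Suc n) = z *\<^sub>C geometric_quotient z t n + t ^ n"
  unfolding scaleC_geometric_quotient by (simp add: geometric_quotient_def scaleC_one)

lemma geometric_quotient_left:
  "(z *\<^sub>C 1 - t) * geometric_quotient z t n = z ^ n *\<^sub>C 1 - t ^ n"
proof (induction n)
  case (Suc n)
  have "(z *\<^sub>C 1 - t) * geometric_quotient z t (Suc n)
     = z *\<^sub>C (z ^ n *\<^sub>C 1 - t ^ n) + (z *\<^sub>C 1 - t) * t ^ n"
    unfolding geometric_quotient_Suc distrib_left mult_scaleC_right Suc ..
  then show ?case
    by (simp add: algebra_simps mult_scaleC_left cvs.scale_right_diff_distrib scaleC_scaleC)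
qed (simp add: geometric_quotient_0 scaleC_one)

lemma geometric_quotient_commute:
  "geometric_quotient z t n * t = t * geometric_quotient z t n"
  unfolding geometric_quotient_def sum_distrib_left sum_distrib_right
  by (intro sum.cong refl) (simp add: mult_scaleC_left mult_scaleC_right power_commutes)

lemma geometric_quotient_right:
  "geometric_quotient z t n * (z *\<^sub>C 1 - t) = z ^ n *\<^sub>C 1 - t ^ n"
  using geometric_quotient_left[of z t n]
  by (simp add: algebra_simps mult_scaleC_left mult_scaleC_right geometric_quotient_commute)

text \<open>
  Averaging over the rotations of \<open>a\<close> by \<open>n\<close>-th roots of unity keeps, of all monomials
  \<open>z\<^sup>n\<^sup>-\<^sup>i t\<^sup>i\<close>, only the one with \<open>i = 0\<close>.
\<close>

lemma sum_geometric_quotient_over_roots: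
  assumes "0 < n"
  defines "\<zeta> \<equiv> \<lambda>j. cis (2 * pi * real j / real n)"
  shows "(\<Sum>j<n. (a * \<zeta> j) *\<^sub>C geometric_quotient (a * \<zeta> j) t n) = of_nat n *\<^sub>C a ^ n *\<^sub>C 1"
proof -
  have "(\<Sum>j<n. (a * \<zeta> j) *\<^sub>C geometric_quotient (a * \<zeta> j) t n)
    = (\<Sum>i<n. (\<Sum>j<n. (a * \<zeta> j) ^ (n - i)) *\<^sub>C t ^ i)"
    unfolding scaleC_geometric_quotient by (subst sum.swap) (simp add: cvs.scale_sum_left)
  also have "\<dots> = (\<Sum>i<n. if i = 0 then of_nat n *\<^sub>C a ^ n *\<^sub>C 1 else 0)"
  proof (intro sum.cong refl)
    fix i assume "i \<in> {..<n}"
    have sum: "(\<Sum>j<n. (a * \<zeta> j) ^ (n - i)) = a ^ (n - i) * (\<Sum>j<n. \<zeta> j ^ (n - i))"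
      unfolding power_mult_distrib sum_distrib_left ..
    show "(\<Sum>j<n. (a * \<zeta> j) ^ (n - i)) *\<^sub>C t ^ i =
      (if i = 0 then of_nat n *\<^sub>C a ^ n *\<^sub>C 1 else 0)"
    proof (cases "i = 0")
      case True
      have "\<zeta> j ^ n = 1" for j unfolding \<zeta>_def by (rule root_of_unity_power[OF \<open>0 < n\<close>])
      then have "(\<Sum>j<n. (a * \<zeta> j) ^ n) = of_nat n * a ^ n" by (simp add: power_mult_distrib)
      then show ?thesis using True by (simp add: scaleC_scaleC)
    next
      case False
      then show ?thesis
        unfolding sum using sum_roots_of_unity_power[of "n - i" n] \<open>i \<in> {..<n}\<close> by (simp add: \<zeta>_def)
    qed
  qed
  also have "\<dots> = of_nat n *\<^sub>C a ^ n *\<^sub>C 1"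
    using \<open>0 < n\<close> by (simp add: sum.delta')
  finally show ?thesis .
qed

context unital_seminorm
begin

text \<open>
  The average of \<open>z R(z)\<close> over \<open>n\<close> equally spaced points of the circle of radius \<open>r\<close> is
  \<open>r\<^sup>n (r\<^sup>n - t\<^sup>n)\<^sup>-\<^sup>1\<close>. This replaces Cauchy's integral formula.
\<close>

lemma resolvent_average:
  assumes "0 < r" "0 < n"
    and R: "\<And>z. cmod z = r \<Longrightarrow> sim (R z * (z *\<^sub>C 1 - t)) 1"
  defines "f \<equiv> inverse (of_nat n) *\<^sub>C (\<Sum>j<n. (of_real r * cis (2 * pi * real j / real n)) *\<^sub>C
              R (of_real r * cis (2 * pi * real j / real n)))"
  shows "sim (f * (of_real (r ^ n) *\<^sub>C 1 - t ^ n)) (of_real (r ^ n) *\<^sub>C 1)"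
proof -
  define z where "z j = of_real r * cis (2 * pi * real j / real n)" for j
  have zn: "z j ^ n = of_real (r ^ n)" for j
    using \<open>0 < n\<close> by (simp add: z_def power_mult_distrib root_of_unity_power)
  have "sim (R (z j) * (z j ^ n *\<^sub>C 1 - t ^ n)) (geometric_quotient (z j) t n)" for j
  proof -
    have "cmod (z j) = r" using \<open>0 < r\<close> by (simp add: z_def norm_mult)
    from sim_mult[OF R[OF this] sim_refl[of "geometric_quotient (z j) t n"]]
    show ?thesis by (simp add: mult.assoc geometric_quotient_left)
  qed
  then have "sim (\<Sum>j<n. z j *\<^sub>C (R (z j) * (of_real (r ^ n) *\<^sub>C 1 - t ^ n)))
                 (\<Sum>j<n. z j *\<^sub>C geometric_quotient (z j) t n)"
    unfolding zn by (intro sim_sum sim_scaleC)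
  also have "(\<Sum>j<n. z j *\<^sub>C geometric_quotient (z j) t n) = of_nat n *\<^sub>C of_real (r ^ n) *\<^sub>C 1"
    unfolding z_def of_real_power by (rule sum_geometric_quotient_over_roots[OF \<open>0 < n\<close>])
  finally have "sim (inverse (of_nat n) *\<^sub>C (\<Sum>j<n. z j *\<^sub>C (R (z j) * (of_real (r ^ n) *\<^sub>C 1 - t ^ n))))
      (inverse (of_nat n) *\<^sub>C of_nat n *\<^sub>C of_real (r ^ n) *\<^sub>C 1)"
    by (rule sim_scaleC)
  moreover have "inverse (of_nat n) *\<^sub>C of_nat n *\<^sub>C of_real (r ^ n) *\<^sub>C (1::'r) = of_real (r ^ n) *\<^sub>C 1"
  proof -
    have "inverse (of_nat n) * (of_nat n * complex_of_real (r ^ n)) = of_real (r ^ n)"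
      using \<open>0 < n\<close> by (simp add: field_simps)
    then show ?thesis by (simp only: scaleC_scaleC)
  qed
  moreover have "f = inverse (of_nat n) *\<^sub>C (\<Sum>j<n. z j *\<^sub>C R (z j))"
    unfolding f_def z_def ..
  ultimately show ?thesis
    by (simp only: mult_scaleC_left sum_distrib_right)
qed

lemma resolvent_identity:
  assumes "sim (a * (z *\<^sub>C 1 - t)) 1" "sim ((w *\<^sub>C 1 - t) * b) 1"
  shows "sim (a - b) ((w - z) *\<^sub>C (a * b))"
proof -
  have "sim (a * ((w *\<^sub>C 1 - t) * b) - (a * (z *\<^sub>C 1 - t)) * b) (a * 1 - 1 * b)"
    by (intro sim_diff sim_mult assms sim_refl)
  moreover have "a * ((w *\<^sub>C 1 - t) * b) - (a * (z *\<^sub>C 1 - t)) * b = (w - z) *\<^sub>C (a * b)"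
    by (simp add: algebra_simps mult_scaleC_left mult_scaleC_right cvs.scale_left_diff_distrib)
  ultimately show ?thesis by (simp add: sim_sym)
qed

text \<open>
  By the resolvent identity \<open>p (R z) \<le> 2 p (R w)\<close> for \<open>z\<close> close to \<open>w\<close>, so \<open>p (R z)\<close> is bounded on
  compact sets.
\<close>

lemma resolvent_bounded_on_annulus:
  assumes L: "\<And>z. \<rho> \<le> cmod z \<Longrightarrow> sim (R z * (z *\<^sub>C 1 - t)) 1"
    and Rt: "\<And>z. \<rho> \<le> cmod z \<Longrightarrow> sim ((z *\<^sub>C 1 - t) * R z) 1"
  obtains M where "0 < M" "\<And>z. \<rho> \<le> cmod z \<Longrightarrow> cmod z \<le> \<rho>' \<Longrightarrow> p (R z) \<le> M"
proof -
  define K where "K = {z. \<rho> \<le> cmod z \<and> cmod z \<le> \<rho>'}"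
  have "closed {z::complex. \<rho> \<le> cmod z}"
    by (intro closed_Collect_le continuous_intros)
  moreover have "K = {z. \<rho> \<le> cmod z} \<inter> cball 0 \<rho>'" by (auto simp: K_def)
  ultimately have K: "compact K" by (simp add: closed_Int_compact)
  have local: "p (R z) \<le> 2 * p (R w)" if "z \<in> K" "w \<in> K" "cmod (z - w) * p (R w) \<le> 1 / 2" for z w
  proof -
    have "p (R z - R w) = cmod (w - z) * p (R z * R w)"
      using sim_eq[OF resolvent_identity[of "R z" z t w "R w"]] that L Rt by (simp add: scaleC K_def)
    also have "\<dots> \<le> cmod (w - z) * (p (R z) * p (R w))"
      by (intro mult_left_mono submult) simp
    also have "\<dots> = (cmod (z - w) * p (R w)) * p (R z)" by (simp add: norm_minus_commute)
    also have "\<dots> \<le> 1 / 2 * p (R z)" using that nonneg by (intro mult_right_mono)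
    finally show ?thesis using triangle[of "R z - R w" "R w"] by simp
  qed
  have "\<exists>M. \<forall>z\<in>K. p (R z) \<le> M"
  proof (rule ccontr)
    assume "\<not> ?thesis"
    then have "\<forall>i::nat. \<exists>z\<in>K. real i < p (R z)" by (meson not_le)
    then obtain x where x: "\<And>i. x i \<in> K" "\<And>i::nat. real i < p (R (x i))" by metis
    obtain w s where w: "w \<in> K" "strict_mono s" "(x \<circ> s) \<longlonglongrightarrow> w"
      using K x(1) unfolding compact_def by metis
    have "(\<lambda>i. cmod ((x \<circ> s) i - w) * p (R w)) \<longlonglongrightarrow> cmod (w - w) * p (R w)"
      by (intro tendsto_intros w)
    then have "eventually (\<lambda>i. cmod ((x \<circ> s) i - w) * p (R w) < 1 / 2) sequentially"
      by (rule order_tendstoD) simp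
    moreover have "eventually (\<lambda>i. 2 * p (R w) < real i) sequentially"
      by (intro eventually_compose_filterlim[OF eventually_gt_at_top filterlim_real_sequentially])
    ultimately have "eventually (\<lambda>i. False) sequentially"
    proof eventually_elim
      case (elim i)
      then have "p (R (x (s i))) \<le> 2 * p (R w)" using local[of "x (s i)" w] x w by simp
      moreover have "real i \<le> real (s i)" using w(2) by (simp add: seq_suble)
      ultimately show ?case using x(2)[of "s i"] elim by linarith
    qed
    then show False by simp
  qed
  then obtain M where "\<forall>z\<in>K. p (R z) \<le> M" by blast
  then show ?thesis using that[of "max M 1"] by (fastforce simp: K_def)
qed

text \<open>
  One \<open>r\<close> serves all directions \<open>u\<close>, so the averages of \<open>z R(z)\<close> over the circles of radius \<open>r\<close> and
  \<open>\<sigma>\<close> differ by at most \<open>\<epsilon>\<close>, however many points are averaged.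
\<close>

lemma resolvent_radial_continuity:
  assumes "0 < \<sigma>"
    and L: "\<And>z. \<sigma> \<le> cmod z \<Longrightarrow> sim (R z * (z *\<^sub>C 1 - t)) 1"
    and Rt: "\<And>z. \<sigma> \<le> cmod z \<Longrightarrow> sim ((z *\<^sub>C 1 - t) * R z) 1"
    and "0 < \<epsilon>"
  obtains r where "\<sigma> < r"
    "\<And>u. cmod u = 1 \<Longrightarrow>
      p ((of_real r * u) *\<^sub>C R (of_real r * u) - (of_real \<sigma> * u) *\<^sub>C R (of_real \<sigma> * u)) \<le> \<epsilon>"
proof -
  obtain M where M: "0 < M" "\<And>z. \<sigma> \<le> cmod z \<Longrightarrow> cmod z \<le> \<sigma> + 1 \<Longrightarrow> p (R z) \<le> M"
    using resolvent_bounded_on_annulus[OF L Rt] by blast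
  define C where "C = M + \<sigma> * M * M"
  have C: "0 < C" using M \<open>0 < \<sigma>\<close> by (simp add: C_def add_pos_pos)
  define \<delta> where "\<delta> = min 1 (\<epsilon> / C)"
  have \<delta>: "0 < \<delta>" "\<delta> \<le> 1" "\<delta> * C \<le> \<epsilon>"
    using C \<open>0 < \<epsilon>\<close> by (auto simp: \<delta>_def min_def field_simps)
  show ?thesis
  proof (rule that[of "\<sigma> + \<delta>"])
    fix u :: complex assume u: "cmod u = 1"
    define z where "z = of_real (\<sigma> + \<delta>) * u"
    define w where "w = of_real \<sigma> * u"
    have zw: "cmod z = \<sigma> + \<delta>" "cmod w = \<sigma>"
      using u \<delta> \<open>0 < \<sigma>\<close> unfolding z_def w_def by (simp_all add: norm_mult del: of_real_add)
    have "z - w = of_real \<delta> * u" by (simp add: z_def w_def algebra_simps)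
    then have zw': "cmod (z - w) = \<delta>" using u \<delta> by (simp add: norm_mult)
    have b: "p (R z) \<le> M" "p (R w) \<le> M" using M zw \<delta> by auto
    have "z *\<^sub>C R z - w *\<^sub>C R w = (z - w) *\<^sub>C R z + w *\<^sub>C (R z - R w)"
      by (simp add: cvs.scale_left_diff_distrib cvs.scale_right_diff_distrib)
    moreover have "sim ((z - w) *\<^sub>C R z + w *\<^sub>C (R z - R w))
        ((z - w) *\<^sub>C R z + w *\<^sub>C (w - z) *\<^sub>C (R z * R w))"
      by (intro sim_add sim_refl sim_scaleC resolvent_identity[where t = t] L Rt) (use zw \<delta> in auto)
    ultimately have "p (z *\<^sub>C R z - w *\<^sub>C R w) = p ((z - w) *\<^sub>C R z + w *\<^sub>C (w - z) *\<^sub>C (R z * R w))"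
      by (metis sim_eq)
    also have "\<dots> \<le> cmod (z - w) * p (R z) + cmod w * (cmod (z - w) * p (R z * R w))"
      using triangle by (metis scaleC norm_minus_commute)
    also have "\<dots> \<le> \<delta> * M + \<sigma> * (\<delta> * (M * M))"
    proof -
      have "p (R z * R w) \<le> M * M"
        using submult[of "R z" "R w"] mult_mono[OF b] nonneg M(1) by (meson order_trans less_imp_le)
      then show ?thesis unfolding zw zw' using b \<delta> \<open>0 < \<sigma>\<close> by (intro add_mono mult_left_mono) auto
    qed
    also have "\<dots> = \<delta> * C" by (simp add: C_def algebra_simps)
    also have "\<dots> \<le> \<epsilon>" by (rule \<delta>)
    finally show "p ((of_real (\<sigma> + \<delta>) * u) *\<^sub>C R (of_real (\<sigma> + \<delta>) * u)
      - (of_real \<sigma> * u) *\<^sub>C R (of_real \<sigma> * u)) \<le> \<epsilon>"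
      by (simp only: z_def w_def)
  qed (use \<delta> in simp)
qed

text \<open>
  Half of the spectral radius formula. Let \<open>\<sigma>\<close> be the infimum of \<open>p (t\<^sup>n)\<^sup>1\<^sup>/\<^sup>n\<close> and suppose
  \<open>\<sigma> \<ge> \<rho>\<close>. For \<open>r > \<sigma>\<close> the averages \<open>f r = r\<^sup>n (r\<^sup>n - t\<^sup>n)\<^sup>-\<^sup>1\<close> are close to \<open>1\<close> for some large \<open>n\<close>. The
  resolvent is uniformly continuous near the circle of radius \<open>\<sigma>\<close>, so for \<open>r\<close> close to \<open>\<sigma>\<close> the
  difference \<open>f r - f \<sigma>\<close> is small for all \<open>n\<close> at once. Then \<open>f \<sigma>\<close> is close to \<open>1\<close> too, which
  forces \<open>p (t\<^sup>n) < \<sigma>\<^sup>n\<close>.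
\<close>

theorem power_small_if_resolvent_everywhere:
  assumes "0 < \<rho>"
    and inv: "\<And>z. \<rho> \<le> cmod z \<Longrightarrow> \<exists>s. sim (s * (z *\<^sub>C 1 - t)) 1 \<and> sim ((z *\<^sub>C 1 - t) * s) 1"
  shows "\<exists>n\<ge>1. p (t ^ n) < \<rho> ^ n"
proof (rule ccontr)
  assume "\<not> ?thesis"
  then have large: "\<rho> ^ n \<le> p (t ^ n)" if "n \<ge> 1" for n using that by (meson not_le)
  obtain R where L: "\<And>z. \<rho> \<le> cmod z \<Longrightarrow> sim (R z * (z *\<^sub>C 1 - t)) 1"
    and Rt: "\<And>z. \<rho> \<le> cmod z \<Longrightarrow> sim ((z *\<^sub>C 1 - t) * R z) 1"
    using inv by metis
  define A where "A = {s. \<rho> \<le> s \<and> (\<forall>n\<ge>1. s ^ n \<le> p (t ^ n))}"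
  define \<sigma> where "\<sigma> = Sup A"
  have bdd: "bdd_above A"
    by (rule bdd_aboveI[of _ "p t"]) (auto simp: A_def dest: spec[of _ 1])
  have "\<rho> \<in> A" using large by (simp add: A_def)
  then have "\<rho> \<le> \<sigma>" using cSup_upper[OF _ bdd] by (simp add: \<sigma>_def)
  have \<sigma>: "\<sigma> ^ n \<le> p (t ^ n)" if "n \<ge> 1" for n
  proof -
    have "\<sigma> \<le> root n (p (t ^ n))"
      unfolding \<sigma>_def
    proof (rule cSup_least)
      fix s assume "s \<in> A"
      then have "0 \<le> s" "s ^ n \<le> p (t ^ n)" using that \<open>0 < \<rho>\<close> by (auto simp: A_def)
      then show "s \<le> root n (p (t ^ n))"
        using that real_root_le_mono[of n "s ^ n" "p (t ^ n)"] by (simp add: real_root_power_cancel)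
    qed (use \<open>\<rho> \<in> A\<close> in blast)
    then have "\<sigma> ^ n \<le> root n (p (t ^ n)) ^ n"
      using \<open>0 < \<rho>\<close> \<open>\<rho> \<le> \<sigma>\<close> by (intro power_mono) auto
    then show ?thesis using that nonneg by simp
  qed
  have "0 < \<sigma>" using \<open>0 < \<rho>\<close> \<open>\<rho> \<le> \<sigma>\<close> by simp
  obtain r where r: "\<sigma> < r" and close: "\<And>u. cmod u = 1 \<Longrightarrow>
      p ((of_real r * u) *\<^sub>C R (of_real r * u) - (of_real \<sigma> * u) *\<^sub>C R (of_real \<sigma> * u)) \<le> 1 / 4"
    using resolvent_radial_continuity[OF \<open>0 < \<sigma>\<close>, of R t "1 / 4"] L Rt \<open>\<rho> \<le> \<sigma>\<close> by auto
  have "r \<notin> A" using cSup_upper[OF _ bdd, of r] r by (auto simp: \<sigma>_def)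
  then obtain m where m: "m \<ge> 1" "p (t ^ m) < r ^ m"
    using r \<open>\<rho> \<le> \<sigma>\<close> by (auto simp: A_def not_le)
  have "0 < r" using r \<open>0 < \<sigma>\<close> by simp
  define \<tau> where "\<tau> = p (t ^ m) / r ^ m"
  have \<tau>: "0 \<le> \<tau>" "\<tau> < 1" using m \<open>0 < r\<close> nonneg by (auto simp: \<tau>_def)
  \<comment> \<open>One exponent \<open>m\<close> with \<open>p (t ^ m) < r ^ m\<close> makes \<open>p (t ^ n) / r ^ n\<close> small for large multiples \<open>n\<close> of \<open>m\<close>.\<close>
  obtain k0 where k0: "\<tau> ^ k0 < 1 / 8" using real_arch_pow_inv[of "1/8" \<tau>] \<tau> by auto
  define k where "k = Suc k0"
  have k: "\<tau> ^ k \<le> 1 / 8"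
  proof -
    have "\<tau> ^ k \<le> \<tau> ^ k0" using \<tau> by (intro power_decreasing) (auto simp: k_def)
    then show ?thesis using k0 by simp
  qed
  define n where "n = m * k"
  have "n \<ge> 1" using m by (simp add: n_def k_def)
  have small: "p (t ^ n) \<le> r ^ n / 8"
  proof -
    have "p (t ^ n) \<le> p (t ^ m) ^ k" unfolding n_def power_mult by (rule power_le)
    also have "\<dots> = \<tau> ^ k * r ^ n"
      using \<open>0 < r\<close> by (simp add: \<tau>_def n_def power_mult power_divide)
    also have "\<dots> \<le> 1 / 8 * r ^ n" using k \<open>0 < r\<close> by (intro mult_right_mono) auto
    finally show ?thesis by simp
  qed
  define f where "f s = inverse (of_nat n) *\<^sub>C (\<Sum>j<n. (of_real s * cis (2 * pi * real j / real n)) *\<^sub>C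
              R (of_real s * cis (2 * pi * real j / real n)))" for s
  have f: "s ^ n * p (f s - 1) = p (f s * t ^ n)" if "\<sigma> \<le> s" for s
  proof -
    have "0 < s" using that \<open>0 < \<sigma>\<close> by simp
    have "sim (f s * (of_real (s ^ n) *\<^sub>C 1 - t ^ n)) (of_real (s ^ n) *\<^sub>C 1)"
      unfolding f_def using that \<open>n \<ge> 1\<close> \<open>0 < s\<close> \<open>\<rho> \<le> \<sigma>\<close> by (intro resolvent_average L) auto
    then have "sim (of_real (s ^ n) *\<^sub>C (f s - 1)) (f s * t ^ n)"
      unfolding sim_def by (simp add: algebra_simps mult_scaleC_right cvs.scale_right_diff_distrib)
    from sim_eq[OF this] show ?thesis using \<open>0 < s\<close> by (simp add: scaleC norm_power)
  qed
  have f_close: "p (f r - f \<sigma>) \<le> 1 / 4"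
  proof -
    have "f r - f \<sigma> = inverse (of_nat n) *\<^sub>C (\<Sum>j<n.
        (of_real r * cis (2 * pi * real j / real n)) *\<^sub>C R (of_real r * cis (2 * pi * real j / real n))
        - (of_real \<sigma> * cis (2 * pi * real j / real n)) *\<^sub>C R (of_real \<sigma> * cis (2 * pi * real j / real n)))"
      by (simp add: f_def sum_subtractf cvs.scale_right_diff_distrib)
    then have "p (f r - f \<sigma>) = inverse (real n) * p (\<Sum>j<n.
        (of_real r * cis (2 * pi * real j / real n)) *\<^sub>C R (of_real r * cis (2 * pi * real j / real n))
        - (of_real \<sigma> * cis (2 * pi * real j / real n)) *\<^sub>C R (of_real \<sigma> * cis (2 * pi * real j / real n)))"
      by (simp only: scaleC norm_inverse norm_of_nat)
    also have "\<dots> \<le> inverse (real n) * (\<Sum>j<n. 1 / 4)"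
      by (intro mult_left_mono order_trans[OF sum_le] sum_mono close) auto
    finally show ?thesis using \<open>n \<ge> 1\<close> by simp
  qed
  \<comment> \<open>With \<open>x = (t / r) ^ n\<close> the average satisfies \<open>f r - 1 = f r * x\<close> up to seminorm zero, and \<open>p x \<le> 1 / 8\<close>.\<close>
  have "p (f r - 1) \<le> 1 / 7"
  proof -
    have "r ^ n * p (f r - 1) \<le> p (f r) * (r ^ n / 8)"
      using f[of r] r submult[of "f r" "t ^ n"] mult_left_mono[OF small nonneg[of "f r"]] by simp
    then have "p (f r - 1) \<le> p (f r) / 8" using \<open>0 < r\<close> by (simp add: field_simps)
    then show ?thesis using triangle[of "f r - 1" 1] one_le by simp
  qed
  then have g: "p (f \<sigma> - 1) \<le> 2 / 5"
    using f_close triangle[of "f r - 1" "f \<sigma> - f r"] minus[of "f r - f \<sigma>"] by simp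
  have "p (t ^ n) \<le> p (f \<sigma> * t ^ n) + p ((f \<sigma> - 1) * t ^ n)"
    using diff[of "f \<sigma> * t ^ n" "(f \<sigma> - 1) * t ^ n"] by (simp add: algebra_simps)
  also have "\<dots> \<le> \<sigma> ^ n * p (f \<sigma> - 1) + p (f \<sigma> - 1) * p (t ^ n)"
    using f[of \<sigma>] submult by simp
  also have "\<dots> \<le> \<sigma> ^ n * (2 / 5) + 2 / 5 * p (t ^ n)"
    using g nonneg \<open>0 < \<sigma>\<close> by (intro add_mono mult_left_mono mult_right_mono) auto
  finally have "p (t ^ n) \<le> 2 / 3 * \<sigma> ^ n" by simp
  moreover have "0 < \<sigma> ^ n" using \<open>0 < \<sigma>\<close> by simp
  ultimately show False using \<sigma>[OF \<open>n \<ge> 1\<close>] by linarith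
qed

end

section \<open>Invertibility in Banach algebras\<close>

lemma norm_power_le_mult:
  fixes x :: "'r::{real_normed_algebra, monoid_mult}"
  shows "norm (x ^ n) \<le> norm (1::'r) * norm x ^ n"
proof (induction n)
  case (Suc n)
  have "norm (x ^ Suc n) \<le> norm (x ^ n) * norm x"
    unfolding power_Suc2 by (rule norm_mult_ineq)
  also have "\<dots> \<le> norm (1::'r) * norm x ^ n * norm x"
    using Suc by (intro mult_right_mono) auto
  finally show ?case by (simp add: mult_ac)
qed simp

text \<open>
  Two-sided invertibility. It is stated for any multiplication with a unit because the operators on
  the zero space form a ring with \<open>0 = 1\<close>, which is not in the class \<open>ring_1\<close>.
\<close>

definition invertible_in_ring :: "'r::{times, one} \<Rightarrow> bool" where
  "invertible_in_ring x \<longleftrightarrow> (\<exists>y. y * x = 1 \<and> x * y = 1)"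

lemma Neumann_inverse:
  fixes x :: "'r::{real_normed_algebra, banach, monoid_mult}"
  assumes "norm x < 1"
  shows "invertible_in_ring (1 - x)"
proof -
  have "summable (\<lambda>n. norm (1::'r) * norm x ^ n)"
    using assms by (intro summable_mult summable_geometric) auto
  then have S: "summable (\<lambda>n. x ^ n)"
    by (rule summable_comparison_test'[where N = 0]) (rule norm_power_le_mult)
  then have sums: "(\<lambda>n. x ^ n) sums (\<Sum>n. x ^ n)" by (rule summable_sums)
  have tele: "(\<lambda>n. x ^ n - x ^ Suc n) sums 1"
    using telescope_sums'[OF summable_LIMSEQ_zero[OF S]] by simp
  have "(\<lambda>n. (1 - x) * x ^ n) sums ((1 - x) * (\<Sum>n. x ^ n))"
    by (rule bounded_linear.sums[OF bounded_linear_mult_right sums])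
  moreover have "(\<lambda>n. x ^ n * (1 - x)) sums ((\<Sum>n. x ^ n) * (1 - x))"
    by (rule bounded_linear.sums[OF bounded_linear_mult_left sums])
  ultimately have "(1 - x) * (\<Sum>n. x ^ n) = 1" "(\<Sum>n. x ^ n) * (1 - x) = 1"
    using sums_unique2[OF tele]
    by (simp_all add: left_diff_distrib right_diff_distrib power_commutes)
  then show ?thesis by (auto simp: invertible_in_ring_def)
qed

lemma invertible_in_ring_mult:
  fixes x y :: "'r::monoid_mult"
  assumes "invertible_in_ring x" "invertible_in_ring y"
  shows "invertible_in_ring (x * y)"
proof -
  obtain x' y' where "x' * x = 1" "x * x' = 1" "y' * y = 1" "y * y' = 1"
    using assms by (auto simp: invertible_in_ring_def)
  then have "(y' * x') * (x * y) = 1" "(x * y) * (y' * x') = 1"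
    by (metis mult.assoc mult_1_left)+
  then show ?thesis unfolding invertible_in_ring_def by blast
qed

lemma invertible_perturbation:
  fixes a b :: "'r::{real_normed_algebra, banach, monoid_mult}"
  assumes "r * a = 1" "a * r = 1" "norm r * norm (a - b) < 1"
  shows "invertible_in_ring b"
proof -
  have "norm (r * (a - b)) < 1"
    using norm_mult_ineq[of r "a - b"] assms by linarith
  then have "invertible_in_ring (a * (1 - r * (a - b)))"
    using assms by (intro invertible_in_ring_mult Neumann_inverse) (auto simp: invertible_in_ring_def)
  moreover have "a * (1 - r * (a - b)) = a - (a * r) * (a - b)"
    by (simp add: algebra_simps)
  ultimately show ?thesis using assms by simp
qed

lemma invertible_scaleC_minus:
  fixes d :: "'r::{complex_banach_algebra, monoid_mult}"
  assumes "norm d < cmod z"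
  shows "invertible_in_ring (z *\<^sub>C 1 - d)"
proof -
  have "z \<noteq> 0" using assms by auto
  have "norm (inverse z *\<^sub>C d) < 1"
    using assms \<open>z \<noteq> 0\<close> by (simp add: norm_scaleC norm_inverse norm_divide divide_simps)
  then have "invertible_in_ring ((z *\<^sub>C 1) * (1 - inverse z *\<^sub>C d))"
  proof (intro invertible_in_ring_mult Neumann_inverse)
    show "invertible_in_ring (z *\<^sub>C (1::'r))"
      unfolding invertible_in_ring_def using \<open>z \<noteq> 0\<close>
      by (intro exI[of _ "inverse z *\<^sub>C 1"]) (simp add: mult_scaleC_left mult_scaleC_right scaleC_scaleC scaleC_one)
  qed
  then show ?thesis using \<open>z \<noteq> 0\<close>
    by (simp add: mult_scaleC_left cvs.scale_right_diff_distrib scaleC_scaleC scaleC_one)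
qed

section \<open>The Banach algebra of bounded operators\<close>

text \<open>
  Complex-linear bounded operators form a closed subalgebra of the real-linear ones, from which
  they inherit norm and completeness. As a type they are a Banach algebra, with powers, sums and
  limits available through type classes.
\<close>

typedef (overloaded) 'a bop =
  "{f :: 'a::complex_normed_vector \<Rightarrow>\<^sub>L 'a. \<forall>z x. blinfun_apply f (z *\<^sub>C x) = z *\<^sub>C blinfun_apply f x}"
  by (rule exI[of _ 0]) simp

setup_lifting type_definition_bop

lemma bounded_linear_scaleC: "bounded_linear (\<lambda>x::'a::complex_normed_vector. z *\<^sub>C x)"
proof (rule bounded_linear_intro[of _ "cmod z"])
  fix r :: real and x :: 'a
  show "z *\<^sub>C r *\<^sub>R x = r *\<^sub>R z *\<^sub>C x"
    by (simp add: scaleC_scaleC mult.commute flip: scaleC_of_real)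
qed (simp_all add: scaleC_add_right norm_scaleC)

instantiation bop :: (complex_normed_vector) real_normed_vector
begin

lift_definition zero_bop :: "'a bop" is 0 by simp
lift_definition plus_bop :: "'a bop \<Rightarrow> 'a bop \<Rightarrow> 'a bop" is "(+)"
  by (simp add: blinfun.add_left scaleC_add_right)
lift_definition minus_bop :: "'a bop \<Rightarrow> 'a bop \<Rightarrow> 'a bop" is "(-)"
  by (simp add: blinfun.diff_left cvs.scale_right_diff_distrib)
lift_definition uminus_bop :: "'a bop \<Rightarrow> 'a bop" is "uminus"
  by (simp add: blinfun.minus_left)
lift_definition scaleR_bop :: "real \<Rightarrow> 'a bop \<Rightarrow> 'a bop" is "(*\<^sub>R)"
  by (simp add: blinfun.scaleR_left scaleC_scaleC mult.commute flip: scaleC_of_real)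
lift_definition norm_bop :: "'a bop \<Rightarrow> real" is norm .
definition "dist_bop (f :: 'a bop) g = norm (f - g)"
definition "sgn_bop (f :: 'a bop) = scaleR (inverse (norm f)) f"
definition "uniformity_bop = (INF e\<in>{0<..}. principal {(f :: 'a bop, g). dist f g < e})"
definition "open_bop (U :: 'a bop set) \<longleftrightarrow>
  (\<forall>f\<in>U. eventually (\<lambda>(f', g). f' = f \<longrightarrow> g \<in> U) uniformity)"

instance
proof
  fix f g h :: "'a bop" and a b :: real
  show "norm (a *\<^sub>R f) = \<bar>a\<bar> * norm f" by transfer simp
  show "norm (f + g) \<le> norm f + norm g" by transfer (rule norm_triangle_ineq)
  show "norm f = 0 \<longleftrightarrow> f = 0" by transfer simp
  show "a *\<^sub>R (f + g) = a *\<^sub>R f + a *\<^sub>R g" by transfer (simp add: algebra_simps)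
  show "(a + b) *\<^sub>R f = a *\<^sub>R f + b *\<^sub>R f" by transfer (simp add: algebra_simps)
  show "a *\<^sub>R b *\<^sub>R f = (a * b) *\<^sub>R f" "1 *\<^sub>R f = f" by (transfer; simp)+
  show "f + g + h = f + (g + h)" "f + g = g + f" "0 + f = f" "- f + f = 0" "f - g = f + - g"
    by (transfer; simp add: algebra_simps)+
qed (simp_all add: dist_bop_def sgn_bop_def uniformity_bop_def open_bop_def)

end

instantiation bop :: (complex_normed_vector) "{complex_algebra, complex_normed_vector, real_normed_algebra, monoid_mult}"
begin

lift_definition times_bop :: "'a bop \<Rightarrow> 'a bop \<Rightarrow> 'a bop" is blinfun_compose by simp
lift_definition one_bop :: "'a bop" is id_blinfun by simp
lift_definition scaleC_bop :: "complex \<Rightarrow> 'a bop \<Rightarrow> 'a bop" is "\<lambda>z f. Blinfun (scaleC z) o\<^sub>L f"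
  by (simp add: bounded_linear_Blinfun_apply bounded_linear_scaleC scaleC_scaleC mult.commute)

instance
proof
  fix f g h :: "'a bop" and a b :: complex and r :: real
  note [simp] = bounded_linear_Blinfun_apply[OF bounded_linear_scaleC]
  show "a *\<^sub>C (f + g) = a *\<^sub>C f + a *\<^sub>C g"
    by transfer (auto intro!: blinfun_eqI simp: blinfun.add_left scaleC_add_right)
  show "(a + b) *\<^sub>C f = a *\<^sub>C f + b *\<^sub>C f"
    by transfer (auto intro!: blinfun_eqI simp: blinfun.add_left scaleC_add_left)
  show "a *\<^sub>C b *\<^sub>C f = (a * b) *\<^sub>C f"
    by transfer (auto intro!: blinfun_eqI simp: scaleC_scaleC)
  show "1 *\<^sub>C f = f" by transfer (auto intro!: blinfun_eqI simp: scaleC_one)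
  show "complex_of_real r *\<^sub>C f = r *\<^sub>R f"
    by transfer (auto intro!: blinfun_eqI simp: scaleC_of_real blinfun.scaleR_left)
  show "f * g * h = f * (g * h)" by transfer (auto intro!: blinfun_eqI)
  show "(f + g) * h = f * h + g * h" by transfer (auto intro!: blinfun_eqI simp: blinfun.add_left)
  show "f * (g + h) = f * g + f * h"
    by transfer (auto intro!: blinfun_eqI simp: blinfun.add_left blinfun.add_right)
  show "(r *\<^sub>R f) * g = r *\<^sub>R (f * g)"
    by transfer (auto intro!: blinfun_eqI simp: blinfun.scaleR_left)
  show "f * (r *\<^sub>R g) = r *\<^sub>R (f * g)"
    by transfer (auto intro!: blinfun_eqI simp: blinfun.scaleR_left blinfun.scaleR_right)
  show "(a *\<^sub>C f) * g = a *\<^sub>C (f * g)" by transfer (auto intro!: blinfun_eqI)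
  show "f * (a *\<^sub>C g) = a *\<^sub>C (f * g)" by transfer (auto intro!: blinfun_eqI)
  show "norm (f * g) \<le> norm f * norm g" by transfer (rule norm_blinfun_compose)
  show "1 * f = f" "f * 1 = f" by (transfer; auto intro!: blinfun_eqI)+
  show "norm (a *\<^sub>C f) = cmod a * norm f"
  proof transfer
    fix a :: complex and f :: "'a \<Rightarrow>\<^sub>L 'a"
    show "norm (Blinfun (scaleC a) o\<^sub>L f) = cmod a * norm f"
    proof (rule antisym)
      show "norm (Blinfun (scaleC a) o\<^sub>L f) \<le> cmod a * norm f"
        by (rule norm_blinfun_bound)
          (auto simp: norm_scaleC mult.assoc intro!: mult_left_mono norm_blinfun)
      show "cmod a * norm f \<le> norm (Blinfun (scaleC a) o\<^sub>L f)"
      proof (cases "a = 0")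
        case False
        have "norm f \<le> norm (Blinfun (scaleC a) o\<^sub>L f) / cmod a"
        proof (rule norm_blinfun_bound)
          fix x
          have "cmod a * norm (f x) \<le> norm (Blinfun (scaleC a) o\<^sub>L f) * norm x"
            using norm_blinfun[of "Blinfun (scaleC a) o\<^sub>L f" x] by (simp add: norm_scaleC)
          then show "norm (f x) \<le> norm (Blinfun (scaleC a) o\<^sub>L f) / cmod a * norm x"
            using False by (simp add: field_simps)
        qed simp
        then show ?thesis using False by (simp add: field_simps)
      qed simp
    qed
  qed
qed

end

definition app :: "'a::complex_normed_vector bop \<Rightarrow> 'a \<Rightarrow> 'a" (infixr \<open>\<cdot>\<close> 75) where
  "f \<cdot> x = blinfun_apply (Rep_bop f) x"

lemma bop_eqI: "(\<And>x. f \<cdot> x = g \<cdot> x) \<Longrightarrow> f = g"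
  by (metis Rep_bop_inject app_def blinfun_eqI)

lemma app_simps [simp]:
  "(f + g) \<cdot> x = f \<cdot> x + g \<cdot> x" "(f - g) \<cdot> x = f \<cdot> x - g \<cdot> x" "(- f) \<cdot> x = - (f \<cdot> x)"
  "0 \<cdot> x = 0" "1 \<cdot> x = x" "(f * g) \<cdot> x = f \<cdot> g \<cdot> x" "(z *\<^sub>C f) \<cdot> x = z *\<^sub>C f \<cdot> x"
  unfolding app_def
  by (transfer; simp add: blinfun.add_left blinfun.diff_left blinfun.minus_left
      bounded_linear_Blinfun_apply bounded_linear_scaleC)+

lemma app_linear [simp]:
  "f \<cdot> (x + y) = f \<cdot> x + f \<cdot> y" "f \<cdot> (x - y) = f \<cdot> x - f \<cdot> y" "f \<cdot> (- x) = - (f \<cdot> x)"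
  "f \<cdot> 0 = 0" "f \<cdot> (z *\<^sub>C x) = z *\<^sub>C f \<cdot> x"
  unfolding app_def using Rep_bop[of f]
  by (simp_all add: blinfun.add_right blinfun.diff_right blinfun.minus_right)

lemma bounded_linear_app: "bounded_linear (\<lambda>x. f \<cdot> x)"
  unfolding app_def by (rule blinfun.bounded_linear_right)

lemma norm_app: "norm (f \<cdot> x) \<le> norm f * norm x"
  unfolding app_def norm_bop.rep_eq by (rule norm_blinfun)

lemma norm_bop_bound: "0 \<le> c \<Longrightarrow> (\<And>x. norm (f \<cdot> x) \<le> c * norm x) \<Longrightarrow> norm f \<le> c"
  unfolding app_def norm_bop.rep_eq by (rule norm_blinfun_bound)

lemma norm_bop_eq_onorm: "norm f = onorm (\<lambda>x. f \<cdot> x)"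
  unfolding app_def norm_bop.rep_eq norm_blinfun.rep_eq ..

lemma norm_bop_one: "norm (1 :: 'a::complex_normed_vector bop) \<le> 1"
  by (rule norm_bop_bound) auto

lemma app_power: "(f ^ n) \<cdot> x = ((\<lambda>x. f \<cdot> x) ^^ n) x"
  by (induction n) auto

lemma bounded_linear_app_left: "bounded_linear (\<lambda>f. f \<cdot> x)"
proof (rule bounded_linear_intro[of _ "norm x"])
  fix r :: real and f :: "'a bop"
  show "(r *\<^sub>R f) \<cdot> x = r *\<^sub>R f \<cdot> x" by (simp flip: scaleC_of_real)
qed (use norm_app in \<open>auto simp: mult.commute\<close>)

instance bop :: ("{complex_normed_vector, banach}") complex_banach_algebra
proof
  fix X :: "nat \<Rightarrow> 'a bop"
  assume "Cauchy X"
  then have "Cauchy (\<lambda>i. Rep_bop (X i))"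
    unfolding Cauchy_def dist_norm by (simp add: norm_bop.rep_eq minus_bop.rep_eq)
  then obtain L where L: "(\<lambda>i. Rep_bop (X i)) \<longlonglongrightarrow> L"
    using convergentI[of "\<lambda>i. Rep_bop (X i)"] Cauchy_convergent convergent_def by blast
  have "blinfun_apply L (z *\<^sub>C x) = z *\<^sub>C blinfun_apply L x" for z x
  proof (rule LIMSEQ_unique)
    show "(\<lambda>i. Rep_bop (X i) (z *\<^sub>C x)) \<longlonglongrightarrow> L (z *\<^sub>C x)"
      by (intro tendsto_intros L)
    have "(\<lambda>i. z *\<^sub>C Rep_bop (X i) x) \<longlonglongrightarrow> z *\<^sub>C L x"
      by (intro bounded_linear.tendsto[OF bounded_linear_scaleC] tendsto_intros L)
    then show "(\<lambda>i. Rep_bop (X i) (z *\<^sub>C x)) \<longlonglongrightarrow> z *\<^sub>C L x"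
      using Rep_bop[of "X _"] by (auto elim!: tendsto_cong[THEN iffD1, rotated])
  qed
  then have "Rep_bop (Abs_bop L) = L" by (simp add: Abs_bop_inverse)
  then have "X \<longlonglongrightarrow> Abs_bop L"
    using L unfolding LIMSEQ_iff by (simp add: norm_bop.rep_eq minus_bop.rep_eq)
  then show "convergent X" by (rule convergentI)
qed

lemma bounded_operator_app: "bounded_operator (\<lambda>x. f \<cdot> x)"
  unfolding bounded_operator_def
proof (intro conjI exI allI)
  show "Vector_Spaces.linear scaleC scaleC (\<lambda>x. f \<cdot> x)"
    by unfold_locales auto
qed (rule norm_app)

lemma bounded_operator_imp_app:
  assumes "bounded_operator T"
  shows "\<exists>f. T = app f"
proof -
  interpret T: Vector_Spaces.linear scaleC scaleC T
    using assms by (simp add: bounded_operator_def)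
  obtain C where C: "\<And>x. norm (T x) \<le> C * norm x" using assms by (auto simp: bounded_operator_def)
  have "bounded_linear T"
    by (rule bounded_linear_intro[of _ C])
      (auto simp: T.add T.scale C mult.commute simp flip: scaleC_of_real)
  then have "blinfun_apply (Blinfun T) = T" by (rule bounded_linear_Blinfun_apply)
  then have "Rep_bop (Abs_bop (Blinfun T)) = Blinfun T"
    by (simp add: Abs_bop_inverse T.scale)
  then have "T x = Abs_bop (Blinfun T) \<cdot> x" for x
    by (simp add: app_def \<open>blinfun_apply (Blinfun T) = T\<close>)
  then show ?thesis by blast
qed

section \<open>Finite-dimensional subspaces and Riesz's lemma\<close>

lemma bounded_bilinear_scaleC: "bounded_bilinear (scaleC :: complex \<Rightarrow> 'a \<Rightarrow> 'a::complex_normed_vector)"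
proof
  fix a a' :: complex and b b' :: 'a and r :: real
  show "(a + a') *\<^sub>C b = a *\<^sub>C b + a' *\<^sub>C b" by (rule scaleC_add_left)
  show "a *\<^sub>C (b + b') = a *\<^sub>C b + a *\<^sub>C b'" by (rule scaleC_add_right)
  show "(r *\<^sub>R a) *\<^sub>C b = r *\<^sub>R (a *\<^sub>C b)"
    by (simp add: scaleC_scaleC scaleR_conv_of_real flip: scaleC_of_real)
  show "a *\<^sub>C (r *\<^sub>R b) = r *\<^sub>R (a *\<^sub>C b)"
    by (simp add: scaleC_scaleC mult.commute flip: scaleC_of_real)
  show "\<exists>K. \<forall>(a::complex) (b::'a). norm (a *\<^sub>C b) \<le> norm a * norm b * K"
    by (intro exI[of _ 1]) (simp add: norm_scaleC)
qed

interpretation scaleC: bounded_bilinear "scaleC :: complex \<Rightarrow> 'a \<Rightarrow> 'a::complex_normed_vector"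
  by (rule bounded_bilinear_scaleC)

lemmas tendsto_scaleC [tendsto_intros] = scaleC.tendsto
lemmas continuous_on_scaleC [continuous_intros] = scaleC.continuous_on

lemma tendsto_app [tendsto_intros]: "(x \<longlongrightarrow> l) F \<Longrightarrow> ((\<lambda>i. f \<cdot> x i) \<longlongrightarrow> f \<cdot> l) F"
  by (rule bounded_linear.tendsto[OF bounded_linear_app])

lemma closed_if_cball_Int_compact:
  fixes A :: "'a::real_normed_vector set"
  assumes "\<And>r. compact (cball 0 r \<inter> A)"
  shows "closed A"
  unfolding closed_sequential_limits
proof (intro allI impI)
  fix x l assume x: "(\<forall>n. x n \<in> A) \<and> x \<longlonglongrightarrow> l"
  then have "bounded (range x)" by (intro convergent_imp_bounded) auto
  then obtain r where r: "\<And>i. norm (x i) \<le> r" unfolding bounded_iff by blast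
  have "closed (cball 0 r \<inter> A)" by (rule compact_imp_closed[OF assms])
  then have "l \<in> cball 0 r \<inter> A"
    by (rule closed_sequentially[of _ x]) (use x r in auto)
  then show "l \<in> A" by blast
qed

text \<open>
  Induction on the spanning set: adjoining a vector \<open>a\<close> outside the span makes the closed ball an
  image of a compact product, because the coefficient of \<open>a\<close> is controlled by the distance of \<open>a\<close>
  from the span, which is closed by the induction hypothesis.
\<close>

lemma compact_cball_Int_span:
  fixes S :: "'a::complex_normed_vector set"
  assumes "finite S"
  shows "compact (cball 0 r \<inter> cvs.span S)"
  using assms
proof (induction S arbitrary: r)
  case (insert a S)
  show ?case
  proof (cases "a \<in> cvs.span S")
    case True
    then show ?thesis using insert by (simp add: cvs.span_redundant)
  next
    case False
    have "closed (cvs.span S)" by (rule closed_if_cball_Int_compact) (rule insert.IH)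
    then have d: "0 < infdist a (cvs.span S)" (is "0 < ?d")
      using False infdist_pos_not_in_closed cvs.span_zero by blast
    have coeff: "cmod k * ?d \<le> norm (k *\<^sub>C a + y)" if "y \<in> cvs.span S" for k y
    proof (cases "k = 0")
      case False
      have "- (inverse k *\<^sub>C y) \<in> cvs.span S" using that by (intro cvs.span_neg cvs.span_scale)
      then have "?d \<le> norm (a + inverse k *\<^sub>C y)"
        using infdist_le[of _ "cvs.span S" a] by (fastforce simp: dist_norm)
      then have "cmod k * ?d \<le> norm (k *\<^sub>C (a + inverse k *\<^sub>C y))"
        unfolding norm_scaleC by (intro mult_left_mono) auto
      then show ?thesis using False by (simp add: scaleC_add_right scaleC_scaleC scaleC_one)
    qed simp
    define K where "K = (\<lambda>(k, y). k *\<^sub>C a + y) ` (cball (0::complex) (r / ?d) \<times>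
        (cball 0 (r + r / ?d * norm a) \<inter> cvs.span S))"
    have "compact K"
      unfolding K_def case_prod_unfold
      by (intro compact_continuous_image compact_Times insert.IH compact_cball continuous_intros)
    moreover have "cball 0 r \<inter> cvs.span (insert a S) = cball 0 r \<inter> K"
    proof (intro Set.set_eqI iffI)
      fix x assume x: "x \<in> cball 0 r \<inter> cvs.span (insert a S)"
      then obtain k where k: "x - k *\<^sub>C a \<in> cvs.span S" by (auto simp: cvs.span_insert)
      have "cmod k * ?d \<le> r" using coeff[OF k, of k] x by simp
      then have kr: "cmod k \<le> r / ?d" using d by (simp add: field_simps)
      have "norm (x - k *\<^sub>C a) \<le> r + cmod k * norm a"
        using norm_triangle_ineq4[of x "k *\<^sub>C a"] x by (simp add: norm_scaleC)
      also have "\<dots> \<le> r + r / ?d * norm a" using kr by (intro add_left_mono mult_right_mono) auto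
      finally have "x \<in> K"
        using k kr unfolding K_def by (intro image_eqI[of _ _ "(k, x - k *\<^sub>C a)"]) auto
      then show "x \<in> cball 0 r \<inter> K" using x by simp
    next
      fix x assume x: "x \<in> cball 0 r \<inter> K"
      then obtain k y where "x = k *\<^sub>C a + y" "y \<in> cvs.span S" by (auto simp: K_def)
      then have "x \<in> cvs.span (insert a S)" by (auto simp: cvs.span_insert intro!: exI[of _ k])
      then show "x \<in> cball 0 r \<inter> cvs.span (insert a S)" using x by simp
    qed
    ultimately show ?thesis by (metis closed_Int_compact closed_cball)
  qed
qed (simp add: finite_imp_compact)

lemma closed_span_finite:
  fixes S :: "'a::complex_normed_vector set"
  assumes "finite S"
  shows "closed (cvs.span S)"
  by (intro closed_if_cball_Int_compact compact_cball_Int_span assms)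

lemma Riesz_lemma:
  fixes a :: "'a::complex_normed_vector"
  assumes M: "cvs.subspace M" "closed M" and "a \<notin> M"
  obtains s m where "m \<in> M" "norm (s *\<^sub>C (a - m)) = 1"
    "\<And>w. w \<in> M \<Longrightarrow> 1 / 2 \<le> norm (s *\<^sub>C (a - m) - w)"
proof -
  have ne: "M \<noteq> {}" using cvs.subspace_0[OF M(1)] by blast
  have d: "0 < infdist a M" (is "0 < ?d")
    using assms infdist_pos_not_in_closed[OF M(2) ne] by blast
  have "\<exists>m\<in>M. dist a m < 2 * ?d"
    using d infdist_notempty[OF ne, of a] cINF_less_iff[OF ne, of "dist a" "2 * ?d"]
    by (simp add: bdd_below_image_dist)
  then obtain m where m: "m \<in> M" "norm (a - m) < 2 * ?d" by (auto simp: dist_norm)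
  have am: "0 < norm (a - m)" using m assms by auto
  define s where "s = complex_of_real (1 / norm (a - m))"
  show ?thesis
  proof (rule that[OF m(1), of s])
    show "norm (s *\<^sub>C (a - m)) = 1" using am by (simp add: s_def norm_scaleC norm_divide)
    fix w assume w: "w \<in> M"
    have "m + inverse s *\<^sub>C w \<in> M" using m w by (intro cvs.subspace_add[OF M(1)] cvs.subspace_scale[OF M(1)])
    from infdist_le[OF this, of a] have "?d \<le> norm (a - m - inverse s *\<^sub>C w)"
      by (simp add: dist_norm algebra_simps)
    then have "cmod s * ?d \<le> norm (s *\<^sub>C (a - m - inverse s *\<^sub>C w))"
      unfolding norm_scaleC by (intro mult_left_mono) auto
    moreover have "s *\<^sub>C (a - m - inverse s *\<^sub>C w) = s *\<^sub>C (a - m) - w"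
      using am by (simp add: cvs.scale_right_diff_distrib scaleC_scaleC s_def scaleC_one)
    moreover have "1 / 2 \<le> cmod s * ?d"
      using am m by (simp add: s_def norm_divide field_simps)
    ultimately show "1 / 2 \<le> norm (s *\<^sub>C (a - m) - w)" by simp
  qed
qed

text \<open>
  A quantitative form of compactness that behaves multiplicatively under composition. Compact
  operators have it for all \<open>c > 0\<close>.
\<close>

section \<open>Quasi-precompact operators\<close>

definition has_net :: "'a::complex_normed_vector bop \<Rightarrow> real \<Rightarrow> bool" where
  "has_net f c \<longleftrightarrow> (\<exists>A. finite A \<and> (\<forall>x. norm x \<le> 1 \<longrightarrow> (\<exists>a\<in>A. norm (f \<cdot> x - a) \<le> c)))"

lemma has_net_mono: "has_net f c \<Longrightarrow> c \<le> d \<Longrightarrow> has_net f d"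
  unfolding has_net_def by (meson order_trans)

lemma has_net_norm: "has_net f (norm f)"
  unfolding has_net_def
proof (intro exI[of _ "{0}"] conjI allI impI)
  fix x :: 'a assume "norm x \<le> 1"
  then have "norm f * norm x \<le> norm f" by (simp add: mult_left_le)
  then show "\<exists>a\<in>{0}. norm (f \<cdot> x - a) \<le> norm f" using norm_app[of f x] by simp
qed simp

lemma has_net_add:
  assumes "has_net f c" "has_net g d"
  shows "has_net (f + g) (c + d)"
proof -
  obtain A B where "finite A" "finite B"
    and A: "\<And>x. norm x \<le> 1 \<Longrightarrow> \<exists>a\<in>A. norm (f \<cdot> x - a) \<le> c"
    and B: "\<And>x. norm x \<le> 1 \<Longrightarrow> \<exists>b\<in>B. norm (g \<cdot> x - b) \<le> d"
    using assms unfolding has_net_def by metis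
  show ?thesis
    unfolding has_net_def
  proof (intro exI[of _ "(\<lambda>(a, b). a + b) ` (A \<times> B)"] conjI allI impI)
    fix x :: 'a assume "norm x \<le> 1"
    then obtain a b where "a \<in> A" "b \<in> B" "norm (f \<cdot> x - a) \<le> c" "norm (g \<cdot> x - b) \<le> d"
      using A B by metis
    then show "\<exists>a\<in>(\<lambda>(a, b). a + b) ` (A \<times> B). norm ((f + g) \<cdot> x - a) \<le> c + d"
      using norm_triangle_mono[of "f \<cdot> x - a" c "g \<cdot> x - b" d]
      by (intro bexI[of _ "a + b"]) (auto simp: algebra_simps)
  qed (use \<open>finite A\<close> \<open>finite B\<close> in simp)
qed

text \<open>
  Cover the image under \<open>g\<close> by balls of radius \<open>d\<close>; the operator \<open>f\<close> maps each of them to a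
  translate of \<open>d\<close> times the image of the unit ball.
\<close>

lemma has_net_mult:
  assumes "has_net f c" "has_net g d" "0 \<le> d"
  shows "has_net (f * g) (c * d)"
proof -
  obtain A B where "finite A" "finite B"
    and A: "\<And>x. norm x \<le> 1 \<Longrightarrow> \<exists>a\<in>A. norm (f \<cdot> x - a) \<le> c"
    and B: "\<And>x. norm x \<le> 1 \<Longrightarrow> \<exists>b\<in>B. norm (g \<cdot> x - b) \<le> d"
    using assms unfolding has_net_def by metis
  show ?thesis
    unfolding has_net_def
  proof (intro exI[of _ "(\<lambda>(a, b). of_real d *\<^sub>C a + f \<cdot> b) ` (A \<times> B)"] conjI allI impI)
    fix x :: 'a assume "norm x \<le> 1"
    then obtain b where b: "b \<in> B" "norm (g \<cdot> x - b) \<le> d" using B by metis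
    define u where "u = of_real (inverse d) *\<^sub>C (g \<cdot> x - b)"
    have "norm u \<le> 1"
      using b \<open>0 \<le> d\<close> by (auto simp: u_def norm_scaleC norm_inverse norm_divide divide_simps)
    then obtain a where a: "a \<in> A" "norm (f \<cdot> u - a) \<le> c" using A by metis
    have "of_real d *\<^sub>C u = g \<cdot> x - b"
      using b by (cases "d = 0") (simp_all add: u_def scaleC_scaleC scaleC_one flip: of_real_mult)
    then have "of_real d *\<^sub>C f \<cdot> u = f \<cdot> g \<cdot> x - f \<cdot> b" by (metis app_linear(2,5))
    then have "(f * g) \<cdot> x - (of_real d *\<^sub>C a + f \<cdot> b) = of_real d *\<^sub>C (f \<cdot> u - a)"
      by (simp add: cvs.scale_right_diff_distrib)
    then have "norm ((f * g) \<cdot> x - (of_real d *\<^sub>C a + f \<cdot> b)) \<le> c * d"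
      using a \<open>0 \<le> d\<close> by (simp add: norm_scaleC mult_left_mono mult.commute[of c])
    then show "\<exists>a\<in>(\<lambda>(a, b). of_real d *\<^sub>C a + f \<cdot> b) ` (A \<times> B). norm ((f * g) \<cdot> x - a) \<le> c * d"
      using a b by force
  qed (use \<open>finite A\<close> \<open>finite B\<close> in simp)
qed

lemma has_net_power:
  assumes "has_net f c" "0 \<le> c"
  shows "has_net (f ^ k) (c ^ k)"
proof (induction k)
  case 0
  show ?case using has_net_mono[OF has_net_norm norm_bop_one] by simp
next
  case (Suc k)
  then show ?case using has_net_mult[OF assms(1) Suc] assms by simp
qed

definition quasi_precompact :: "'a::complex_normed_vector bop \<Rightarrow> bool" where
  "quasi_precompact X \<longleftrightarrow> (\<exists>m\<ge>1. \<exists>c. 0 \<le> c \<and> c < 1 \<and> has_net (X ^ m) c)"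

lemma quasi_precompact_net:
  assumes "quasi_precompact X" "0 < \<epsilon>"
  obtains n where "1 \<le> n" "has_net (X ^ n) \<epsilon>"
proof -
  obtain m c where m: "1 \<le> m" "0 \<le> c" "c < 1" "has_net (X ^ m) c"
    using assms unfolding quasi_precompact_def by blast
  obtain k where "c ^ k < \<epsilon>" using real_arch_pow_inv[OF \<open>0 < \<epsilon>\<close> \<open>c < 1\<close>] by blast
  moreover have "c ^ Suc k \<le> c ^ k" using m by (intro power_decreasing) auto
  ultimately have "has_net ((X ^ m) ^ Suc k) \<epsilon>"
    using has_net_mono[OF has_net_power[OF m(4,2)], of "Suc k" \<epsilon>] by linarith
  then show ?thesis using that[of "m * Suc k"] m by (simp add: power_mult power_add)
qed

lemma quasi_precompact_power:
  assumes "quasi_precompact X" "1 \<le> n"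
  shows "quasi_precompact (X ^ n)"
proof -
  obtain m c where m: "1 \<le> m" "0 \<le> c" "c < 1" "has_net (X ^ m) c"
    using assms unfolding quasi_precompact_def by blast
  have "has_net ((X ^ m) ^ n) (c ^ n)" by (rule has_net_power[OF m(4,2)])
  moreover have "c ^ n < 1" using m assms by (simp add: power_less_one_iff)
  ultimately show ?thesis
    unfolding quasi_precompact_def using m
    by (intro exI[of _ m] conjI exI[of _ "c ^ n"]) (auto simp: mult.commute simp flip: power_mult)
qed

text \<open>
  The spans of the initial segments of \<open>y\<close> form a strictly increasing flag of invariant
  subspaces, and \<open>X\<close> acts on the successive quotients by the scalars \<open>\<mu> i\<close>. Eigenvectors for
  distinct eigenvalues and Jordan chains are both of this form.
\<close>

definition triangular_chain ::
    "'a::complex_normed_vector bop \<Rightarrow> nat \<Rightarrow> (nat \<Rightarrow> 'a) \<Rightarrow> (nat \<Rightarrow> complex) \<Rightarrow> bool" where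
  "triangular_chain X n y \<mu> \<longleftrightarrow> (\<forall>i<n. y i \<notin> cvs.span (y ` {..<i}) \<and>
     X \<cdot> y i - \<mu> i *\<^sub>C y i \<in> cvs.span (y ` {..<i}) \<and> 1 \<le> cmod (\<mu> i))"

text \<open>
  Riesz's lemma gives unit vectors \<open>u i\<close> in the members of the flag at distance at least \<open>1/2\<close>
  from the preceding member. Since \<open>X\<^sup>k\<close> multiplies \<open>u i\<close> by a scalar of modulus at least \<open>1\<close> modulo
  the preceding member, the vectors \<open>X\<^sup>k u i\<close> are \<open>1/2\<close> apart, and so lie in distinct balls of a
  finite net of radius \<open>1/8\<close>.
\<close>

lemma triangular_chain_length_bounded:
  fixes X :: "'a::complex_normed_vector bop"
  assumes "quasi_precompact X"
  shows "\<exists>N. \<forall>n y \<mu>. triangular_chain X n y \<mu> \<longrightarrow> n \<le> N"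
proof -
  obtain k where "has_net (X ^ k) (1 / 8)"
    using quasi_precompact_net[OF assms, of "1 / 8"] by auto
  then obtain A where A: "finite A" "\<And>x. norm x \<le> 1 \<Longrightarrow> \<exists>a\<in>A. norm (X ^ k \<cdot> x - a) \<le> 1 / 8"
    unfolding has_net_def by blast
  show ?thesis
  proof (intro exI[of _ "card A"] allI impI)
    fix n :: nat and y :: "nat \<Rightarrow> 'a" and \<mu> :: "nat \<Rightarrow> complex"
    assume "triangular_chain X n y \<mu>"
    then have y: "\<And>i. i < n \<Longrightarrow> y i \<notin> cvs.span (y ` {..<i})"
      and Xy: "\<And>i. i < n \<Longrightarrow> X \<cdot> y i - \<mu> i *\<^sub>C y i \<in> cvs.span (y ` {..<i})"
      and \<mu>: "\<And>i. i < n \<Longrightarrow> 1 \<le> cmod (\<mu> i)"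
      by (auto simp: triangular_chain_def)
    define M where "M i = cvs.span (y ` {..<i})" for i
    have M_mono: "M i \<subseteq> M j" if "i \<le> j" for i j
      unfolding M_def using that by (intro cvs.span_mono) auto
    have XM: "X \<cdot> x \<in> M i" if "x \<in> M i" "i \<le> n" for x i
      using that(1) unfolding M_def
    proof (induction rule: cvs.span_induct_alt)
      case (step c b x)
      then obtain j where j: "j < i" "b = y j" by auto
      have "X \<cdot> y j - \<mu> j *\<^sub>C y j \<in> M i" using Xy[of j] j that M_mono[of j i] by (auto simp: M_def)
      then have "X \<cdot> y j - \<mu> j *\<^sub>C y j + \<mu> j *\<^sub>C y j \<in> M i"
        unfolding M_def using j by (intro cvs.span_add) (auto intro: cvs.span_scale cvs.span_base)
      then show ?case using step j by (auto simp: M_def intro!: cvs.span_add cvs.span_scale)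
    qed (simp add: cvs.span_zero)
    have XkM: "X ^ q \<cdot> x \<in> M i" if "x \<in> M i" "i \<le> n" for q x i
      using that by (induction q) (auto intro: XM)
    have "\<exists>u. norm u = 1 \<and> u \<in> M (Suc i) \<and> X \<cdot> u - \<mu> i *\<^sub>C u \<in> M i \<and> (\<forall>w\<in>M i. 1 / 2 \<le> norm (u - w))"
      if i: "i < n" for i
    proof -
      obtain s m where sm: "m \<in> M i" "norm (s *\<^sub>C (y i - m)) = 1"
          "\<And>w. w \<in> M i \<Longrightarrow> 1 / 2 \<le> norm (s *\<^sub>C (y i - m) - w)"
        using Riesz_lemma[OF cvs.subspace_span closed_span_finite y[OF i]] unfolding M_def by blast
      have "y i \<in> M (Suc i)" unfolding M_def by (intro cvs.span_base) auto
      then have "s *\<^sub>C (y i - m) \<in> M (Suc i)"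
        using sm(1) M_mono[of i "Suc i"] unfolding M_def by (intro cvs.span_scale cvs.span_diff) auto
      moreover have "X \<cdot> (s *\<^sub>C (y i - m)) - \<mu> i *\<^sub>C s *\<^sub>C (y i - m)
          = s *\<^sub>C ((X \<cdot> y i - \<mu> i *\<^sub>C y i) - (X \<cdot> m - \<mu> i *\<^sub>C m))"
        by (simp add: cvs.scale_right_diff_distrib scaleC_scaleC mult.commute)
      moreover have "X \<cdot> m - \<mu> i *\<^sub>C m \<in> M i"
        using XM[OF sm(1)] sm(1) i unfolding M_def by (intro cvs.span_scale cvs.span_diff) auto
      then have "s *\<^sub>C ((X \<cdot> y i - \<mu> i *\<^sub>C y i) - (X \<cdot> m - \<mu> i *\<^sub>C m)) \<in> M i"
        using Xy[OF i] unfolding M_def by (metis cvs.span_scale cvs.span_diff)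
      ultimately show ?thesis using sm by (intro exI[of _ "s *\<^sub>C (y i - m)"]) auto
    qed
    then obtain u where u: "\<And>i. i < n \<Longrightarrow> norm (u i) = 1" "\<And>i. i < n \<Longrightarrow> u i \<in> M (Suc i)"
        "\<And>i. i < n \<Longrightarrow> X \<cdot> u i - \<mu> i *\<^sub>C u i \<in> M i"
        "\<And>i w. i < n \<Longrightarrow> w \<in> M i \<Longrightarrow> 1 / 2 \<le> norm (u i - w)"
      by metis
    have Xk: "X ^ q \<cdot> u i - \<mu> i ^ q *\<^sub>C u i \<in> M i" if i: "i < n" for i q
    proof (induction q)
      case (Suc q)
      have "X \<cdot> (X ^ q \<cdot> u i - \<mu> i ^ q *\<^sub>C u i) + \<mu> i ^ q *\<^sub>C (X \<cdot> u i - \<mu> i *\<^sub>C u i) \<in> M i"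
        using XM[OF Suc] u(3)[OF i] i unfolding M_def by (intro cvs.span_add cvs.span_scale) auto
      then show ?case by (simp add: cvs.scale_right_diff_distrib scaleC_scaleC mult.commute)
    qed (simp add: M_def cvs.span_zero scaleC_one)
    \<comment> \<open>The distance of \<open>X ^ k \<cdot> u i\<close> from \<open>M i\<close> is \<open>\<bar>\<mu> i\<bar> ^ k\<close> times that of \<open>u i\<close>.\<close>
    have sep: "1 / 2 \<le> norm (X ^ k \<cdot> u i - X ^ k \<cdot> u j)" if "i < n" "j < i" for i j
    proof -
      define w where "w = inverse (\<mu> i ^ k) *\<^sub>C (X ^ k \<cdot> u j - (X ^ k \<cdot> u i - \<mu> i ^ k *\<^sub>C u i))"
      have "u j \<in> M i" using u(2)[of j] M_mono[of "Suc j" i] that by auto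
      then have "w \<in> M i"
        using XkM[of "u j" i k] Xk[of i k] that unfolding w_def M_def
        by (metis cvs.span_scale cvs.span_diff less_imp_le)
      then have "1 / 2 \<le> norm (u i - w)" using u(4) that by blast
      moreover have "1 \<le> cmod (\<mu> i) ^ k" using \<mu> that by simp
      ultimately have "1 / 2 \<le> cmod (\<mu> i ^ k) * norm (u i - w)"
        using mult_mono[of 1 "cmod (\<mu> i ^ k)" "1/2" "norm (u i - w)"] by (simp add: norm_power)
      also have "\<dots> = norm (\<mu> i ^ k *\<^sub>C (u i - w))" by (simp add: norm_scaleC)
      also have "\<mu> i ^ k *\<^sub>C (u i - w) = X ^ k \<cdot> u i - X ^ k \<cdot> u j"
      proof -
        have "\<mu> i \<noteq> 0" using \<mu>[of i] that by auto
        then show ?thesis by (simp add: w_def cvs.scale_right_diff_distrib scaleC_scaleC scaleC_one)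
      qed
      finally show ?thesis .
    qed
    have "\<forall>i\<in>{..<n}. \<exists>a\<in>A. norm (X ^ k \<cdot> u i - a) \<le> 1 / 8" using A(2) u(1) by simp
    then obtain g where g: "\<And>i. i < n \<Longrightarrow> g i \<in> A" "\<And>i. i < n \<Longrightarrow> norm (X ^ k \<cdot> u i - g i) \<le> 1 / 8"
      by (metis lessThan_iff)
    have "g i \<noteq> g j" if "i < n" "j < i" for i j
    proof
      assume "g i = g j"
      then have "norm (X ^ k \<cdot> u i - X ^ k \<cdot> u j) \<le> 1 / 8 + 1 / 8"
        using norm_triangle_mono[OF g(2)[of i] g(2)[of j, unfolded norm_minus_commute[of _ "g j"]]] that by simp
      then show False using sep[OF that] by simp
    qed
    then have "inj_on g {..<n}"
      by (intro linorder_inj_onI) (metis lessThan_iff order_less_imp_not_eq2, auto)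
    then have "card {..<n} \<le> card A" using g A by (intro card_inj_on_le) auto
    then show "n \<le> card A" by simp
  qed
qed

lemma totally_bounded_sequence:
  fixes x :: "nat \<Rightarrow> 'a::banach"
  assumes "\<And>\<epsilon>. 0 < \<epsilon> \<Longrightarrow> \<exists>A. finite A \<and> (\<forall>i. \<exists>a\<in>A. norm (x i - a) \<le> \<epsilon>)"
  obtains l s where "strict_mono s" "(x \<circ> s) \<longlonglongrightarrow> l"
proof -
  have "compact (closure (range x))"
    unfolding compact_eq_totally_bounded
  proof (intro conjI allI impI)
    show "complete (closure (range x))" by (simp add: complete_eq_closed)
    fix e :: real assume "0 < e"
    then obtain A where A: "finite A" "\<And>i. \<exists>a\<in>A. norm (x i - a) \<le> e / 2" using assms[of "e / 2"] by auto
    have "closed (\<Union>a\<in>A. cball a (e / 2))" using A by (intro closed_UN) auto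
    moreover have "range x \<subseteq> (\<Union>a\<in>A. cball a (e / 2))"
      using A(2) by (force simp: dist_norm norm_minus_commute)
    ultimately have "closure (range x) \<subseteq> (\<Union>a\<in>A. cball a (e / 2))" by (rule closure_minimal[rotated])
    also have "\<dots> \<subseteq> (\<Union>a\<in>A. ball a e)" using \<open>0 < e\<close> by force
    finally show "\<exists>k. finite k \<and> closure (range x) \<subseteq> (\<Union>x\<in>k. ball x e)" using A by blast
  qed
  moreover have "\<forall>i. x i \<in> closure (range x)" using closure_subset by fastforce
  ultimately show ?thesis using that unfolding compact_def by metis
qed

text \<open>
  From \<open>z x - X x\<close> one gets \<open>z\<^sup>n x - X\<^sup>n x\<close> by applying a polynomial in \<open>X\<close>. So \<open>z\<^sup>n x\<^sub>i\<close> is the sum of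
  a convergent sequence and of \<open>X\<^sup>n x\<^sub>i\<close>, which has a fine finite net when \<open>n\<close> is large.
\<close>

lemma quasi_precompact_subsequence:
  fixes X :: "'a::{complex_normed_vector, banach} bop"
  assumes "quasi_precompact X" "\<And>i. norm (x i) \<le> B" "1 \<le> cmod z"
    and lim: "(\<lambda>i. z *\<^sub>C x i - X \<cdot> x i) \<longlonglongrightarrow> y"
  shows "\<exists>l s. strict_mono s \<and> (x \<circ> s) \<longlonglongrightarrow> l"
proof (rule totally_bounded_sequence[of x])
  fix \<epsilon> :: real assume "0 < \<epsilon>"
  define C where "C = max B 1"
  have C: "0 < C" "\<And>i. norm (x i) \<le> C" using assms(2) by (auto simp: C_def le_max_iff_disj)
  obtain n where n: "has_net (X ^ n) (\<epsilon> / (2 * C))"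
    using quasi_precompact_net[OF assms(1), of "\<epsilon> / (2 * C)"] C \<open>0 < \<epsilon>\<close> by auto
  then obtain A where A: "finite A" "\<And>x. norm x \<le> 1 \<Longrightarrow> \<exists>a\<in>A. norm (X ^ n \<cdot> x - a) \<le> \<epsilon> / (2 * C)"
    unfolding has_net_def by blast
  define q where "q = geometric_quotient z X n"
  \<comment> \<open>The polynomial quotient carries \<open>z x - X x\<close> to \<open>z ^ n x - X ^ n x\<close>.\<close>
  define v where "v i = q \<cdot> (z *\<^sub>C x i - X \<cdot> x i)" for i
  have v: "v i = z ^ n *\<^sub>C x i - X ^ n \<cdot> x i" for i
  proof -
    have "v i = (q * (z *\<^sub>C 1 - X)) \<cdot> x i" by (simp add: v_def)
    then show ?thesis unfolding q_def geometric_quotient_right by simp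
  qed
  have "v \<longlonglongrightarrow> q \<cdot> y" unfolding v_def by (intro tendsto_intros lim)
  then obtain k where k: "\<And>i. i \<ge> k \<Longrightarrow> norm (v i - q \<cdot> y) \<le> \<epsilon> / 2"
    using \<open>0 < \<epsilon>\<close> unfolding LIMSEQ_iff by (metis half_gt_zero less_imp_le)
  define V where "V = insert (q \<cdot> y) (v ` {..<k})"
  have V: "\<exists>b\<in>V. norm (v i - b) \<le> \<epsilon> / 2" for i
  proof (cases "i < k")
    case True
    then show ?thesis using \<open>0 < \<epsilon>\<close> by (intro bexI[of _ "v i"]) (auto simp: V_def)
  qed (use k in \<open>auto simp: V_def\<close>)
  have z: "1 \<le> cmod (z ^ n)" using assms(3) by (simp add: norm_power)
  then have z0: "z ^ n \<noteq> 0" by (metis norm_zero not_one_le_zero)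
  show "\<exists>A. finite A \<and> (\<forall>i. \<exists>a\<in>A. norm (x i - a) \<le> \<epsilon>)"
  proof (intro exI[of _ "(\<lambda>(a, b). inverse (z ^ n) *\<^sub>C (of_real C *\<^sub>C a + b)) ` (A \<times> V)"] conjI allI)
    show "finite ((\<lambda>(a, b). inverse (z ^ n) *\<^sub>C (of_real C *\<^sub>C a + b)) ` (A \<times> V))"
      using A by (simp add: V_def)
    fix i
    have "norm (of_real (inverse C) *\<^sub>C x i) \<le> 1"
      using C by (simp add: norm_scaleC norm_inverse norm_divide divide_simps)
    then obtain a where a: "a \<in> A" "norm (X ^ n \<cdot> (of_real (inverse C) *\<^sub>C x i) - a) \<le> \<epsilon> / (2 * C)"
      using A by blast
    obtain b where b: "b \<in> V" "norm (v i - b) \<le> \<epsilon> / 2" using V by blast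
    have "X ^ n \<cdot> x i - of_real C *\<^sub>C a = of_real C *\<^sub>C (X ^ n \<cdot> (of_real (inverse C) *\<^sub>C x i) - a)"
      using C by (simp add: cvs.scale_right_diff_distrib scaleC_scaleC scaleC_one flip: of_real_mult)
    then have "norm (X ^ n \<cdot> x i - of_real C *\<^sub>C a) \<le> C * (\<epsilon> / (2 * C))"
      using a C by (simp only: norm_scaleC norm_of_real) (intro mult_mono, auto)
    then have "norm ((X ^ n \<cdot> x i - of_real C *\<^sub>C a) + (v i - b)) \<le> \<epsilon> / 2 + \<epsilon> / 2"
      using b C by (intro norm_triangle_mono) auto
    moreover have "(X ^ n \<cdot> x i - of_real C *\<^sub>C a) + (v i - b) = z ^ n *\<^sub>C x i - (of_real C *\<^sub>C a + b)"
      by (simp add: v)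
    ultimately have "norm (z ^ n *\<^sub>C x i - (of_real C *\<^sub>C a + b)) \<le> \<epsilon>" by simp
    moreover have "x i - inverse (z ^ n) *\<^sub>C (of_real C *\<^sub>C a + b)
        = inverse (z ^ n) *\<^sub>C (z ^ n *\<^sub>C x i - (of_real C *\<^sub>C a + b))"
      using z0 by (simp only: cvs.scale_right_diff_distrib scaleC_scaleC left_inverse[OF z0] scaleC_one)
    moreover have "cmod (inverse (z ^ n)) * norm (z ^ n *\<^sub>C x i - (of_real C *\<^sub>C a + b))
        \<le> 1 * norm (z ^ n *\<^sub>C x i - (of_real C *\<^sub>C a + b))"
      using z by (intro mult_right_mono) (auto simp: norm_inverse inverse_le_1_iff)
    ultimately have "norm (x i - inverse (z ^ n) *\<^sub>C (of_real C *\<^sub>C a + b)) \<le> \<epsilon>"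
      by (simp add: norm_scaleC)
    then show "\<exists>a\<in>(\<lambda>(a, b). inverse (z ^ n) *\<^sub>C (of_real C *\<^sub>C a + b)) ` (A \<times> V). norm (x i - a) \<le> \<epsilon>"
      using a b by force
  qed
qed blast

text \<open>
  Unit vectors on which \<open>z - X\<close> is ever smaller accumulate at an eigenvector.
\<close>

section \<open>Spectrum outside the open unit disc\<close>

lemma bounded_below_if_not_eigenvalue:
  fixes X :: "'a::{complex_normed_vector, banach} bop"
  assumes X: "quasi_precompact X" and z: "1 \<le> cmod z"
    and inj: "\<And>x. X \<cdot> x = z *\<^sub>C x \<Longrightarrow> x = 0"
  shows "\<exists>c>0. \<forall>x. c * norm x \<le> norm ((z *\<^sub>C 1 - X) \<cdot> x)"
proof (rule ccontr)
  assume no: "\<not> ?thesis"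
  have "\<exists>u. norm u = 1 \<and> norm ((z *\<^sub>C 1 - X) \<cdot> u) \<le> inverse (real (Suc i))" for i
  proof -
    obtain x where x: "norm ((z *\<^sub>C 1 - X) \<cdot> x) < inverse (real (Suc i)) * norm x"
      using no by (metis not_le inverse_positive_iff_positive of_nat_0_less_iff zero_less_Suc)
    then have "0 < norm x" by (auto simp del: app_simps)
    define u where "u = of_real (inverse (norm x)) *\<^sub>C x"
    have "norm u = 1" using \<open>0 < norm x\<close> by (simp add: u_def norm_scaleC norm_inverse norm_divide)
    have "(z *\<^sub>C 1 - X) \<cdot> u = of_real (inverse (norm x)) *\<^sub>C ((z *\<^sub>C 1 - X) \<cdot> x)"
      unfolding u_def by (rule app_linear)
    then have normXu: "norm ((z *\<^sub>C 1 - X) \<cdot> u) = inverse (norm x) * norm ((z *\<^sub>C 1 - X) \<cdot> x)"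
      by (simp only: norm_scaleC norm_of_real) simp
    have "inverse (norm x) * norm ((z *\<^sub>C 1 - X) \<cdot> x) \<le> inverse (norm x) * (inverse (real (Suc i)) * norm x)"
      using x by (intro mult_left_mono) auto
    also have "\<dots> = inverse (real (Suc i))" using \<open>0 < norm x\<close> by simp
    finally have "norm ((z *\<^sub>C 1 - X) \<cdot> u) \<le> inverse (real (Suc i))" unfolding normXu .
    with \<open>norm u = 1\<close> show ?thesis by blast
  qed
  then obtain u where u: "\<And>i. norm (u i) = 1"
    "\<And>i. norm ((z *\<^sub>C 1 - X) \<cdot> u i) \<le> inverse (real (Suc i))" by metis
  have "(\<lambda>i. (z *\<^sub>C 1 - X) \<cdot> u i) \<longlonglongrightarrow> 0"
    by (rule Lim_null_comparison[OF _ LIMSEQ_inverse_real_of_nat]) (use u(2) in simp)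
  then have lim: "(\<lambda>i. z *\<^sub>C u i - X \<cdot> u i) \<longlonglongrightarrow> 0" by simp
  have "\<exists>l s. strict_mono s \<and> (u \<circ> s) \<longlonglongrightarrow> l"
    by (rule quasi_precompact_subsequence[OF X _ z lim, of 1]) (simp add: u(1))
  then obtain l s where s: "strict_mono s" and l: "(u \<circ> s) \<longlonglongrightarrow> l" by blast
  have "(\<lambda>i. z *\<^sub>C (u \<circ> s) i - X \<cdot> (u \<circ> s) i) \<longlonglongrightarrow> z *\<^sub>C l - X \<cdot> l"
    by (intro tendsto_intros l)
  moreover have "(\<lambda>i. z *\<^sub>C (u \<circ> s) i - X \<cdot> (u \<circ> s) i) \<longlonglongrightarrow> 0"
    using LIMSEQ_subseq_LIMSEQ[OF lim s] by (simp add: o_def)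
  ultimately have "z *\<^sub>C l - X \<cdot> l = 0" by (rule LIMSEQ_unique)
  then have "l = 0" by (intro inj) simp
  moreover have "(\<lambda>i. norm ((u \<circ> s) i)) \<longlonglongrightarrow> norm l" by (intro tendsto_intros l)
  then have "norm l = 1" using u(1) by (simp add: LIMSEQ_const_iff)
  ultimately show False by simp
qed

lemma norm_inverse_bop_le:
  fixes a r :: "'a::complex_normed_vector bop"
  assumes "a * r = 1" "0 < c" "\<And>x. c * norm x \<le> norm (a \<cdot> x)"
  shows "norm r \<le> 1 / c"
proof (rule norm_bop_bound)
  fix x
  have "a \<cdot> r \<cdot> x = x" using assms(1) by (metis app_simps(5,6))
  then show "norm (r \<cdot> x) \<le> 1 / c * norm x"
    using assms(3)[of "r \<cdot> x"] \<open>0 < c\<close> by (simp add: field_simps)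
qed (use assms in simp)

text \<open>
  A lower bound for \<open>a\<close> bounds the norm of the inverse of every invertible operator near \<open>a\<close>
  uniformly, so invertibility can neither be lost nor gained near \<open>a\<close>.
\<close>

lemma invertible_iff_near_bounded_below:
  fixes a b :: "'a::{complex_normed_vector, banach} bop"
  assumes "0 < c" "\<And>x. c * norm x \<le> norm (a \<cdot> x)" "norm (a - b) \<le> c / 3"
  shows "invertible_in_ring a \<longleftrightarrow> invertible_in_ring b"
proof
  assume "invertible_in_ring a"
  then obtain r where r: "r * a = 1" "a * r = 1" by (auto simp: invertible_in_ring_def)
  have "norm r * norm (a - b) \<le> 1 / c * (c / 3)"
    using norm_inverse_bop_le[OF r(2) assms(1,2)] assms by (intro mult_mono) auto
  then show "invertible_in_ring b"
    using \<open>0 < c\<close> by (intro invertible_perturbation[OF r]) auto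
next
  assume "invertible_in_ring b"
  then obtain r where r: "r * b = 1" "b * r = 1" by (auto simp: invertible_in_ring_def)
  have "2 * c / 3 * norm x \<le> norm (b \<cdot> x)" for x
  proof -
    have "norm ((a - b) \<cdot> x) \<le> c / 3 * norm x"
      using norm_app[of "a - b" x] mult_right_mono[OF assms(3), of "norm x"] by simp
    then show ?thesis using assms(2)[of x] norm_triangle_ineq2[of "a \<cdot> x" "b \<cdot> x"] by simp
  qed
  from norm_inverse_bop_le[OF r(2) _ this]
  have "norm r * norm (b - a) \<le> 1 / (2 * c / 3) * (c / 3)"
    using assms by (intro mult_mono) (auto simp: norm_minus_commute)
  then show "invertible_in_ring a"
    using \<open>0 < c\<close> by (intro invertible_perturbation[OF r]) auto
qed

text \<open>
  Along the ray from \<open>z\<close> to infinity invertibility is locally constant, by the previous lemma, and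
  it holds far out, by the Neumann series. This takes the place of the Riesz-Schauder theory.
\<close>

lemma invertible_if_no_eigenvalue_on_ray:
  fixes X :: "'a::{complex_normed_vector, banach} bop"
  assumes X: "quasi_precompact X" and z: "1 \<le> cmod z"
    and inj: "\<And>s x. 1 \<le> s \<Longrightarrow> X \<cdot> x = (of_real s * z) *\<^sub>C x \<Longrightarrow> x = 0"
  shows "invertible_in_ring (z *\<^sub>C 1 - X)"
proof -
  define P where "P s = invertible_in_ring ((of_real s * z) *\<^sub>C 1 - X)" for s :: real
  define s0 where "s0 = norm X + 1"
  have "P 1 = P s0"
  proof (rule connected_local_const[of "{1..}"])
    show "connected {1::real..}" by simp
    show "1 \<in> {1::real..}" "s0 \<in> {1..}" by (auto simp: s0_def)
    show "\<forall>s\<in>{1..}. eventually (\<lambda>s'. P s = P s') (at s within {1..})"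
    proof
      fix s :: real assume s: "s \<in> {1..}"
      have "1 \<le> cmod (of_real s * z)"
        using s z mult_mono[of 1 s 1 "cmod z"] by (simp add: norm_mult)
      then have "\<exists>c>0. \<forall>x. c * norm x \<le> norm (((of_real s * z) *\<^sub>C 1 - X) \<cdot> x)"
        using s by (intro bounded_below_if_not_eigenvalue[OF X] inj[of s]) auto
      then obtain c where c: "0 < c" "\<And>x. c * norm x \<le> norm (((of_real s * z) *\<^sub>C 1 - X) \<cdot> x)"
        by blast
      have "P s = P s'" if "dist s' s < c / 3 / cmod z" for s'
        unfolding P_def
      proof (rule invertible_iff_near_bounded_below[OF c])
        have "((of_real s * z) *\<^sub>C 1 - X) - ((of_real s' * z) *\<^sub>C 1 - X)
            = (of_real (s - s') * z) *\<^sub>C (1 :: 'a bop)"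
          by (simp add: left_diff_distrib flip: cvs.scale_left_diff_distrib)
        then have "norm (((of_real s * z) *\<^sub>C 1 - X) - ((of_real s' * z) *\<^sub>C 1 - X))
            = \<bar>s - s'\<bar> * cmod z * norm (1 :: 'a bop)"
          by (simp only: norm_scaleC norm_mult norm_of_real)
        also have "\<dots> \<le> \<bar>s - s'\<bar> * cmod z * 1"
          using norm_bop_one by (intro mult_left_mono) auto
        also have "\<dots> \<le> c / 3"
        proof -
          have "0 < cmod z" using z by linarith
          then have "\<bar>s - s'\<bar> * cmod z < c / 3"
            using that by (simp add: dist_real_def abs_minus_commute pos_less_divide_eq)
          then show ?thesis by simp
        qed
        finally show "norm (((of_real s * z) *\<^sub>C 1 - X) - ((of_real s' * z) *\<^sub>C 1 - X)) \<le> c / 3" .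
      qed
      moreover have "0 < c / 3 / cmod z" using c z by (intro divide_pos_pos) auto
      ultimately show "eventually (\<lambda>s'. P s = P s') (at s within {1..})"
        unfolding eventually_at by blast
    qed
  qed
  moreover have "P s0"
    unfolding P_def
  proof (rule invertible_scaleC_minus)
    have "norm X < s0 * 1" by (simp add: s0_def)
    also have "\<dots> \<le> s0 * cmod z" using z by (intro mult_left_mono) (auto simp: s0_def)
    finally show "norm X < cmod (of_real s0 * z)" by (simp add: norm_mult s0_def)
  qed
  ultimately show ?thesis by (simp add: P_def)
qed

interpretation norm_bop: unital_seminorm "norm :: 'a::complex_normed_vector bop \<Rightarrow> real"
  by unfold_locales (rule norm_triangle_ineq norm_scaleC norm_mult_ineq norm_bop_one)+

lemma power_contracts_if_no_large_eigenvalue: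
  fixes X :: "'a::{complex_normed_vector, banach} bop"
  assumes "quasi_precompact X"
    and "\<And>z x. 1 \<le> cmod z \<Longrightarrow> X \<cdot> x = z *\<^sub>C x \<Longrightarrow> x = 0"
  shows "\<exists>n\<ge>1. norm (X ^ n) < 1"
proof -
  have "\<exists>n\<ge>1. norm (X ^ n) < 1 ^ n"
  proof (rule norm_bop.power_small_if_resolvent_everywhere)
    fix z assume z: "1 \<le> cmod z"
    have "invertible_in_ring (z *\<^sub>C 1 - X)"
    proof (rule invertible_if_no_eigenvalue_on_ray[OF assms(1) z])
      fix s x assume "1 \<le> s" "X \<cdot> x = (of_real s * z) *\<^sub>C x"
      moreover have "1 \<le> cmod (of_real s * z)"
        using \<open>1 \<le> s\<close> z mult_mono[of 1 s 1 "cmod z"] by (simp add: norm_mult)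
      ultimately show "x = 0" using assms(2) by blast
    qed
    then show "\<exists>s. norm_bop.sim (s * (z *\<^sub>C 1 - X)) 1 \<and> norm_bop.sim ((z *\<^sub>C 1 - X) * s) 1"
      unfolding invertible_in_ring_def norm_bop.sim_def by auto
  qed simp
  then show ?thesis by simp
qed

definition fixed_space :: "'a::complex_normed_vector bop \<Rightarrow> 'a set" where
  "fixed_space V = {x. V \<cdot> x = x}"

text \<open>
  A linearly independent sequence in the fixed space is a triangular chain with all \<open>\<mu> i = 1\<close>, so a
  longest one exists; it spans.
\<close>

lemma fixed_space_finite_dimensional:
  assumes "quasi_precompact V"
  shows "finite_dimensional (fixed_space V)"
proof -
  obtain N where N: "\<And>n y \<mu>. triangular_chain V n y \<mu> \<Longrightarrow> n \<le> N"
    using triangular_chain_length_bounded[OF assms] by blast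
  have sub: "cvs.span A \<subseteq> fixed_space V" if "A \<subseteq> fixed_space V" for A
    by (rule cvs.span_minimal[OF that]) (auto simp: cvs.subspace_def fixed_space_def)
  define Q where "Q n \<longleftrightarrow> (\<exists>y. (\<forall>i<n. y i \<in> fixed_space V \<and> y i \<notin> cvs.span (y ` {..<i})))" for n :: nat
  have bound: "n \<le> N" if Qn: "Q n" for n
  proof -
    obtain y where "\<forall>i<n. y i \<in> fixed_space V \<and> y i \<notin> cvs.span (y ` {..<i})"
      using Qn unfolding Q_def by (elim exE) (rule that)
    then have "triangular_chain V n y (\<lambda>_. 1)"
      by (simp add: triangular_chain_def fixed_space_def scaleC_one cvs.span_zero)
    then show ?thesis by (rule N)
  qed
  have "Q 0" by (simp add: Q_def)
  define n where "n = (GREATEST n. Q n)"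
  have "Q n" unfolding n_def by (rule GreatestI_nat[of Q, OF \<open>Q 0\<close> bound])
  then obtain y where y: "\<And>i. i < n \<Longrightarrow> y i \<in> fixed_space V" "\<And>i. i < n \<Longrightarrow> y i \<notin> cvs.span (y ` {..<i})"
    by (auto simp: Q_def)
  have "fixed_space V \<subseteq> cvs.span (y ` {..<n})"
  proof (rule ccontr)
    assume "\<not> ?thesis"
    then obtain x where x: "x \<in> fixed_space V" "x \<notin> cvs.span (y ` {..<n})" by blast
    have im: "(y(n := x)) ` {..<i} = y ` {..<i}" if "i \<le> n" for i
      using that by (intro image_cong) auto
    have "(y(n := x)) i \<in> fixed_space V \<and> (y(n := x)) i \<notin> cvs.span ((y(n := x)) ` {..<i})"
      if "i < Suc n" for i
    proof -
      have "i \<le> n" using that by simp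
      then show ?thesis unfolding im[OF \<open>i \<le> n\<close>] using x y[of i] by (cases "i = n") auto
    qed
    then have "Q (Suc n)" unfolding Q_def by blast
    then have "Suc n \<le> n" unfolding n_def by (rule Greatest_le_nat[OF _ bound])
    then show False by simp
  qed
  moreover have "cvs.span (y ` {..<n}) \<subseteq> fixed_space V" using y by (intro sub) auto
  ultimately show ?thesis unfolding finite_dimensional_def by (metis finite_imageI finite_lessThan subset_antisym)
qed

lemma subspace_fixed_space: "cvs.subspace (fixed_space V)"
  by (auto simp: cvs.subspace_def fixed_space_def)

lemma closed_fixed_space: "closed (fixed_space V)"
  unfolding fixed_space_def
  by (intro closed_Collect_eq continuous_on_id linear_continuous_on bounded_linear_app)

text \<open>
  The range of \<open>V - 1\<close> is closed, in quantitative form. Otherwise there are unit vectors \<open>u\<^sub>i\<close> away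
  from the fixed space with \<open>V u\<^sub>i - u\<^sub>i\<close> tending to \<open>0\<close>; a limit point would be fixed.
\<close>

section \<open>The projection onto the fixed space\<close>

lemma distance_to_fixed_space_le:
  fixes V :: "'a::{complex_normed_vector, banach} bop"
  assumes "quasi_precompact V"
  shows "\<exists>c>0. \<forall>x. \<exists>f\<in>fixed_space V. norm (x - f) \<le> c * norm (V \<cdot> x - x)"
proof (rule ccontr)
  assume no: "\<not> ?thesis"
  have "\<exists>u. norm u = 1 \<and> (\<forall>f\<in>fixed_space V. 1 / 2 \<le> norm (u - f)) \<and>
      norm (V \<cdot> u - u) \<le> inverse (real (Suc i))" for i
  proof -
    have "0 < real (Suc i)" by simp
    then obtain x where x: "\<And>f. f \<in> fixed_space V \<Longrightarrow> real (Suc i) * norm (V \<cdot> x - x) < norm (x - f)"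
      using no by (metis not_le)
    have "x \<notin> fixed_space V" using x[of x] by (auto simp: fixed_space_def)
    then obtain s m where sm: "m \<in> fixed_space V" "norm (s *\<^sub>C (x - m)) = 1"
        "\<And>w. w \<in> fixed_space V \<Longrightarrow> 1 / 2 \<le> norm (s *\<^sub>C (x - m) - w)"
      using Riesz_lemma[OF subspace_fixed_space closed_fixed_space] by blast
    have "V \<cdot> (s *\<^sub>C (x - m)) - s *\<^sub>C (x - m) = s *\<^sub>C (V \<cdot> x - x)"
      using sm(1) by (simp add: fixed_space_def cvs.scale_right_diff_distrib)
    then have "real (Suc i) * norm (V \<cdot> (s *\<^sub>C (x - m)) - s *\<^sub>C (x - m))
        = cmod s * (real (Suc i) * norm (V \<cdot> x - x))"
      by (simp only: norm_scaleC) simp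
    also have "\<dots> \<le> cmod s * norm (x - m)" using x[OF sm(1)] by (intro mult_left_mono) auto
    also have "\<dots> = 1" using sm(2) by (simp only: norm_scaleC)
    finally have "norm (V \<cdot> (s *\<^sub>C (x - m)) - s *\<^sub>C (x - m)) \<le> inverse (real (Suc i))"
      by (simp add: field_simps del: app_linear)
    then show ?thesis using sm by blast
  qed
  then obtain u where u: "\<And>i. norm (u i) = 1" "\<And>i f. f \<in> fixed_space V \<Longrightarrow> 1 / 2 \<le> norm (u i - f)"
      "\<And>i. norm (V \<cdot> u i - u i) \<le> inverse (real (Suc i))" by metis
  have "(\<lambda>i. V \<cdot> u i - u i) \<longlonglongrightarrow> 0"
    by (rule Lim_null_comparison[OF _ LIMSEQ_inverse_real_of_nat]) (use u(3) in simp)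
  then have lim: "(\<lambda>i. 1 *\<^sub>C u i - V \<cdot> u i) \<longlonglongrightarrow> 0"
    using tendsto_minus by (fastforce simp: scaleC_one)
  have "\<exists>l s. strict_mono s \<and> (u \<circ> s) \<longlonglongrightarrow> l"
    by (rule quasi_precompact_subsequence[OF assms _ _ lim, of 1]) (simp_all add: u(1))
  then obtain l s where s: "strict_mono s" and l: "(u \<circ> s) \<longlonglongrightarrow> l" by blast
  have "(\<lambda>i. 1 *\<^sub>C (u \<circ> s) i - V \<cdot> (u \<circ> s) i) \<longlonglongrightarrow> 1 *\<^sub>C l - V \<cdot> l"
    by (intro tendsto_intros l)
  moreover have "(\<lambda>i. 1 *\<^sub>C (u \<circ> s) i - V \<cdot> (u \<circ> s) i) \<longlonglongrightarrow> 0"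
    using LIMSEQ_subseq_LIMSEQ[OF lim s] by (simp add: o_def)
  ultimately have "1 *\<^sub>C l - V \<cdot> l = 0" by (rule LIMSEQ_unique)
  then have "l \<in> fixed_space V" by (simp add: fixed_space_def scaleC_one)
  have "(\<lambda>i. norm ((u \<circ> s) i - l)) \<longlonglongrightarrow> norm (l - l)" by (intro tendsto_intros l)
  moreover have "\<forall>i\<ge>0. 1 / 2 \<le> norm ((u \<circ> s) i - l)" using u(2)[OF \<open>l \<in> fixed_space V\<close>] by simp
  ultimately have "1 / 2 \<le> norm (l - l)" by (intro LIMSEQ_le_const) blast+
  then show False by simp
qed

text \<open>
  If there were unit fixed vectors ever closer to the range of \<open>V - 1\<close>, a limit point would be a
  nonzero fixed vector \<open>V k - k\<close>, against semisimplicity. By the previous lemma the preimages can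
  be kept bounded, which is what makes them accumulate.
\<close>

lemma fixed_space_transversal_to_range:
  fixes V :: "'a::{complex_normed_vector, banach} bop"
  assumes V: "quasi_precompact V"
    and semisimple: "\<And>x. V \<cdot> x - x \<in> fixed_space V \<Longrightarrow> V \<cdot> x = x"
  shows "\<exists>c>0. \<forall>f\<in>fixed_space V. \<forall>v. norm f \<le> c * norm (f - (V \<cdot> v - v))"
proof (rule ccontr)
  assume no: "\<not> ?thesis"
  obtain c where c: "0 < c" "\<And>x. \<exists>f\<in>fixed_space V. norm (x - f) \<le> c * norm (V \<cdot> x - x)"
    using distance_to_fixed_space_le[OF V] by blast
  have "\<exists>f v. f \<in> fixed_space V \<and> norm f = 1 \<and> norm v \<le> 2 * c \<and>
      norm (f - (V \<cdot> v - v)) \<le> inverse (real (Suc i))" for i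
  proof -
    have "0 < real (Suc i)" by simp
    then obtain f v where f: "f \<in> fixed_space V" and fv: "real (Suc i) * norm (f - (V \<cdot> v - v)) < norm f"
      using no by (metis not_le)
    define f' where "f' = of_real (inverse (norm f)) *\<^sub>C f"
    define w where "w = of_real (inverse (norm f)) *\<^sub>C v"
    have "0 < norm f"
    proof -
      have "0 \<le> real (Suc i) * norm (f - (V \<cdot> v - v))" by simp
      then show ?thesis using fv by linarith
    qed
    then have f': "f' \<in> fixed_space V" "norm f' = 1"
      using f by (auto simp: f'_def norm_scaleC norm_inverse norm_divide
          intro!: cvs.subspace_scale[OF subspace_fixed_space])
    have "f' - (V \<cdot> w - w) = of_real (inverse (norm f)) *\<^sub>C (f - (V \<cdot> v - v))"
      by (simp add: f'_def w_def cvs.scale_right_diff_distrib)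
    then have "norm (f' - (V \<cdot> w - w)) = inverse (norm f) * norm (f - (V \<cdot> v - v))"
      by (simp only: norm_scaleC norm_of_real) simp
    moreover have "inverse (norm f) * (real (Suc i) * norm (f - (V \<cdot> v - v))) \<le> inverse (norm f) * norm f"
      using fv by (intro mult_left_mono) auto
    ultimately have small: "real (Suc i) * norm (f' - (V \<cdot> w - w)) \<le> 1"
      using \<open>0 < norm f\<close> by (simp add: mult_ac)
    then have small': "norm (f' - (V \<cdot> w - w)) \<le> inverse (real (Suc i))" by (simp add: field_simps)
    also have "\<dots> \<le> 1" by (simp add: field_simps)
    finally have Vw: "norm (V \<cdot> w - w) \<le> 2"
      using norm_triangle_ineq4[of f' "f' - (V \<cdot> w - w)"] f'(2) by simp
    obtain g where g: "g \<in> fixed_space V" "norm (w - g) \<le> c * norm (V \<cdot> w - w)" using c(2) by blast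
    have "norm (w - g) \<le> 2 * c" using g(2) mult_left_mono[OF Vw, of c] c(1) by linarith
    moreover have "V \<cdot> (w - g) - (w - g) = V \<cdot> w - w" using g(1) by (simp add: fixed_space_def)
    ultimately show ?thesis using f' small' by metis
  qed
  then obtain f v where f: "\<And>i. f i \<in> fixed_space V" "\<And>i. norm (f i) = 1" and v: "\<And>i. norm (v i) \<le> 2 * c"
      and fv: "\<And>i. norm (f i - (V \<cdot> v i - v i)) \<le> inverse (real (Suc i))" by metis
  have lim: "(\<lambda>i. f i - (V \<cdot> v i - v i)) \<longlonglongrightarrow> 0"
    by (rule Lim_null_comparison[OF _ LIMSEQ_inverse_real_of_nat]) (use fv in simp)
  have flim: "(\<lambda>i. 1 *\<^sub>C f i - V \<cdot> f i) \<longlonglongrightarrow> 0" using f(1) by (simp add: fixed_space_def scaleC_one)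
  have "\<exists>l s. strict_mono s \<and> (f \<circ> s) \<longlonglongrightarrow> l"
    by (rule quasi_precompact_subsequence[OF V _ _ flim, of 1]) (simp_all add: f(2))
  then obtain l s where s: "strict_mono s" and l: "(f \<circ> s) \<longlonglongrightarrow> l" by blast
  have "(\<lambda>i. (f (s i) - (V \<cdot> v (s i) - v (s i))) - f (s i)) \<longlonglongrightarrow> 0 - l"
    using LIMSEQ_subseq_LIMSEQ[OF lim s] l by (intro tendsto_diff) (simp_all add: o_def)
  then have lim': "(\<lambda>i. 1 *\<^sub>C (v \<circ> s) i - V \<cdot> (v \<circ> s) i) \<longlonglongrightarrow> - l" by (simp add: scaleC_one)
  have "\<exists>k t. strict_mono t \<and> (v \<circ> s \<circ> t) \<longlonglongrightarrow> k"
    by (rule quasi_precompact_subsequence[OF V _ _ lim', of "2 * c"]) (simp_all add: v)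
  then obtain k t where t: "strict_mono t" and k: "(v \<circ> s \<circ> t) \<longlonglongrightarrow> k" by blast
  have "(\<lambda>i. 1 *\<^sub>C (v \<circ> s \<circ> t) i - V \<cdot> (v \<circ> s \<circ> t) i) \<longlonglongrightarrow> 1 *\<^sub>C k - V \<cdot> k"
    by (intro tendsto_intros k)
  moreover have "(\<lambda>i. 1 *\<^sub>C (v \<circ> s \<circ> t) i - V \<cdot> (v \<circ> s \<circ> t) i) \<longlonglongrightarrow> - l"
    using LIMSEQ_subseq_LIMSEQ[OF lim' t] by (simp add: o_def)
  ultimately have "1 *\<^sub>C k - V \<cdot> k = - l" by (rule LIMSEQ_unique)
  then have kl: "V \<cdot> k - k = l" by (simp add: scaleC_one algebra_simps)
  have "l \<in> fixed_space V"
    using closed_fixed_space f(1) l unfolding closed_sequential_limits by (metis o_def)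
  then have "V \<cdot> k = k" using semisimple kl by simp
  then have "l = 0" using kl by simp
  moreover have "(\<lambda>i. norm ((f \<circ> s) i)) \<longlonglongrightarrow> norm l" by (intro tendsto_intros l)
  then have "norm l = 1" using f(2) by (simp add: LIMSEQ_const_iff)
  ultimately show False by simp
qed

text \<open>
  The hypothesis on \<open>e\<close> says that \<open>e = \<epsilon> (1 + \<epsilon> - V)\<^sup>-\<^sup>1\<close>. Put \<open>w = e u\<close>. Then
  \<open>V w - w = \<epsilon> (w - u)\<close> is small compared with \<open>w\<close> and \<open>u\<close>, so \<open>w\<close> is close to a fixed vector \<open>f\<close>; and \<open>w - u\<close>
  lies in the range of \<open>V - 1\<close>, so \<open>f\<close> is controlled by \<open>f - (w - u)\<close>, hence by \<open>u\<close>.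
\<close>

lemma Abel_means_bounded:
  fixes V :: "'a::{complex_normed_vector, banach} bop"
  assumes V: "quasi_precompact V"
    and semisimple: "\<And>x. V \<cdot> x - x \<in> fixed_space V \<Longrightarrow> V \<cdot> x = x"
  shows "\<exists>\<delta>>0. \<exists>M. \<forall>\<epsilon> e. 0 < \<epsilon> \<longrightarrow> \<epsilon> \<le> \<delta> \<longrightarrow>
      (V - 1) * e = of_real \<epsilon> *\<^sub>C (e - 1) \<longrightarrow> norm e \<le> M"
proof -
  obtain c where c: "0 < c" "\<And>x. \<exists>f\<in>fixed_space V. norm (x - f) \<le> c * norm (V \<cdot> x - x)"
    using distance_to_fixed_space_le[OF V] by blast
  obtain d where d: "0 < d" "\<And>f v. f \<in> fixed_space V \<Longrightarrow> norm f \<le> d * norm (f - (V \<cdot> v - v))"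
    using fixed_space_transversal_to_range[OF V semisimple] by blast
  define \<delta> where "\<delta> = 1 / 2 * inverse ((1 + d) * c)"
  have "0 < \<delta>" using c d by (simp add: \<delta>_def)
  have "norm e \<le> 2 * d + 1"
    if \<epsilon>: "0 < \<epsilon>" "\<epsilon> \<le> \<delta>" and e: "(V - 1) * e = of_real \<epsilon> *\<^sub>C (e - 1)" for \<epsilon> e
  proof (rule norm_bop_bound)
    fix u
    define w where "w = e \<cdot> u"
    have Vw: "V \<cdot> w - w = of_real \<epsilon> *\<^sub>C (w - u)"
      using arg_cong[OF e, of "\<lambda>f. f \<cdot> u"] by (simp add: w_def)
    obtain f where f: "f \<in> fixed_space V" "norm (w - f) \<le> c * norm (V \<cdot> w - w)" using c(2) by blast
    have "norm (V \<cdot> w - w) \<le> \<epsilon> * (norm w + norm u)"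
      unfolding Vw norm_scaleC using \<epsilon> norm_triangle_ineq4[of w u] by (simp add: mult_left_mono)
    then have "c * norm (V \<cdot> w - w) \<le> c * (\<epsilon> * (norm w + norm u))"
      using c(1) by (intro mult_left_mono) auto
    then have wf: "norm (w - f) \<le> c * \<epsilon> * (norm w + norm u)" using f(2) by (simp add: mult.assoc)
    have "V \<cdot> (of_real (inverse \<epsilon>) *\<^sub>C w) - of_real (inverse \<epsilon>) *\<^sub>C w = of_real (inverse \<epsilon>) *\<^sub>C (V \<cdot> w - w)"
      by (simp add: cvs.scale_right_diff_distrib)
    also have "\<dots> = w - u"
    proof -
      have "of_real (inverse \<epsilon>) * of_real \<epsilon> = (1::complex)"
        using \<epsilon> by (simp flip: of_real_mult)
      then show ?thesis unfolding Vw scaleC_scaleC by (simp only: scaleC_one)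
    qed
    finally have "norm f \<le> d * norm (f - (w - u))" using d(2)[OF f(1)] by metis
    also have "\<dots> \<le> d * (norm (w - f) + norm u)"
      using d(1) norm_triangle_ineq[of "f - w" u] by (intro mult_left_mono) (auto simp: algebra_simps norm_minus_commute)
    finally have "norm w \<le> (1 + d) * norm (w - f) + d * norm u"
      using norm_triangle_ineq[of "w - f" f] by (simp add: algebra_simps)
    also have "\<dots> \<le> (1 + d) * (c * \<epsilon> * (norm w + norm u)) + d * norm u"
      using wf d(1) by (intro add_right_mono mult_left_mono) auto
    also have "\<dots> = ((1 + d) * c * \<epsilon>) * (norm w + norm u) + d * norm u" by simp
    also have "\<dots> \<le> 1 / 2 * (norm w + norm u) + d * norm u"
    proof (intro add_right_mono mult_right_mono)
      have "(1 + d) * c * \<epsilon> \<le> (1 + d) * c * \<delta>" using \<epsilon> c d by (intro mult_left_mono) auto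
      also have "\<dots> = 1 / 2"
      proof -
        have "k * (1 / 2 * inverse k) = 1 / 2" if "k \<noteq> 0" for k :: real using that by simp
        then show ?thesis unfolding \<delta>_def by this (use c d in auto)
      qed
      finally show "(1 + d) * c * \<epsilon> \<le> 1 / 2" .
    qed auto
    finally show "norm (e \<cdot> u) \<le> (2 * d + 1) * norm u" by (simp add: w_def algebra_simps)
  qed (use d in simp)
  then show ?thesis using \<open>0 < \<delta>\<close> by blast
qed

lemma inverse_commutes:
  fixes a r x :: "'r::monoid_mult"
  assumes "r * a = 1" "a * r = 1" "x * a = a * x"
  shows "x * r = r * x"
proof -
  have "x * r = (r * a) * (x * r)" using assms by simp
  also have "\<dots> = r * (a * x) * r" by (simp only: mult.assoc)
  also have "\<dots> = r * (x * a) * r" using assms by simp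
  also have "\<dots> = r * x * (a * r)" by (simp only: mult.assoc)
  also have "\<dots> = r * x" using assms by simp
  finally show ?thesis .
qed

text \<open>
  The Abel means \<open>e i\<close> commute, act as the identity on the fixed space, and take values ever closer
  to it. So \<open>e j\<close> moves the values of \<open>e i\<close> by little, uniformly in \<open>j\<close>, and by symmetry the
  sequence is Cauchy.
\<close>

theorem fixed_space_projection:
  fixes V :: "'a::{complex_normed_vector, banach} bop"
  assumes V: "quasi_precompact V"
    and semisimple: "\<And>x. V \<cdot> x - x \<in> fixed_space V \<Longrightarrow> V \<cdot> x = x"
    and peripheral: "\<And>z x. 1 \<le> cmod z \<Longrightarrow> z \<noteq> 1 \<Longrightarrow> V \<cdot> x = z *\<^sub>C x \<Longrightarrow> x = 0"
  shows "\<exists>P. V * P = P \<and> P * V = P \<and> (\<forall>x\<in>fixed_space V. P \<cdot> x = x)"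
proof -
  obtain \<delta> M where \<delta>: "0 < \<delta>" and M: "\<And>\<epsilon> e. 0 < \<epsilon> \<Longrightarrow> \<epsilon> \<le> \<delta> \<Longrightarrow>
      (V - 1) * e = of_real \<epsilon> *\<^sub>C (e - 1) \<Longrightarrow> norm e \<le> M"
    using Abel_means_bounded[OF V semisimple] by blast
  obtain c where c: "0 < c" "\<And>x. \<exists>f\<in>fixed_space V. norm (x - f) \<le> c * norm (V \<cdot> x - x)"
    using distance_to_fixed_space_le[OF V] by blast
  define \<epsilon> where "\<epsilon> i = \<delta> * inverse (real (Suc i))" for i
  have \<epsilon>: "0 < \<epsilon> i" "\<epsilon> i \<le> \<delta>" for i using \<delta> by (auto simp: \<epsilon>_def field_simps)
  have \<epsilon>_lim: "\<epsilon> \<longlonglongrightarrow> 0"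
    unfolding \<epsilon>_def using tendsto_mult_right_zero[OF LIMSEQ_inverse_real_of_nat] by simp
  define a where "a i = of_real (1 + \<epsilon> i) *\<^sub>C 1 - V" for i
  have "invertible_in_ring (a i)" for i
    unfolding a_def
  proof (rule invertible_if_no_eigenvalue_on_ray[OF V])
    fix s :: real and x assume s: "1 \<le> s" "V \<cdot> x = (of_real s * of_real (1 + \<epsilon> i)) *\<^sub>C x"
    have "1 * 1 < s * (1 + \<epsilon> i)" using s \<epsilon>[of i] by (intro mult_le_less_imp_less) auto
    then have "1 \<le> cmod (of_real (s * (1 + \<epsilon> i)))" "complex_of_real (s * (1 + \<epsilon> i)) \<noteq> 1"
      by (simp_all only: norm_of_real of_real_eq_1_iff)
    moreover have "V \<cdot> x = complex_of_real (s * (1 + \<epsilon> i)) *\<^sub>C x" using s(2) by (simp only: of_real_mult)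
    ultimately show "x = 0" by (rule peripheral)
  next
    show "1 \<le> cmod (of_real (1 + \<epsilon> i))" using \<epsilon>[of i] by (simp only: norm_of_real)
  qed
  then obtain r where r: "\<And>i. r i * a i = 1" "\<And>i. a i * r i = 1"
    unfolding invertible_in_ring_def by metis
  define e where "e i = of_real (\<epsilon> i) *\<^sub>C r i" for i
  have V_eq: "V - 1 = of_real (\<epsilon> i) *\<^sub>C 1 - a i" for i
    by (simp add: a_def scaleC_add_left scaleC_one)
  have e_eq: "(V - 1) * e i = of_real (\<epsilon> i) *\<^sub>C (e i - 1)" for i
    unfolding V_eq[of i] left_diff_distrib
    by (simp add: e_def r mult_scaleC_left mult_scaleC_right cvs.scale_right_diff_distrib)
  have Va: "V * a i = a i * V" for i
    by (simp add: a_def algebra_simps mult_scaleC_left mult_scaleC_right)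
  have Vr: "V * r i = r i * V" for i by (rule inverse_commutes[OF r Va])
  have rr: "r j * r i = r i * r j" for i j
    by (rule inverse_commutes[OF r]) (simp add: a_def algebra_simps mult_scaleC_left mult_scaleC_right Vr)
  have Ve: "V * e i = e i * V" and ee: "e j * e i = e i * e j" for i j
    by (simp_all add: e_def mult_scaleC_left mult_scaleC_right Vr rr[of j i] scaleC_scaleC mult.commute)
  have fix_e: "e i \<cdot> f = f" if "f \<in> fixed_space V" for i f
  proof -
    have "a i \<cdot> f = of_real (\<epsilon> i) *\<^sub>C f"
      using that by (simp add: a_def fixed_space_def scaleC_add_left scaleC_one)
    then have "e i \<cdot> f = r i \<cdot> a i \<cdot> f" by (simp add: e_def)
    then show ?thesis using r(1)[of i] by (metis app_simps(5,6))
  qed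
  have norm_e: "norm (e i) \<le> M" for i using M \<epsilon> e_eq by blast
  have "0 \<le> M" using norm_e[of 0] norm_ge_zero order_trans by blast
  have norm_e1: "norm (e i - 1) \<le> M + 1" for i
    using norm_triangle_ineq4[of "e i" 1] norm_e[of i] norm_bop_one[where 'a = 'a] by linarith
  define K where "K = (M + 1) * (c * (M + 1))"
  \<comment> \<open>The values of \<open>e i\<close> lie within a multiple of \<open>\<epsilon> i\<close> of the fixed space, where \<open>e j - 1\<close> vanishes.\<close>
  have almost: "norm (e j * e i - e i) \<le> K * \<epsilon> i" for i j
  proof (rule norm_bop_bound)
    fix u
    define w where "w = e i \<cdot> u"
    obtain f where f: "f \<in> fixed_space V" "norm (w - f) \<le> c * norm (V \<cdot> w - w)" using c(2) by blast
    have "V \<cdot> w - w = of_real (\<epsilon> i) *\<^sub>C (e i - 1) \<cdot> u"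
      using arg_cong[OF e_eq[of i], of "\<lambda>f. f \<cdot> u"] by (simp add: w_def)
    then have "norm (V \<cdot> w - w) = \<epsilon> i * norm ((e i - 1) \<cdot> u)"
      using \<epsilon>(1)[of i] by (simp add: norm_scaleC del: app_simps)
    also have "\<dots> \<le> \<epsilon> i * ((M + 1) * norm u)"
      using \<epsilon>(1)[of i] norm_app[of "e i - 1" u] mult_right_mono[OF norm_e1[of i], of "norm u"]
      by (intro mult_left_mono) auto
    finally have wf: "norm (w - f) \<le> c * (\<epsilon> i * ((M + 1) * norm u))"
      using f(2) mult_left_mono[of _ _ c] c(1) by (meson order_trans less_imp_le)
    have "(e j * e i - e i) \<cdot> u = (e j - 1) \<cdot> (w - f)"
      using fix_e[OF f(1)] by (simp add: w_def)
    then have "norm ((e j * e i - e i) \<cdot> u) \<le> (M + 1) * norm (w - f)"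
      using norm_app[of "e j - 1" "w - f"] mult_right_mono[OF norm_e1[of j], of "norm (w - f)"] by simp
    also have "\<dots> \<le> (M + 1) * (c * (\<epsilon> i * ((M + 1) * norm u)))"
      using wf \<open>0 \<le> M\<close> by (intro mult_left_mono) auto
    finally show "norm ((e j * e i - e i) \<cdot> u) \<le> K * \<epsilon> i * norm u" by (simp add: K_def mult_ac)
  qed (use \<open>0 \<le> M\<close> c \<epsilon>(1)[of i] in \<open>simp add: K_def\<close>)
  have "0 < K" using \<open>0 \<le> M\<close> c by (simp add: K_def)
  \<comment> \<open>As the means commute, \<open>e i - e j\<close> is a difference of two errors of the kind just bounded.\<close>
  have "Cauchy e"
  proof (rule CauchyI)
    fix \<eta> :: real assume "0 < \<eta>"
    then have "eventually (\<lambda>i. \<epsilon> i < \<eta> / (2 * K)) sequentially"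
      using order_tendstoD(2)[OF \<epsilon>_lim, of "\<eta> / (2 * K)"] \<open>0 < K\<close> by simp
    then obtain k where k: "\<And>i. k \<le> i \<Longrightarrow> \<epsilon> i < \<eta> / (2 * K)"
      unfolding eventually_sequentially by blast
    have "norm (e i - e j) < \<eta>" if "k \<le> i" "k \<le> j" for i j
    proof -
      have "norm (e i - e j) \<le> norm (e i * e j - e j) + norm (e j * e i - e i)"
        using norm_triangle_ineq4[of "e i * e j - e j" "e j * e i - e i"] by (simp add: ee[of i j])
      also have "\<dots> \<le> K * \<epsilon> j + K * \<epsilon> i" by (intro add_mono almost)
      also have "\<dots> < \<eta>" using k[OF that(1)] k[OF that(2)] \<open>0 < K\<close> by (simp add: field_simps)
      finally show ?thesis .
    qed
    then show "\<exists>k. \<forall>i\<ge>k. \<forall>j\<ge>k. norm (e i - e j) < \<eta>" by blast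
  qed
  then obtain P where P: "e \<longlonglongrightarrow> P" using Cauchy_convergent convergent_def by blast
  have "(\<lambda>i. (V - 1) * e i) \<longlonglongrightarrow> (V - 1) * P" by (intro tendsto_intros P)
  moreover have "(\<lambda>i. (V - 1) * e i) \<longlonglongrightarrow> 0"
  proof -
    have "(\<lambda>i. of_real (\<epsilon> i) *\<^sub>C (e i - 1)) \<longlonglongrightarrow> of_real 0 *\<^sub>C (P - 1)"
      by (intro tendsto_intros P \<epsilon>_lim)
    then show ?thesis unfolding e_eq by simp
  qed
  ultimately have "(V - 1) * P = 0" by (rule LIMSEQ_unique)
  then have VP: "V * P = P" by (simp add: left_diff_distrib)
  have "(\<lambda>i. V * e i) \<longlonglongrightarrow> V * P" "(\<lambda>i. e i * V) \<longlonglongrightarrow> P * V" by (intro tendsto_intros P)+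
  then have "P * V = P" unfolding Ve using VP LIMSEQ_unique by metis
  moreover have "P \<cdot> f = f" if "f \<in> fixed_space V" for f
    using bounded_linear.tendsto[OF bounded_linear_app_left P, of f] fix_e[OF that]
    by (simp add: LIMSEQ_const_iff)
  ultimately show ?thesis using VP by blast
qed

text \<open>
  Subtracting \<open>P\<close> removes the eigenvalue \<open>1\<close> and nothing else: an eigenvector of \<open>V - P\<close> for a
  nonzero eigenvalue is annihilated by \<open>P\<close>, so it is an eigenvector of \<open>V\<close> that is not fixed.
\<close>

theorem powers_converge_to_projection:
  fixes V :: "'a::{complex_normed_vector, banach} bop"
  assumes V: "quasi_precompact V"
    and semisimple: "\<And>x. V \<cdot> x - x \<in> fixed_space V \<Longrightarrow> V \<cdot> x = x"
    and peripheral: "\<And>z x. 1 \<le> cmod z \<Longrightarrow> z \<noteq> 1 \<Longrightarrow> V \<cdot> x = z *\<^sub>C x \<Longrightarrow> x = 0"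
  shows "\<exists>P. \<exists>n\<ge>1. range (\<lambda>x. P \<cdot> x) = fixed_space V \<and> (\<lambda>k. V ^ (k * n)) \<longlonglongrightarrow> P"
proof -
  have "\<exists>P. V * P = P \<and> P * V = P \<and> (\<forall>x\<in>fixed_space V. P \<cdot> x = x)"
    by (rule fixed_space_projection[OF assms])
  then obtain P where P: "V * P = P" "P * V = P" "\<And>x. x \<in> fixed_space V \<Longrightarrow> P \<cdot> x = x" by blast
  have Pfix: "P \<cdot> x \<in> fixed_space V" for x
    using arg_cong[OF P(1), of "\<lambda>f. f \<cdot> x"] by (simp add: fixed_space_def)
  have PP: "P * P = P" by (rule bop_eqI) (simp add: P(3) Pfix)
  have power: "(V - P) ^ Suc k = V ^ Suc k - P" for k
  proof (induction k)
    case (Suc k)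
    have "(V - P) ^ Suc (Suc k) = (V - P) * (V ^ Suc k - P)" by (simp only: Suc power_Suc[of "V - P" "Suc k"])
    also have "P * V ^ Suc k = P" by (induction k) (simp_all add: P(2) flip: mult.assoc)
    then have "(V - P) * (V ^ Suc k - P) = V ^ Suc (Suc k) - P"
      by (simp only: left_diff_distrib right_diff_distrib P PP power_Suc[of V "Suc k"]) simp
    finally show ?case .
  qed simp
  have VkP: "V ^ k * P = P" for k by (induction k) (simp_all add: P(1) mult.assoc)
  have qp: "quasi_precompact (V - P)"
  proof -
    obtain n where n: "1 \<le> n" "has_net (V ^ n) (inverse (2 * (1 + norm P)))"
      using quasi_precompact_net[OF V, of "inverse (2 * (1 + norm P))"]
      by (auto simp: add_pos_nonneg)
    have "has_net (V ^ n * (1 - P)) (inverse (2 * (1 + norm P)) * norm (1 - P))"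
      by (rule has_net_mult[OF n(2) has_net_norm]) simp
    \<comment> \<open>So the net for \<open>V ^ n\<close> passes to \<open>(V - P) ^ n\<close> at the cost of the factor \<open>norm (1 - P)\<close>.\<close>
    moreover have "V ^ n * (1 - P) = (V - P) ^ n"
      using power[of "n - 1"] n(1) by (simp add: right_diff_distrib VkP)
    moreover have "inverse (2 * (1 + norm P)) * norm (1 - P) \<le> inverse (2 * (1 + norm P)) * (1 + norm P)"
      using norm_triangle_ineq4[of 1 P] norm_bop_one[where 'a = 'a]
      by (intro mult_left_mono) (auto simp: add_nonneg_nonneg)
    moreover have "inverse (2 * (1 + norm P)) * (1 + norm P) = 1 / 2"
      using norm_ge_zero[of P] by (simp add: field_simps add_nonneg_eq_0_iff)
    ultimately have "has_net ((V - P) ^ n) (1 / 2)" by (metis has_net_mono)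
    then show ?thesis unfolding quasi_precompact_def using n(1) by (intro exI[of _ n] conjI exI[of _ "1/2"]) auto
  qed
  have no_eigenvalue: "x = 0" if z: "1 \<le> cmod z" and x: "(V - P) \<cdot> x = z *\<^sub>C x" for z x
  proof -
    have "z *\<^sub>C P \<cdot> x = (P * (V - P)) \<cdot> x" using x by simp
    also have "\<dots> = 0" by (simp only: right_diff_distrib P PP) simp
    finally have "P \<cdot> x = 0" using z by auto
    then have Vx: "V \<cdot> x = z *\<^sub>C x" using x by simp
    show "x = 0"
    proof (cases "z = 1")
      case True
      then have "P \<cdot> x = x" using Vx by (intro P) (simp add: fixed_space_def scaleC_one)
      then show ?thesis using \<open>P \<cdot> x = 0\<close> by simp
    qed (use peripheral z Vx in blast)
  qed
  have "\<exists>n\<ge>1. norm ((V - P) ^ n) < 1"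
    by (rule power_contracts_if_no_large_eigenvalue[OF qp no_eigenvalue])
  then obtain n where n: "1 \<le> n" "norm ((V - P) ^ n) < 1" by blast
  have "(\<lambda>k. V ^ (k * n) - P) \<longlonglongrightarrow> 0"
  proof (rule Lim_null_comparison)
    show "(\<lambda>k. norm ((V - P) ^ n) ^ k) \<longlonglongrightarrow> 0" using n by (intro LIMSEQ_power_zero) simp
    show "eventually (\<lambda>k. norm (V ^ (k * n) - P) \<le> norm ((V - P) ^ n) ^ k) sequentially"
      using eventually_gt_at_top[of 0]
    proof eventually_elim
      case (elim k)
      have "V ^ (k * n) - P = ((V - P) ^ n) ^ k"
        using power[of "k * n - 1"] elim n(1) by (simp add: mult.commute flip: power_mult)
      then show ?case using norm_bop.power_le by metis
    qed
  qed
  then have "(\<lambda>k. V ^ (k * n)) \<longlonglongrightarrow> P" by (simp add: LIM_zero_iff)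
  moreover have "range (\<lambda>x. P \<cdot> x) = fixed_space V"
    using Pfix P(3)[symmetric] by (auto intro: range_eqI)
  ultimately show ?thesis using n(1) by blast
qed

text \<open>
  If \<open>x\<^sup>2 = 0\<close>, the principal ideal generated by \<open>x\<close> has zero products.
\<close>

section \<open>Multiplicative operators on reduced algebras\<close>

lemma semiprime_square_zero:
  fixes x :: "'a::unital_comm_complex_banach_algebra"
  assumes "semiprime TYPE('a)" "x * x = 0"
  shows "x = 0"
proof -
  define J where "J = range (\<lambda>a. a * x)"
  have "algebra_ideal J"
    unfolding algebra_ideal_def J_def cvs.subspace_def
  proof (intro conjI ballI allI)
    show "0 \<in> range (\<lambda>a. a * x)" by (rule range_eqI[of _ _ 0]) simp
    fix u v assume u: "u \<in> range (\<lambda>a. a * x)" and v: "v \<in> range (\<lambda>a. a * x)"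
    obtain a where "u = a * x" using u by blast
    moreover obtain b where "v = b * x" using v by blast
    ultimately show "u + v \<in> range (\<lambda>a. a * x)" by (intro range_eqI[of _ _ "a + b"]) (simp add: algebra_simps)
  next
    fix u c assume "u \<in> range (\<lambda>a. a * x)"
    then obtain a where "u = a * x" by blast
    then show "c *\<^sub>C u \<in> range (\<lambda>a. a * x)"
      by (intro range_eqI[of _ _ "c *\<^sub>C a"]) (simp add: mult_scaleC_left)
  next
    fix u b assume "u \<in> range (\<lambda>a. a * x)"
    then obtain a where "u = a * x" by blast
    then show "b * u \<in> range (\<lambda>a. a * x)" "u * b \<in> range (\<lambda>a. a * x)"
      by (auto intro!: range_eqI[of _ _ "a * b"] simp: mult_ac)
  qed
  moreover have "u * v = 0" if u: "u \<in> J" and v: "v \<in> J" for u v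
  proof -
    obtain a where "u = a * x" using u by (auto simp: J_def)
    moreover obtain b where "v = b * x" using v by (auto simp: J_def)
    ultimately have "u * v = (a * b) * (x * x)" by (simp add: mult_ac)
    then show ?thesis using assms(2) by simp
  qed
  ultimately have "J = {0}" using assms(1) unfolding semiprime_def by blast
  moreover have "x \<in> J" unfolding J_def by (rule range_eqI[of _ _ 1]) simp
  ultimately show ?thesis by simp
qed

lemma power_nonzero_if_reduced:
  fixes x :: "'a::unital_comm_complex_banach_algebra"
  assumes reduced: "\<And>x::'a. x * x = 0 \<Longrightarrow> x = 0" and "x \<noteq> 0"
  shows "x ^ n \<noteq> 0"
proof (induction n)
  case 0
  then show ?case using \<open>x \<noteq> 0\<close> mult_1_left[of x] by (metis mult_zero_left power_0)
next
  case (Suc n)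
  show ?case
  proof (cases n)
    case (Suc m)
    show ?thesis
    proof
      assume "x ^ Suc n = 0"
      then have "x ^ Suc n * x ^ m = 0" by simp
      moreover have "x ^ n * x ^ n = x ^ Suc n * x ^ m" by (simp add: Suc mult_ac)
      ultimately have "x ^ n * x ^ n = 0" by simp
      then show False using reduced Suc.IH by blast
    qed
  qed (use \<open>x \<noteq> 0\<close> in simp)
qed

text \<open>
  The product of the operators \<open>X - \<mu> j\<close> over \<open>j < i\<close> kills the other eigenvectors, but not \<open>y i\<close>.
\<close>

lemma eigenvector_not_in_span_of_others:
  fixes X :: "'a::complex_normed_vector bop" and i :: nat
  assumes eig: "\<And>j. j \<le> i \<Longrightarrow> X \<cdot> y j = \<mu> j *\<^sub>C y j"
    and distinct: "\<And>j. j < i \<Longrightarrow> \<mu> i \<noteq> \<mu> j" and "y i \<noteq> 0"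
  shows "y i \<notin> cvs.span (y ` {..<i})"
proof
  define Q :: "nat \<Rightarrow> 'a bop" where "Q = rec_nat 1 (\<lambda>j q. (X - \<mu> j *\<^sub>C 1) * q)"
  have Q: "Q 0 = 1" "\<And>k. Q (Suc k) = (X - \<mu> k *\<^sub>C 1) * Q k" by (simp_all add: Q_def)
  have Q_eig: "Q k \<cdot> x = (\<Prod>j<k. z - \<mu> j) *\<^sub>C x" if "X \<cdot> x = z *\<^sub>C x" for k x z
    by (induction k) (simp_all add: Q scaleC_one that scaleC_scaleC algebra_simps flip: cvs.scale_left_diff_distrib)
  have "Q i \<cdot> y j = 0" if "j < i" for j
    using Q_eig[OF eig[of j]] that by (auto simp: prod_zero)
  then have "y ` {..<i} \<subseteq> {x. Q i \<cdot> x = 0}" by auto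
  moreover have "cvs.subspace {x. Q i \<cdot> x = 0}" by (simp add: cvs.subspace_def)
  ultimately have "cvs.span (y ` {..<i}) \<subseteq> {x. Q i \<cdot> x = 0}" by (rule cvs.span_minimal)
  moreover assume "y i \<in> cvs.span (y ` {..<i})"
  ultimately have "Q i \<cdot> y i = 0" by blast
  then have "(\<Prod>j<i. \<mu> i - \<mu> j) *\<^sub>C y i = 0" using Q_eig[OF eig[of i]] by simp
  then show False using distinct \<open>y i \<noteq> 0\<close> by (auto simp: cvs.scale_eq_0_iff)
qed

lemma eigenvector_power:
  fixes T :: "'a::unital_comm_complex_banach_algebra bop"
  assumes mult: "\<And>x y. T \<cdot> (x * y) = T \<cdot> x * T \<cdot> y" and one: "T \<cdot> 1 = 1"
    and x: "T \<cdot> x = z *\<^sub>C x"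
  shows "T \<cdot> (x ^ k) = z ^ k *\<^sub>C x ^ k"
  by (induction k) (simp_all add: one scaleC_one mult x mult_scaleC_left mult_scaleC_right scaleC_scaleC)

text \<open>
  If none of \<open>z, \<dots>, z\<^sup>N\<close> is \<open>1\<close>, the powers \<open>1, x, \<dots>, x\<^sup>N\<close> are eigenvectors for distinct
  eigenvalues and form a chain of length \<open>N + 1\<close>. The exponent \<open>N!\<close> serves all eigenvalues at once.
\<close>

lemma eigenvalues_roots_of_unity:
  fixes T :: "'a::unital_comm_complex_banach_algebra bop"
  assumes reduced: "\<And>x::'a. x * x = 0 \<Longrightarrow> x = 0"
    and T: "quasi_precompact T"
    and mult: "\<And>x y. T \<cdot> (x * y) = T \<cdot> x * T \<cdot> y" and one: "T \<cdot> 1 = 1"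
  shows "\<exists>n\<ge>1. \<forall>z x. 1 \<le> cmod z \<longrightarrow> T \<cdot> x = z *\<^sub>C x \<longrightarrow> x \<noteq> 0 \<longrightarrow> z ^ n = 1"
proof -
  obtain N where N: "\<And>n y \<mu>. triangular_chain T n y \<mu> \<Longrightarrow> n \<le> N"
    using triangular_chain_length_bounded[OF T] by blast
  have "z ^ fact N = 1" if z: "1 \<le> cmod z" and x: "T \<cdot> x = z *\<^sub>C x" "x \<noteq> 0" for z x
  proof -
    have "\<exists>m. 0 < m \<and> m \<le> N \<and> z ^ m = 1"
    proof (rule ccontr)
      assume no: "\<not> ?thesis"
      have "z \<noteq> 0" using z by auto
      have "z ^ i \<noteq> z ^ j" if "j < i" "i \<le> N" for i j
      proof
        assume "z ^ i = z ^ j"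
        then have "z ^ j * z ^ (i - j) = z ^ j * 1" using that by (simp flip: power_add)
        then have "z ^ (i - j) = 1" using \<open>z \<noteq> 0\<close> by simp
        then show False using no that by (meson diff_le_self order_trans zero_less_diff)
      qed
      then have "x ^ i \<notin> cvs.span ((\<lambda>k. x ^ k) ` {..<i})" if "i < Suc N" for i
        using that eigenvector_power[OF mult one x(1)] power_nonzero_if_reduced[OF reduced x(2)]
        by (intro eigenvector_not_in_span_of_others[where X = T and \<mu> = "\<lambda>k. z ^ k"]) auto
      then have "triangular_chain T (Suc N) (\<lambda>k. x ^ k) (\<lambda>k. z ^ k)"
        unfolding triangular_chain_def
        using eigenvector_power[OF mult one x(1)] z by (simp add: norm_power cvs.span_zero)
      then show False using N by fastforce
    qed
    then obtain m where "0 < m" "m \<le> N" "z ^ m = 1" by blast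
    then have "m dvd fact N" by (intro dvd_fact) auto
    then show ?thesis using \<open>z ^ m = 1\<close> by (auto simp: dvd_def power_mult)
  qed
  then show ?thesis using fact_ge_1[where 'a = nat] by blast
qed

text \<open>
  For each \<open>n\<close>-th root \<open>z\<close> of \<open>\<mu>\<close>, applying \<open>(z\<^sup>n - X\<^sup>n) / (z - X)\<close> to \<open>x\<close> gives \<open>0\<close> or an eigenvector
  of \<open>X\<close>; it cannot be \<open>0\<close> for all of them, since a weighted sum of the results is \<open>n \<mu> x\<close>.
\<close>

lemma eigenvalue_of_power:
  fixes X :: "'a::complex_normed_vector bop"
  assumes "1 \<le> n" "X ^ n \<cdot> x = \<mu> *\<^sub>C x" "x \<noteq> 0" "\<mu> \<noteq> 0"
  shows "\<exists>z y. y \<noteq> 0 \<and> X \<cdot> y = z *\<^sub>C y \<and> z ^ n = \<mu>"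
proof -
  obtain a where a: "a ^ n = \<mu>" using exists_complex_root[of n \<mu>] assms(1) by auto
  define z where "z j = a * cis (2 * pi * real j / real n)" for j
  define y where "y j = geometric_quotient (z j) X n \<cdot> x" for j
  have zn: "z j ^ n = \<mu>" for j
    using root_of_unity_power[of n j] assms(1) by (simp only: z_def power_mult_distrib a) simp
  have y: "X \<cdot> y j = z j *\<^sub>C y j" for j
  proof -
    have "((z j *\<^sub>C 1 - X) * geometric_quotient (z j) X n) \<cdot> x = 0"
      unfolding geometric_quotient_left zn using assms(2) by simp
    then show ?thesis by (simp add: y_def)
  qed
  have app_sum: "(\<Sum>j\<in>A. f j) \<cdot> x = (\<Sum>j\<in>A. f j \<cdot> x)" for f :: "nat \<Rightarrow> 'a bop" and A
    by (induction A rule: infinite_finite_induct) auto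
  have "(\<Sum>j<n. z j *\<^sub>C y j) = (\<Sum>j<n. z j *\<^sub>C geometric_quotient (z j) X n) \<cdot> x"
    by (simp add: app_sum y_def)
  also have "\<dots> = of_nat n *\<^sub>C \<mu> *\<^sub>C x"
    unfolding z_def using sum_geometric_quotient_over_roots[of n a X] assms(1) by (simp add: a)
  finally have "(\<Sum>j<n. z j *\<^sub>C y j) \<noteq> 0" using assms by (simp add: cvs.scale_eq_0_iff)
  then obtain j where "z j *\<^sub>C y j \<noteq> 0" by (meson sum.neutral)
  then show ?thesis using y zn by (metis cvs.scale_zero_right)
qed

lemma span_image_mono_map:
  assumes "w \<in> cvs.span (f ` A)"
    and "\<And>x y. g (x + y) = g x + g y" "\<And>c x. g (c *\<^sub>C x) = c *\<^sub>C g x"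
    and "\<And>a. a \<in> A \<Longrightarrow> g (f a) \<in> cvs.span B"
  shows "g w \<in> cvs.span B"
  using assms(1)
proof (induction rule: cvs.span_induct_alt)
  case base
  have "g 0 = 0" using assms(3)[of 0 0] by simp
  then show ?case by (simp add: cvs.span_zero)
qed (auto simp: assms intro!: cvs.span_add cvs.span_scale)

lemma span_initial_mono: "w \<in> cvs.span (c ` {..<k}) \<Longrightarrow> k \<le> l \<Longrightarrow> w \<in> cvs.span (c ` {..<l::nat})"
  using cvs.span_mono[of "c ` {..<k}" "c ` {..<l}"] by (auto simp: image_mono)

text \<open>
  The first two terms of the binomial expansion. The bound \<open>j < k\<close> on the remaining monomials is what
  makes \<open>V - 1\<close> lower the position in the flag below by exactly one step.
\<close>

lemma power_add_leading_terms:
  fixes x y :: "'a::unital_comm_complex_banach_algebra"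
  shows "(x + y) ^ Suc k - x ^ Suc k - of_nat (Suc k) *\<^sub>C (x ^ k * y)
    \<in> cvs.span ((\<lambda>j. x ^ j * y ^ (Suc k - j)) ` {..<k})"
proof (induction k)
  case 0
  then show ?case by (simp add: scaleC_one cvs.span_zero)
next
  case (Suc k)
  define w where "w = (x + y) ^ Suc k - x ^ Suc k - of_nat (Suc k) *\<^sub>C (x ^ k * y)"
  let ?S = "cvs.span ((\<lambda>j. x ^ j * y ^ (Suc (Suc k) - j)) ` {..<Suc k})"
  have mem: "x ^ j * y ^ (Suc (Suc k) - j) \<in> ?S" if "j < Suc k" for j
    using that by (intro cvs.span_base) auto
  have "x * w \<in> ?S"
    by (rule span_image_mono_map[OF Suc.IH[folded w_def], of "\<lambda>v. x * v"])
      (use mem[of "Suc _"] in \<open>auto simp: algebra_simps mult_scaleC_right\<close>)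
  moreover have "y * w \<in> ?S"
  proof (rule span_image_mono_map[OF Suc.IH[folded w_def], of "\<lambda>v. y * v"])
    fix j assume "j \<in> {..<k}"
    then show "y * (x ^ j * y ^ (Suc k - j)) \<in> ?S"
      using mem[of j] by (simp add: Suc_diff_le mult_ac)
  qed (simp_all add: algebra_simps mult_scaleC_right)
  moreover have "of_nat (Suc k) *\<^sub>C (x ^ k * y ^ 2) \<in> ?S"
    using mem[of k] by (intro cvs.span_scale) (simp add: power2_eq_square)
  ultimately have "x * w + y * w + of_nat (Suc k) *\<^sub>C (x ^ k * y ^ 2) \<in> ?S"
    by (intro cvs.span_add)
  moreover have "(x + y) ^ Suc (Suc k) - x ^ Suc (Suc k) - of_nat (Suc (Suc k)) *\<^sub>C (x ^ Suc k * y)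
     = x * w + y * w + of_nat (Suc k) *\<^sub>C (x ^ k * y ^ 2)"
  proof -
    have "(x + y) ^ Suc k = w + x ^ Suc k + of_nat (Suc k) *\<^sub>C (x ^ k * y)" by (simp add: w_def)
    then have "(x + y) ^ Suc (Suc k) = (x + y) * (w + x ^ Suc k + of_nat (Suc k) *\<^sub>C (x ^ k * y))"
      by (simp only: power_Suc)
    moreover have "of_nat (Suc (Suc k)) *\<^sub>C v = v + of_nat (Suc k) *\<^sub>C v" for v :: 'a
      unfolding of_nat_Suc[of "Suc k"] scaleC_add_left scaleC_one by (rule refl)
    ultimately show ?thesis
      by (simp add: algebra_simps power2_eq_square mult_scaleC_right scaleC_add_right del: of_nat_Suc)
  qed
  ultimately show ?case by simp
qed

text \<open>
  Let \<open>y = V x - x\<close> be fixed and nonzero. On the monomials \<open>c k = x\<^sup>k y\<^sup>N\<^sup>-\<^sup>k\<close> the operator \<open>V - 1\<close> acts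
  like a derivation up to lower terms: it maps \<open>c (k + 1)\<close> to \<open>(k + 1) c k\<close>. So they are linearly
  independent as soon as \<open>c 0 = y\<^sup>N\<close> is nonzero, and they form a chain of length \<open>N + 1\<close>.
\<close>

lemma fixed_space_semisimple:
  fixes V :: "'a::unital_comm_complex_banach_algebra bop"
  assumes reduced: "\<And>x::'a. x * x = 0 \<Longrightarrow> x = 0"
    and V: "quasi_precompact V"
    and mult: "\<And>x y. V \<cdot> (x * y) = V \<cdot> x * V \<cdot> y" and one: "V \<cdot> 1 = 1"
    and x: "V \<cdot> x - x \<in> fixed_space V"
  shows "V \<cdot> x = x"
proof (rule ccontr)
  assume "V \<cdot> x \<noteq> x"
  define y where "y = V \<cdot> x - x"
  have y: "V \<cdot> y = y" "V \<cdot> x = x + y" "y \<noteq> 0"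
    using x \<open>V \<cdot> x \<noteq> x\<close> by (auto simp: y_def fixed_space_def)
  obtain N where N: "\<And>n u \<mu>. triangular_chain V n u \<mu> \<Longrightarrow> n \<le> N"
    using triangular_chain_length_bounded[OF V] by blast
  have V_power: "V \<cdot> (a ^ k) = (V \<cdot> a) ^ k" for a k
    by (induction k) (simp_all add: one mult)
  define c where "c k = x ^ k * y ^ (N - k)" for k
  have Vc: "V \<cdot> c (Suc k) - c (Suc k) - of_nat (Suc k) *\<^sub>C c k \<in> cvs.span (c ` {..<k})"
    if "Suc k \<le> N" for k
  proof -
    let ?w = "(x + y) ^ Suc k - x ^ Suc k - of_nat (Suc k) *\<^sub>C (x ^ k * y)"
    have "?w * y ^ (N - Suc k) \<in> cvs.span (c ` {..<k})"
    proof (rule span_image_mono_map[OF power_add_leading_terms, of "\<lambda>v. v * y ^ (N - Suc k)"])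
      fix j assume "j \<in> {..<k}"
      then have "x ^ j * y ^ (Suc k - j) * y ^ (N - Suc k) = c j"
        using that by (simp add: c_def mult.assoc flip: power_add)
      then show "x ^ j * y ^ (Suc k - j) * y ^ (N - Suc k) \<in> cvs.span (c ` {..<k})"
        using \<open>j \<in> {..<k}\<close> by (simp add: cvs.span_base)
    qed (simp_all add: algebra_simps mult_scaleC_left)
    moreover have "y * y ^ (N - Suc k) = y ^ (N - k)"
      using that by (simp add: Suc_diff_Suc flip: power_Suc)
    then have "x ^ k * y * y ^ (N - Suc k) = c k" by (simp add: c_def mult.assoc)
    moreover have "V \<cdot> c (Suc k) = (x + y) ^ Suc k * y ^ (N - Suc k)"
      by (simp only: c_def mult V_power y)
    ultimately show ?thesis
      by (simp only: left_diff_distrib mult_scaleC_left c_def[of "Suc k"])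
  qed
  have Vc': "V \<cdot> c k - c k \<in> cvs.span (c ` {..<k})" if "k \<le> N" for k
  proof (cases k)
    case 0
    then show ?thesis by (simp add: c_def V_power y cvs.span_zero)
  next
    case (Suc m)
    have "V \<cdot> c k - c k - of_nat (Suc m) *\<^sub>C c m \<in> cvs.span (c ` {..<k})"
      using span_initial_mono[OF Vc[of m], of k] that Suc by simp
    moreover have "of_nat (Suc m) *\<^sub>C c m \<in> cvs.span (c ` {..<k})"
      by (intro cvs.span_scale cvs.span_base) (simp add: Suc)
    ultimately have "V \<cdot> c k - c k - of_nat (Suc m) *\<^sub>C c m + of_nat (Suc m) *\<^sub>C c m \<in> cvs.span (c ` {..<k})"
      by (rule cvs.span_add)
    then show ?thesis by simp
  qed
  have indep: "c k \<notin> cvs.span (c ` {..<k})" if "k \<le> N" for k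
    using that
  proof (induction k)
    case 0
    show ?case using power_nonzero_if_reduced[OF reduced y(3)] by (simp add: c_def)
  next
    case (Suc k)
    show ?case
    proof
      assume "c (Suc k) \<in> cvs.span (c ` {..<Suc k})"
      then have "V \<cdot> c (Suc k) - c (Suc k) \<in> cvs.span (c ` {..<k})"
      proof (rule span_image_mono_map[where g = "\<lambda>v. V \<cdot> v - v"])
        fix j assume "j \<in> {..<Suc k}"
        then show "V \<cdot> c j - c j \<in> cvs.span (c ` {..<k})"
          using span_initial_mono[OF Vc'[of j], of k] Suc.prems by simp
      qed (simp_all add: cvs.scale_right_diff_distrib)
      from cvs.span_diff[OF this Vc[OF Suc.prems]]
      have "of_nat (Suc k) *\<^sub>C c k \<in> cvs.span (c ` {..<k})" by (simp del: of_nat_Suc)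
      from cvs.span_scale[OF this]
      have "inverse (of_nat (Suc k)) *\<^sub>C of_nat (Suc k) *\<^sub>C c k \<in> cvs.span (c ` {..<k})" .
      moreover have "inverse (of_nat (Suc k)) *\<^sub>C of_nat (Suc k) *\<^sub>C c k = c k"
        unfolding scaleC_scaleC by (subst left_inverse) (simp_all add: scaleC_one del: of_nat_Suc)
      ultimately show False using Suc by simp
    qed
  qed
  have "triangular_chain V (Suc N) c (\<lambda>_. 1)"
    unfolding triangular_chain_def using indep Vc' by (simp add: scaleC_one)
  then show False using N by fastforce
qed

text \<open>
  Roots of unity as eigenvalues and the absence of Jordan blocks are the two hypotheses of
  \<open>powers_converge_to_projection\<close> for \<open>V = T\<^sup>m\<close>. The limit is multiplicative because it is a
  pointwise limit of multiplicative maps.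
\<close>

theorem quasi_precompact_endomorphism_powers_converge:
  fixes T :: "'a::unital_comm_complex_banach_algebra bop"
  assumes reduced: "\<And>x::'a. x * x = 0 \<Longrightarrow> x = 0"
    and T: "quasi_precompact T"
    and mult: "\<And>x y. T \<cdot> (x * y) = T \<cdot> x * T \<cdot> y" and one: "T \<cdot> 1 = 1"
  shows "\<exists>P. \<exists>n\<ge>1. finite_rank (\<lambda>x. P \<cdot> x) \<and> unital_endomorphism (\<lambda>x. P \<cdot> x) \<and>
    (\<lambda>k. T ^ (k * n)) \<longlonglongrightarrow> P"
proof -
  obtain m where m: "1 \<le> m" "\<And>z x. 1 \<le> cmod z \<Longrightarrow> T \<cdot> x = z *\<^sub>C x \<Longrightarrow> x \<noteq> 0 \<Longrightarrow> z ^ m = 1"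
    using eigenvalues_roots_of_unity[OF assms] by blast
  have mult_power: "T ^ k \<cdot> (x * y) = (T ^ k \<cdot> x) * (T ^ k \<cdot> y)" "T ^ k \<cdot> 1 = 1" for k x y
    by (induction k) (simp_all add: mult one)
  define V where "V = T ^ m"
  have V: "quasi_precompact V" unfolding V_def by (rule quasi_precompact_power[OF T m(1)])
  have semisimple: "V \<cdot> x = x" if "V \<cdot> x - x \<in> fixed_space V" for x
    using fixed_space_semisimple[OF reduced V _ _ that] by (simp add: V_def mult_power)
  have peripheral: "x = 0" if z: "1 \<le> cmod z" "z \<noteq> 1" and x: "V \<cdot> x = z *\<^sub>C x" for z x
  proof (rule ccontr)
    assume "x \<noteq> 0"
    moreover have "z \<noteq> 0" using z(1) by auto
    ultimately obtain w y where w: "y \<noteq> 0" "T \<cdot> y = w *\<^sub>C y" "w ^ m = z"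
      using eigenvalue_of_power[OF m(1), of T x z] x by (auto simp: V_def)
    have "1 \<le> cmod w"
    proof (rule ccontr)
      assume "\<not> 1 \<le> cmod w"
      then have "cmod w ^ m < 1" using m(1) by (simp add: power_less_one_iff)
      then show False using w(3) z(1) by (auto simp: norm_power)
    qed
    then show False using m(2) w z(2) by blast
  qed
  have "\<exists>P. \<exists>n\<ge>1. range (\<lambda>x. P \<cdot> x) = fixed_space V \<and> (\<lambda>k. V ^ (k * n)) \<longlonglongrightarrow> P"
    by (rule powers_converge_to_projection[OF V semisimple peripheral])
  then obtain P n where n: "1 \<le> n" and range_P: "range (\<lambda>x. P \<cdot> x) = fixed_space V"
    and "(\<lambda>k. V ^ (k * n)) \<longlonglongrightarrow> P" by blast
  then have lim: "(\<lambda>k. T ^ (k * (m * n))) \<longlonglongrightarrow> P"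
    by (simp add: V_def mult_ac flip: power_mult)
  have lim_app: "(\<lambda>k. T ^ (k * (m * n)) \<cdot> x) \<longlonglongrightarrow> P \<cdot> x" for x
    by (rule bounded_linear.tendsto[OF bounded_linear_app_left lim])
  have "finite_rank (\<lambda>x. P \<cdot> x)"
    unfolding finite_rank_def range_P by (rule fixed_space_finite_dimensional[OF V])
  moreover have "unital_endomorphism (\<lambda>x. P \<cdot> x)"
    unfolding unital_endomorphism_def endomorphism_def
  proof (intro conjI allI)
    show "Vector_Spaces.linear scaleC scaleC (\<lambda>x. P \<cdot> x)"
      using bounded_operator_app[of P] by (simp add: bounded_operator_def)
    show "P \<cdot> (x * y) = P \<cdot> x * P \<cdot> y" for x y
      using lim_app[of "x * y"] tendsto_mult[OF lim_app[of x] lim_app[of y]]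
      unfolding mult_power by (rule LIMSEQ_unique)
    show "P \<cdot> 1 = 1" using lim_app[of 1] by (simp add: mult_power LIMSEQ_const_iff)
  qed
  moreover have "1 \<le> m * n" using m(1) n by simp
  ultimately show ?thesis using lim by blast
qed

section \<open>Compact operators and the essential norm\<close>

definition compact_bop :: "'a::complex_normed_vector bop \<Rightarrow> bool" where
  "compact_bop f \<longleftrightarrow> compact_operator (app f)"

lemma compact_bop_iff:
  "compact_bop f \<longleftrightarrow> (\<exists>K. compact K \<and> (\<forall>x. norm x \<le> 1 \<longrightarrow> f \<cdot> x \<in> K))"
proof
  assume "compact_bop f"
  then have "compact (closure (app f ` cball 0 1))" by (simp add: compact_bop_def compact_operator_def)
  moreover have "\<forall>x. norm x \<le> 1 \<longrightarrow> f \<cdot> x \<in> closure (app f ` cball 0 1)"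
    using closure_subset[of "app f ` cball 0 1"] by auto
  ultimately show "\<exists>K. compact K \<and> (\<forall>x. norm x \<le> 1 \<longrightarrow> f \<cdot> x \<in> K)" by blast
next
  assume "\<exists>K. compact K \<and> (\<forall>x. norm x \<le> 1 \<longrightarrow> f \<cdot> x \<in> K)"
  then obtain K where K: "compact K" "\<And>x. norm x \<le> 1 \<Longrightarrow> f \<cdot> x \<in> K" by blast
  then have "closure (app f ` cball 0 1) \<subseteq> K"
    by (intro closure_minimal compact_imp_closed) auto
  then have "compact (closure (app f ` cball 0 1))"
    using closed_Int_compact[OF closed_closure K(1)] by (metis Int_absorb2)
  then show "compact_bop f"
    using bounded_operator_app[of f] by (simp add: compact_bop_def compact_operator_def)
qed

lemma compact_bop_0: "compact_bop 0"
  unfolding compact_bop_iff by (intro exI[of _ "{0}"]) auto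

lemma compact_bop_add:
  assumes "compact_bop f" "compact_bop g"
  shows "compact_bop (f + g)"
proof -
  obtain K L where "compact K" "\<forall>x. norm x \<le> 1 \<longrightarrow> f \<cdot> x \<in> K"
    and "compact L" "\<forall>x. norm x \<le> 1 \<longrightarrow> g \<cdot> x \<in> L"
    using assms unfolding compact_bop_iff by blast
  then show ?thesis
    unfolding compact_bop_iff
    by (intro exI[of _ "{x + y |x y. x \<in> K \<and> y \<in> L}"]) (auto intro: compact_sums)
qed

lemma compact_bop_mult_left:
  assumes "compact_bop f"
  shows "compact_bop (g * f)"
proof -
  obtain K where "compact K" "\<forall>x. norm x \<le> 1 \<longrightarrow> f \<cdot> x \<in> K"
    using assms unfolding compact_bop_iff by blast
  then show ?thesis
    unfolding compact_bop_iff
    by (intro exI[of _ "app g ` K"])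
      (auto intro!: compact_continuous_image linear_continuous_on bounded_linear_app)
qed

lemma compact_bop_scaleC: "compact_bop f \<Longrightarrow> compact_bop (z *\<^sub>C f)"
  using compact_bop_mult_left[of f "z *\<^sub>C 1"] by (simp add: mult_scaleC_left)

lemma compact_bop_minus: "compact_bop f \<Longrightarrow> compact_bop (- f)"
  using compact_bop_scaleC[of f "- 1"] by (simp add: scaleC_minus_one)

lemma compact_bop_diff: "compact_bop f \<Longrightarrow> compact_bop g \<Longrightarrow> compact_bop (f - g)"
  using compact_bop_add[of f "- g"] compact_bop_minus[of g] by simp

lemma compact_bop_mult_right:
  assumes "compact_bop f"
  shows "compact_bop (f * g)"
proof -
  obtain K where K: "compact K" "\<And>x. norm x \<le> 1 \<Longrightarrow> f \<cdot> x \<in> K"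
    using assms unfolding compact_bop_iff by blast
  define c where "c = norm g + 1"
  have "0 < c" by (simp add: c_def add_nonneg_pos)
  have "compact ((\<lambda>x. of_real c *\<^sub>C x) ` K)"
    by (intro compact_continuous_image K(1) linear_continuous_on bounded_linear_scaleC)
  moreover have "(f * g) \<cdot> x \<in> (\<lambda>x. of_real c *\<^sub>C x) ` K" if x: "norm x \<le> 1" for x
  proof (rule image_eqI)
    have "norm (g \<cdot> x) \<le> norm g * 1"
      using norm_app[of g x] mult_left_mono[OF x, of "norm g"] by simp
    then have "norm (of_real (inverse c) *\<^sub>C g \<cdot> x) \<le> 1"
      using \<open>0 < c\<close> by (simp add: norm_scaleC norm_inverse norm_divide divide_simps c_def)
    then show "f \<cdot> (of_real (inverse c) *\<^sub>C g \<cdot> x) \<in> K" by (rule K(2))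
    show "(f * g) \<cdot> x = of_real c *\<^sub>C f \<cdot> (of_real (inverse c) *\<^sub>C g \<cdot> x)"
      using \<open>0 < c\<close> by (simp add: scaleC_scaleC scaleC_one flip: of_real_mult)
  qed
  ultimately show ?thesis unfolding compact_bop_iff by blast
qed

lemma compact_bop_finite_rank:
  assumes "finite_rank (app f)"
  shows "compact_bop f"
proof -
  obtain S where S: "finite S" "range (app f) = cvs.span S"
    using assms unfolding finite_rank_def finite_dimensional_def by blast
  have "f \<cdot> x \<in> cball 0 (norm f) \<inter> cvs.span S" if x: "norm x \<le> 1" for x
    using norm_app[of f x] mult_left_mono[OF x, of "norm f"] S(2) by auto
  then show ?thesis unfolding compact_bop_iff using compact_cball_Int_span[OF S(1)] by blast
qed

lemma has_net_compact_bop: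
  assumes "compact_bop f" "0 < \<epsilon>"
  shows "has_net f \<epsilon>"
proof -
  obtain K where K: "compact K" "\<And>x. norm x \<le> 1 \<Longrightarrow> f \<cdot> x \<in> K"
    using assms unfolding compact_bop_iff by blast
  obtain A where A: "finite A" "K \<subseteq> (\<Union>a\<in>A. ball a \<epsilon>)"
    using K(1) \<open>0 < \<epsilon>\<close> unfolding compact_eq_totally_bounded by metis
  have "\<exists>a\<in>A. norm (f \<cdot> x - a) \<le> \<epsilon>" if x: "norm x \<le> 1" for x
  proof -
    obtain a where "a \<in> A" "f \<cdot> x \<in> ball a \<epsilon>" using A(2) K(2)[OF x] by blast
    then show ?thesis by (auto simp: dist_norm norm_minus_commute intro!: bexI[of _ a])
  qed
  then show ?thesis unfolding has_net_def using A(1) by blast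
qed

text \<open>
  The norm of the class of \<open>f\<close> in the Calkin algebra.
\<close>

definition essential_norm :: "'a::complex_normed_vector bop \<Rightarrow> real" where
  "essential_norm f = Inf {norm (f - k) |k. compact_bop k}"

lemma essential_norm_le: "compact_bop k \<Longrightarrow> essential_norm f \<le> norm (f - k)"
  unfolding essential_norm_def by (rule cInf_lower) (auto intro!: bdd_belowI[of _ 0])

lemma essential_norm_approx:
  assumes "essential_norm f < c"
  shows "\<exists>k. compact_bop k \<and> norm (f - k) < c"
proof -
  have "{norm (f - k) |k. compact_bop k} \<noteq> {}" using compact_bop_0 by blast
  then have "\<exists>x\<in>{norm (f - k) |k. compact_bop k}. x < c"
    using assms unfolding essential_norm_def by (subst (asm) cInf_less_iff) (auto intro!: bdd_belowI[of _ 0])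
  then show ?thesis by blast
qed

lemma essential_norm_nonneg: "0 \<le> essential_norm f"
proof (rule ccontr)
  assume "\<not> 0 \<le> essential_norm f"
  then obtain k where "norm (f - k) < 0" using essential_norm_approx[of f 0] by auto
  then show False by simp
qed

lemma essential_norm_compact: "compact_bop k \<Longrightarrow> essential_norm k = 0"
  using essential_norm_le[of k k] essential_norm_nonneg[of k] by simp

lemma essential_norm_scaleC_le: "essential_norm (z *\<^sub>C f) \<le> cmod z * essential_norm f"
proof (cases "z = 0")
  case True
  then show ?thesis by (simp add: essential_norm_compact compact_bop_0)
next
  case False
  show ?thesis
  proof (rule field_le_epsilon)
    fix e :: real assume "0 < e"
    then obtain k where k: "compact_bop k" "norm (f - k) < essential_norm f + e / cmod z"
      using essential_norm_approx[of f "essential_norm f + e / cmod z"] False by auto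
    have "essential_norm (z *\<^sub>C f) \<le> norm (z *\<^sub>C f - z *\<^sub>C k)"
      by (intro essential_norm_le compact_bop_scaleC k)
    also have "\<dots> = cmod z * norm (f - k)"
      by (simp add: norm_scaleC flip: cvs.scale_right_diff_distrib)
    also have "\<dots> \<le> cmod z * (essential_norm f + e / cmod z)"
      using k(2) by (intro mult_left_mono) auto
    also have "\<dots> = cmod z * essential_norm f + e" using False by (simp add: distrib_left)
    finally show "essential_norm (z *\<^sub>C f) \<le> cmod z * essential_norm f + e" .
  qed
qed

interpretation essential_norm: unital_seminorm "essential_norm :: 'a::complex_normed_vector bop \<Rightarrow> real"
proof
  fix f g :: "'a bop" and z :: complex
  show "essential_norm (f + g) \<le> essential_norm f + essential_norm g"
  proof (rule field_le_epsilon)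
    fix e :: real assume "0 < e"
    obtain k where k: "compact_bop k" "norm (f - k) < essential_norm f + e / 2"
      using essential_norm_approx[of f "essential_norm f + e / 2"] \<open>0 < e\<close> by auto
    obtain l where l: "compact_bop l" "norm (g - l) < essential_norm g + e / 2"
      using essential_norm_approx[of g "essential_norm g + e / 2"] \<open>0 < e\<close> by auto
    have "essential_norm (f + g) \<le> norm ((f - k) + (g - l))"
      using essential_norm_le[OF compact_bop_add[OF k(1) l(1)], of "f + g"] by (simp add: algebra_simps)
    then show "essential_norm (f + g) \<le> essential_norm f + essential_norm g + e"
      using norm_triangle_ineq[of "f - k" "g - l"] k(2) l(2) by linarith
  qed
  show "essential_norm (z *\<^sub>C f) = cmod z * essential_norm f"
  proof (cases "z = 0")
    case True
    then show ?thesis using essential_norm_compact[OF compact_bop_0] by simp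
  next
    case False
    have "essential_norm (inverse z *\<^sub>C z *\<^sub>C f) \<le> cmod (inverse z) * essential_norm (z *\<^sub>C f)"
      by (rule essential_norm_scaleC_le)
    then have "cmod z * essential_norm f \<le> essential_norm (z *\<^sub>C f)"
      using False by (simp add: scaleC_scaleC scaleC_one norm_inverse norm_divide field_simps)
    then show ?thesis using essential_norm_scaleC_le[of z f] by simp
  qed
  show "essential_norm (f * g) \<le> essential_norm f * essential_norm g"
  proof (rule tendsto_lowerbound)
    show "((\<lambda>e. (essential_norm f + e) * (essential_norm g + e)) \<longlongrightarrow>
        essential_norm f * essential_norm g) (at_right 0)"
      by (auto intro!: tendsto_eq_intros)
    show "\<forall>\<^sub>F e in at_right 0. essential_norm (f * g) \<le> (essential_norm f + e) * (essential_norm g + e)"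
      using eventually_at_right_less[of 0]
    proof eventually_elim
      case (elim e)
      obtain k where k: "compact_bop k" "norm (f - k) < essential_norm f + e"
        using essential_norm_approx[of f "essential_norm f + e"] elim by auto
      obtain l where l: "compact_bop l" "norm (g - l) < essential_norm g + e"
        using essential_norm_approx[of g "essential_norm g + e"] elim by auto
      have "compact_bop (k * g + (f - k) * l)"
        using k(1) l(1) by (intro compact_bop_add compact_bop_mult_left compact_bop_mult_right)
      then have "essential_norm (f * g) \<le> norm (f * g - (k * g + (f - k) * l))"
        by (rule essential_norm_le)
      also have "f * g - (k * g + (f - k) * l) = (f - k) * (g - l)" by (simp add: algebra_simps)
      also have "norm \<dots> \<le> norm (f - k) * norm (g - l)" by (rule norm_mult_ineq)
      also have "\<dots> \<le> (essential_norm f + e) * (essential_norm g + e)"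
        using k(2) l(2) essential_norm_nonneg[of f] elim by (intro mult_mono) auto
      finally show ?case .
    qed
  qed simp
  show "essential_norm (1 :: 'a bop) \<le> 1"
    using essential_norm_le[OF compact_bop_0, of "1 :: 'a bop"] norm_bop_one[where 'a = 'a] by simp
qed

lemma quasi_precompact_if_essential_norm_power_lt_1:
  assumes "1 \<le> n" "essential_norm (f ^ n) < 1"
  shows "quasi_precompact f"
proof -
  obtain k where k: "compact_bop k" "norm (f ^ n - k) < 1" using essential_norm_approx assms by blast
  define \<epsilon> where "\<epsilon> = (1 - norm (f ^ n - k)) / 2"
  have "0 < \<epsilon>" using k by (simp add: \<epsilon>_def)
  then have "has_net (k + (f ^ n - k)) (\<epsilon> + norm (f ^ n - k))"
    by (intro has_net_add has_net_compact_bop has_net_norm k)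
  then have "has_net (f ^ n) (\<epsilon> + norm (f ^ n - k))" by simp
  moreover have "\<epsilon> + norm (f ^ n - k) < 1" using k by (simp add: \<epsilon>_def field_simps)
  ultimately show ?thesis
    unfolding quasi_precompact_def using assms(1) \<open>0 < \<epsilon>\<close>
    by (intro exI[of _ n] conjI exI[of _ "\<epsilon> + norm (f ^ n - k)"]) auto
qed

section \<open>The Calkin algebra and the essential spectrum\<close>

lemma app_operations:
  "(\<lambda>x. f \<cdot> x + g \<cdot> x) = app (f + g)" "app f \<circ> app g = app (f * g)" "id = app 1" "(\<lambda>x. 0) = app 0"
  by auto

lemma bounded_operator_iff_app: "bounded_operator T \<longleftrightarrow> T \<in> range app"
proof
  assume "bounded_operator T"
  then show "T \<in> range app" using bounded_operator_imp_app by blast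
qed (use bounded_operator_app in auto)

lemma operator_ring_simps:
  "carrier operator_ring = range app"
  "app f \<otimes>\<^bsub>operator_ring\<^esub> app g = app (f * g)"
  "app f \<oplus>\<^bsub>operator_ring\<^esub> app g = app (f + g)"
  "\<one>\<^bsub>operator_ring\<^esub> = app 1" "\<zero>\<^bsub>operator_ring\<^esub> = app 0"
  by (simp_all add: operator_ring_def app_operations bounded_operator_iff_app set_eq_iff)

lemma ring_operator_ring: "ring (operator_ring :: ('a::complex_normed_vector \<Rightarrow> 'a) ring)"
proof (rule ringI)
  show "abelian_group (operator_ring :: ('a \<Rightarrow> 'a) ring)"
  proof (rule abelian_groupI)
    fix T :: "'a \<Rightarrow> 'a" assume "T \<in> carrier operator_ring"
    then obtain f where "T = app f" by (auto simp: operator_ring_simps)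
    then show "\<exists>S\<in>carrier operator_ring. S \<oplus>\<^bsub>operator_ring\<^esub> T = \<zero>\<^bsub>operator_ring\<^esub>"
      by (intro bexI[of _ "app (- f)"]) (simp_all only: operator_ring_simps, simp_all)
  qed (auto simp: operator_ring_simps add.assoc add.commute)
  show "Group.monoid (operator_ring :: ('a \<Rightarrow> 'a) ring)"
    by (rule monoidI) (auto simp: operator_ring_simps mult.assoc)
qed (auto simp: operator_ring_simps distrib_left distrib_right)

lemma ideal_compact_operators:
  "ideal (Collect compact_operator) (operator_ring :: ('a::complex_normed_vector \<Rightarrow> 'a) ring)"
proof -
  interpret ring "operator_ring :: ('a \<Rightarrow> 'a) ring" by (rule ring_operator_ring)
  have compact: "T \<in> Collect compact_operator \<longleftrightarrow> (\<exists>f. T = app f \<and> compact_bop f)" for T :: "'a \<Rightarrow> 'a"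
    using bounded_operator_iff_app[of T] by (auto simp: compact_bop_def compact_operator_def)
  show ?thesis
  proof (rule idealI[OF ring_operator_ring])
    show "subgroup (Collect compact_operator) (add_monoid (operator_ring :: ('a \<Rightarrow> 'a) ring))"
    proof (rule add.subgroupI)
      show "Collect compact_operator \<subseteq> carrier (operator_ring :: ('a \<Rightarrow> 'a) ring)"
        unfolding subset_iff compact by (auto simp: operator_ring_simps)
      show "Collect compact_operator \<noteq> ({} :: ('a \<Rightarrow> 'a) set)"
        using compact compact_bop_0 by blast
    next
      fix T :: "'a \<Rightarrow> 'a" assume "T \<in> Collect compact_operator"
      then obtain f where f: "T = app f" "compact_bop f" unfolding compact by blast
      have "\<ominus>\<^bsub>operator_ring\<^esub> T = app (- f)"
        by (rule minus_equality) (simp_all add: f operator_ring_simps)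
      then show "\<ominus>\<^bsub>operator_ring\<^esub> T \<in> Collect compact_operator"
        using compact_bop_minus[OF f(2)] compact by blast
    next
      fix S T :: "'a \<Rightarrow> 'a" assume "S \<in> Collect compact_operator" "T \<in> Collect compact_operator"
      then show "S \<oplus>\<^bsub>operator_ring\<^esub> T \<in> Collect compact_operator"
        unfolding compact by (metis compact_bop_add operator_ring_simps(3))
    qed
  next
    fix S T :: "'a \<Rightarrow> 'a" assume "S \<in> Collect compact_operator" "T \<in> carrier operator_ring"
    then obtain f g where fg: "S = app f" "compact_bop f" "T = app g"
      unfolding compact by (auto simp: operator_ring_simps)
    show "T \<otimes>\<^bsub>operator_ring\<^esub> S \<in> Collect compact_operator"
      using compact_bop_mult_left[OF fg(2), of g] unfolding compact fg operator_ring_simps by blast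
    show "S \<otimes>\<^bsub>operator_ring\<^esub> T \<in> Collect compact_operator"
      using compact_bop_mult_right[OF fg(2), of g] unfolding compact fg operator_ring_simps by blast
  qed
qed

text \<open>
  Every coset is the class of an operator, so the quotient ring can be left at this point.
\<close>

lemma calkin_class_unit_iff:
  fixes f :: "'a::complex_normed_vector bop"
  shows "calkin_class (app f) \<in> Units calkin_ring \<longleftrightarrow>
    (\<exists>s. compact_bop (s * f - 1) \<and> compact_bop (f * s - 1))"
proof -
  interpret ring "operator_ring :: ('a \<Rightarrow> 'a) ring" by (rule ring_operator_ring)
  interpret I: ideal "Collect compact_operator" "operator_ring :: ('a \<Rightarrow> 'a) ring"
    by (rule ideal_compact_operators)
  have carrier: "carrier (calkin_ring :: ('a \<Rightarrow> 'a) set ring) = range (\<lambda>g. calkin_class (app g))"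
    by (auto simp: calkin_ring_def FactRing_def A_RCOSETS_def' operator_ring_simps calkin_class_def)
  have mult: "calkin_class (app g) \<otimes>\<^bsub>calkin_ring\<^esub> calkin_class (app h) = calkin_class (app (g * h))"
    for g h :: "'a bop"
    using I.rcoset_mult_add[of "app g" "app h"]
    by (simp add: calkin_ring_def FactRing_def calkin_class_def operator_ring_simps)
  have one: "\<one>\<^bsub>calkin_ring\<^esub> = calkin_class (app (1 :: 'a bop))"
    by (simp add: calkin_ring_def FactRing_def calkin_class_def operator_ring_simps)
  have eq: "calkin_class (app g) = calkin_class (app h) \<longleftrightarrow> compact_bop (g - h)" for g h :: "'a bop"
  proof -
    have "\<ominus>\<^bsub>operator_ring\<^esub> app h = app (- h)"
      by (rule minus_equality) (simp_all add: operator_ring_simps)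
    then have "app g \<ominus>\<^bsub>operator_ring\<^esub> app h = app (g - h)"
      by (simp add: a_minus_def operator_ring_simps)
    then show ?thesis
      using quotient_eq_iff_same_a_r_cos[OF ideal_compact_operators, of "app g" "app h"]
      by (simp add: calkin_class_def compact_bop_def operator_ring_simps)
  qed
  show ?thesis unfolding Units_def carrier by (auto simp: mult one eq)
qed

lemma not_in_essential_spectrum_iff:
  "z \<notin> essential_spectrum (app t) \<longleftrightarrow>
    (\<exists>s. compact_bop (s * (z *\<^sub>C 1 - t) - 1) \<and> compact_bop ((z *\<^sub>C 1 - t) * s - 1))"
proof -
  have "(\<lambda>x. z *\<^sub>C x - app t x) = app (z *\<^sub>C 1 - t)" by auto
  then show ?thesis unfolding essential_spectrum_def by (simp add: calkin_class_unit_iff)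
qed

lemma power_essentially_small_if_essential_spectrum_in_disc:
  assumes "0 < \<rho>" "\<And>z. z \<in> essential_spectrum (app t) \<Longrightarrow> cmod z < \<rho>"
  shows "\<exists>n\<ge>1. essential_norm (t ^ n) < \<rho> ^ n"
proof (rule essential_norm.power_small_if_resolvent_everywhere[OF assms(1)])
  fix z assume "\<rho> \<le> cmod z"
  then have "z \<notin> essential_spectrum (app t)" using assms(2) by force
  then show "\<exists>s. essential_norm.sim (s * (z *\<^sub>C 1 - t)) 1 \<and> essential_norm.sim ((z *\<^sub>C 1 - t) * s) 1"
    unfolding not_in_essential_spectrum_iff essential_norm.sim_def
    using essential_norm_compact by blast
qed

lemma essential_spectrum_bounded:
  fixes t :: "'a::{complex_normed_vector, banach} bop"
  assumes "z \<in> essential_spectrum (app t)"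
  shows "cmod z \<le> norm t"
proof (rule ccontr)
  assume "\<not> cmod z \<le> norm t"
  then obtain s where "s * (z *\<^sub>C 1 - t) = 1" "(z *\<^sub>C 1 - t) * s = 1"
    using invertible_scaleC_minus[of t z] by (auto simp: invertible_in_ring_def)
  then have "z \<notin> essential_spectrum (app t)"
    unfolding not_in_essential_spectrum_iff by (intro exI[of _ s]) (simp add: compact_bop_0)
  then show False using assms by blast
qed

text \<open>
  If it were empty, \<open>t\<close> would have an essential inverse \<open>s\<close>, while the essential norms of the powers
  of \<open>t\<close> decrease faster than any geometric sequence; so \<open>1 = s\<^sup>n t\<^sup>n\<close> would have essential norm less
  than \<open>1\<close>. Then the identity is quasi-precompact and its fixed space, the whole space, is
  finite-dimensional.
\<close>

lemma essential_spectrum_nonempty: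
  assumes "\<not> finite_dimensional (UNIV :: 'a::complex_normed_vector set)"
  shows "essential_spectrum (app (t :: 'a bop)) \<noteq> {}"
proof
  assume empty: "essential_spectrum (app t) = {}"
  then obtain s where "compact_bop (s * (0 *\<^sub>C 1 - t) - 1)"
    using not_in_essential_spectrum_iff[of 0 t] by auto
  then have "essential_norm.sim (- s * t) 1"
    unfolding essential_norm.sim_def using essential_norm_compact by fastforce
  then obtain s where s: "essential_norm.sim (s * t) 1" by blast
  have pow: "essential_norm.sim (s ^ n * t ^ n) 1" for n
  proof (induction n)
    case (Suc n)
    have "essential_norm.sim (s ^ n * (s * t) * t ^ n) (s ^ n * 1 * t ^ n)"
      by (intro essential_norm.sim_mult essential_norm.sim_refl s)
    then have "essential_norm.sim (s ^ Suc n * t ^ Suc n) (s ^ n * t ^ n)"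
      by (simp only: power_Suc2[of s] power_Suc[of t] mult.assoc mult_1_right mult_1_left)
    then show ?case using Suc by (rule essential_norm.sim_trans)
  qed simp
  define c where "c = essential_norm s + 1"
  have c: "0 < c" "essential_norm s < c" using essential_norm_nonneg[of s] by (auto simp: c_def)
  obtain n where n: "1 \<le> n" "essential_norm (t ^ n) < inverse c ^ n"
    using power_essentially_small_if_essential_spectrum_in_disc[of "inverse c" t] empty c by auto
  have "essential_norm (1 :: 'a bop) = essential_norm (s ^ n * t ^ n)"
    using essential_norm.sim_eq[OF pow] by simp
  also have "\<dots> \<le> essential_norm (s ^ n) * essential_norm (t ^ n)" by (rule essential_norm.submult)
  also have "\<dots> \<le> c ^ n * essential_norm (t ^ n)"
  proof (intro mult_right_mono essential_norm_nonneg)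
    have "essential_norm (s ^ n) \<le> essential_norm s ^ n" by (rule essential_norm.power_le)
    also have "\<dots> \<le> c ^ n" using c essential_norm_nonneg by (intro power_mono) auto
    finally show "essential_norm (s ^ n) \<le> c ^ n" .
  qed
  also have "\<dots> < c ^ n * inverse c ^ n" using n c by (intro mult_strict_left_mono) auto
  also have "\<dots> = 1" using c by (simp flip: power_mult_distrib)
  finally have "quasi_precompact (1 :: 'a bop)"
    by (intro quasi_precompact_if_essential_norm_power_lt_1[of 1]) auto
  then have "finite_dimensional (fixed_space (1 :: 'a bop))" by (rule fixed_space_finite_dimensional)
  then show False using assms by (simp add: fixed_space_def)
qed

text \<open>
  In finite dimension every operator is compact. In infinite dimension the essential spectrum is
  bounded, so its supremum below \<open>1\<close> confines it to the open unit disc.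
\<close>

section \<open>Quasicompact endomorphisms\<close>

lemma quasicompact_imp_quasi_precompact:
  fixes t :: "'a::{complex_normed_vector, banach} bop"
  assumes "quasicompact (app t)"
  shows "quasi_precompact t"
proof (cases "finite_dimensional (UNIV :: 'a set)")
  case True
  then obtain S :: "'a set" where S: "finite S" "UNIV = cvs.span S" by (auto simp: finite_dimensional_def)
  have "compact (cball 0 (norm t) \<inter> cvs.span S)" by (rule compact_cball_Int_span[OF S(1)])
  then have "compact (cball (0::'a) (norm t))" by (simp flip: S(2))
  moreover have "t \<cdot> x \<in> cball 0 (norm t)" if x: "norm x \<le> 1" for x
    using norm_app[of t x] mult_left_mono[OF x, of "norm t"] by simp
  ultimately have "compact_bop t" unfolding compact_bop_iff by blast
  then show ?thesis
    by (intro quasi_precompact_if_essential_norm_power_lt_1[of 1]) (simp_all add: essential_norm_compact)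
next
  case False
  then have radius: "essential_spectral_radius (app t) < 1" using assms by (simp add: quasicompact_def)
  have "bdd_above (cmod ` essential_spectrum (app t))"
    using essential_spectrum_bounded by (intro bdd_aboveI[of _ "norm t"]) auto
  then have "cmod z < 1" if "z \<in> essential_spectrum (app t)" for z
    using that radius unfolding essential_spectral_radius_def
    by (meson cSup_upper imageI le_less_trans)
  then obtain n where "1 \<le> n" "essential_norm (t ^ n) < 1 ^ n"
    using power_essentially_small_if_essential_spectrum_in_disc[of 1 t] by auto
  then show ?thesis by (intro quasi_precompact_if_essential_norm_power_lt_1) auto
qed

text \<open>
  With \<open>a = z\<^sup>m - (t\<^sup>m - k)\<close>, inverted by \<open>g\<close>, both products of \<open>z - t\<close> with its cofactor \<open>q\<close> in
  \<open>z\<^sup>m - t\<^sup>m\<close> equal \<open>a - k\<close>. So \<open>g q\<close> is a left inverse and \<open>q g\<close> a right inverse modulo compact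
  operators, and the two agree modulo compact operators.
\<close>

lemma essentially_invertible_if_power_near_compact:
  fixes t :: "'a::{complex_normed_vector, banach} bop"
  assumes "compact_bop k" "norm (t ^ m - k) < cmod z ^ m"
  shows "z \<notin> essential_spectrum (app t)"
proof -
  define a where "a = z ^ m *\<^sub>C 1 - (t ^ m - k)"
  obtain g where g: "g * a = 1" "a * g = 1"
    using invertible_scaleC_minus[of "t ^ m - k" "z ^ m"] assms(2)
    by (auto simp: a_def invertible_in_ring_def norm_power)
  define q where "q = geometric_quotient z t m"
  define f where "f = z *\<^sub>C 1 - t"
  have q: "f * q = a - k" "q * f = a - k"
    by (simp_all add: a_def f_def q_def geometric_quotient_left geometric_quotient_right)
  have "(g * q) * f - 1 = - (g * k)" by (simp add: mult.assoc q right_diff_distrib g)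
  then have left: "compact_bop ((g * q) * f - 1)"
    using assms(1) by (simp add: compact_bop_minus compact_bop_mult_left)
  have "f * (q * g) - 1 = - (k * g)" by (simp add: q left_diff_distrib g flip: mult.assoc)
  then have right: "compact_bop (f * (q * g) - 1)"
    using assms(1) by (simp add: compact_bop_minus compact_bop_mult_right)
  \<comment> \<open>A left inverse \<open>l\<close> and a right inverse \<open>r\<close> modulo an ideal differ by an element of the ideal.\<close>
  have "f * l - 1 = f * ((l * f - 1) * r - l * (f * r - 1)) + (f * r - 1)" for l r
    by (simp add: algebra_simps)
  from this[of "g * q" "q * g"]
have "compact_bop (f * (g * q) - 1)"
    using left right
    by (simp only: compact_bop_add compact_bop_diff compact_bop_mult_left compact_bop_mult_right)
  then show ?thesis using left unfolding not_in_essential_spectrum_iff f_def by blast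
qed

lemma quasicompact_if_power_near_compact:
  fixes t :: "'a::{complex_normed_vector, banach} bop"
  assumes "compact_bop k" "1 \<le> m" "norm (t ^ m - k) < 1"
  shows "quasicompact (app t)"
proof (cases "finite_dimensional (UNIV :: 'a set)")
  case True
  then show ?thesis by (simp add: quasicompact_def bounded_operator_app)
next
  case False
  define r where "r = root m (norm (t ^ m - k))"
  have "r < 1" using assms by (simp add: r_def)
  have "cmod z \<le> r" if "z \<in> essential_spectrum (app t)" for z
  proof -
    have "cmod z ^ m \<le> norm (t ^ m - k)"
      using essentially_invertible_if_power_near_compact[OF assms(1), of t m z] that by force
    then have "root m (cmod z ^ m) \<le> r" using assms(2) by (simp add: r_def)
    then show ?thesis using assms(2) by (simp add: real_root_power_cancel)
  qed
  \<comment> \<open>The essential spectrum must be nonempty here: the supremum of the empty set is unspecified.\<close>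
  then have "essential_spectral_radius (app t) \<le> r"
    unfolding essential_spectral_radius_def
    using essential_spectrum_nonempty[OF False] by (intro cSup_least) auto
  then show ?thesis using \<open>r < 1\<close> by (simp add: quasicompact_def bounded_operator_app)
qed

lemma converges_in_operator_norm_iff:
  "converges_in_operator_norm (\<lambda>k. app (U k)) (app P) \<longleftrightarrow> U \<longlonglongrightarrow> P"
proof -
  have "(\<lambda>k. onorm (\<lambda>x. U k \<cdot> x - P \<cdot> x)) = (\<lambda>k. norm (U k - P))"
    by (simp add: norm_bop_eq_onorm)
  then show ?thesis
    unfolding converges_in_operator_norm_def
    by (simp add: bounded_operator_app tendsto_norm_zero_iff LIM_zero_iff)
qed

theorem theorem1p2:
  fixes T :: "'a::unital_comm_complex_banach_algebra \<Rightarrow> 'a"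
  assumes "semiprime TYPE('a)"
    and "bounded_operator T"
    and "unital_endomorphism T"
  shows "quasicompact T \<longleftrightarrow>
    (\<exists>n\<ge>1. \<exists>S. finite_rank S \<and> unital_endomorphism S \<and>
       converges_in_operator_norm (\<lambda>k. T ^^ (k * n)) S)"
proof -
  obtain t where T: "T = app t" using assms(2) by (auto simp: bounded_operator_iff_app)
  have T_power: "T ^^ k = app (t ^ k)" for k
    unfolding T by (rule ext) (simp add: app_power)
  show ?thesis
  proof
    assume "quasicompact T"
    then have "quasi_precompact t" unfolding T by (rule quasicompact_imp_quasi_precompact)
    moreover have "t \<cdot> (x * y) = t \<cdot> x * t \<cdot> y" "t \<cdot> 1 = 1" for x y
      using assms(3) by (simp_all add: T unital_endomorphism_def endomorphism_def)
    ultimately obtain P n where "1 \<le> n" "finite_rank (app P)" "unital_endomorphism (app P)"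
        "(\<lambda>k. t ^ (k * n)) \<longlonglongrightarrow> P"
      using quasi_precompact_endomorphism_powers_converge[OF semiprime_square_zero[OF assms(1)], of t]
      by auto
    then show "\<exists>n\<ge>1. \<exists>S. finite_rank S \<and> unital_endomorphism S \<and>
       converges_in_operator_norm (\<lambda>k. T ^^ (k * n)) S"
      unfolding T_power by (metis converges_in_operator_norm_iff)
  next
    assume "\<exists>n\<ge>1. \<exists>S. finite_rank S \<and> unital_endomorphism S \<and>
       converges_in_operator_norm (\<lambda>k. T ^^ (k * n)) S"
    then obtain n S where n: "1 \<le> n" and S: "finite_rank S"
      "converges_in_operator_norm (\<lambda>k. T ^^ (k * n)) S" by blast
    have "bounded_operator S" using S(2) by (simp add: converges_in_operator_norm_def)
    then obtain P where P: "S = app P" by (auto simp: bounded_operator_iff_app)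
    have "(\<lambda>k. t ^ (k * n)) \<longlonglongrightarrow> P"
      using S(2) unfolding P T_power by (simp add: converges_in_operator_norm_iff)
    then obtain k0 where "\<And>k. k0 \<le> k \<Longrightarrow> norm (t ^ (k * n) - P) < 1"
      unfolding LIMSEQ_iff by (meson zero_less_one)
    then have "norm (t ^ (Suc k0 * n) - P) < 1" by (meson le_SucI order_refl)
    moreover have "1 \<le> Suc k0 * n" using n by simp
    ultimately show "quasicompact T"
      unfolding T using quasicompact_if_power_near_compact compact_bop_finite_rank S(1)[unfolded P] by blast
  qed
qed

end
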